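(* Let $\mathcal{C}$ be a (finitely) complete and cocomplete category such that $\mathcal{C}^{\Delta^{\mathrm{op}}}$ is symmetric with respect to a class of weak equivalences $\mathcal{W}$ satisfying (W1) and (W2) (for example $\mathcal{C}$ Abelian with $\mathcal{W}$ the quasi-isomorphisms, or $\mathcal{C}=\mathrm{Set}$ with $\mathcal{W}$ the usual weak equivalences). Then the Alexander–Whitney morphism $\mathfrak{Aw}:\delta^*\to\mathrm{dec}_*$ and the Eilenberg–Zilber morphism $\mathfrak{Ez}:\mathrm{dec}_*\to\delta^*$ are mutually inverse isomorphisms $$\mathrm{dec}_*\cong\delta^*$$ in $\mathrm{Fun}(\mathcal{C}^{\Delta^{\mathrm{op}}\times\Delta^{\mathrm{op}}},\mathcal{C}^{\Delta^{\mathrm{op}}})[\mathcal{W}^{-1}]$. If $\mathcal{C}^{\Delta^{\mathrm{op}}}$ is strongly symmetric, (W2) is not needed.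
   Context: Notation. $\mathrm{dec}:\Delta\times\Delta\to\Delta$, $([n],[m])\mapsto[n]\ast[m]=[n+m+1]$ (concatenation), $\delta:\Delta\to\Delta\times\Delta$ the diagonal; $\mathrm{dec}^*:\mathcal{C}^{\Delta^{\mathrm{op}}}\to\mathcal{C}^{\Delta^{\mathrm{op}}\times\Delta^{\mathrm{op}}}$ and $\delta^*$ are the induced pull-backs and $\mathrm{dec}_*$ is the right adjoint of $\mathrm{dec}^*$. $\mathrm{FinSet}$ is the category of non-empty finite sets, $\iota:\Delta\to\mathrm{FinSet}$ the forgetful functor, $\mathrm{dec}_s=\coprod:\mathrm{FinSet}^2\to\mathrm{FinSet}$ and $\delta_s:\mathrm{FinSet}\to\mathrm{FinSet}^2$ the diagonal. $\mathcal{W}$ is a class of morphisms of $\mathcal{C}^{\Delta^{\mathrm{op}}}$. Axioms: (W1) $\Delta_1\otimes X\to X$ is in $\mathcal{W}$ for all $X$ (point-wise tensoring with the simplicial set $\Delta_1$), or equivalently $X\to\mathcal{HOM}(\Delta_1,X)$ is in $\mathcal W$ for all $X$ (cotensoring of the canonical simplicial enrichment); (W2) $\delta^*:\mathcal{C}^{\Delta^{\mathrm{op}}\times\Delta^{\mathrm{op}}}\to\mathcal{C}^{\Delta^{\mathrm{op}}}$ maps morphisms that are point-wise (in one of the two directions) weak equivalences to weak equivalences. Symmetric: $\mathcal{C}^{\Delta^{\mathrm{op}}}$ with $\mathcal{W}$ is symmetric (resp. strongly symmetric) if there is a functor $\mathfrak{C}:\mathcal{C}^{\Delta^{\mathrm{op}}}\to\mathcal{C}^{\mathrm{FinSet}^{\mathrm{op}}}$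 with a natural transformation $\mathrm{id}\to\iota^*\mathfrak{C}$ that is object-wise a weak equivalence (resp. an isomorphism). Such data are fixed. (For $\mathcal{C}=\mathrm{Set}$ one takes $\mathfrak C X=$ singular complex of the geometric realization with the symmetric group action on topological simplices; for $\mathcal{C}$ abelian one takes $\mathfrak{C}(X)_{[n]}=\mathrm{Hom}(\Delta_n^\circ,X)$, where $X$ is viewed as a complex by Dold–Kan, $\Delta_n^\circ$ is the normalized chain complex of the standard simplex, with basis the non-empty subsets of $\{0,\dots,n\}$, and maps of finite sets act by sending a subset to its image with the sign of the induced permutation if the map is injective on it, and to $0$ otherwise.) The natural transformation $u^{\mathrm{op}}:\mathrm{dec}^*\delta^*\to\mathrm{id}$ is $X_{[n]\ast[m],[n]\ast[m]}\to X_{[n],[m]}$ induced by the inclusions $[n]\hookrightarrow[n]\ast[m]\hookleftarrow[m]$. The natural transformation $c^{\mathrm{op}}:\mathrm{id}\to\delta_s^*\mathrm{dec}_s^*$ on $\mathcal{C}^{\mathrm{FinSet}^{\mathrm{op}}}$ is induced by the fold maps $S\coprod S\to S$. The morphism "$c^{\mathrm{op}}$": $\mathrm{id}\to\delta^*\mathrm{dec}^*$ in $\mathrm{Fun}(\mathcal{C}^{\Delta^{\mathrm{op}}},\mathcal{C}^{\Delta^{\mathrm{op}}})[\mathcal{W}^{-1}]$ is the composite $\mathrm{id}\to\iota^*\mathfrak{C}\xrightarrow{\iota^*c^{\mathrm{op}}\mathfrak{C}}\iota^*\delta_s^*\mathrm{dec}_s^*\mathfrak{C}=\delta^*\mathrm{dec}^*\iota^*\mathfrak{C}\xleftarrow{\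 \in\mathcal{W}\ }\delta^*\mathrm{dec}^*$ (an honest natural transformation in the strongly symmetric case). $\mathfrak{Aw}$ is the composite $\delta^*\to\mathrm{dec}_*\mathrm{dec}^*\delta^*\xrightarrow{\mathrm{dec}_*u^{\mathrm{op}}}\mathrm{dec}_*$ (first map the unit), and $\mathfrak{Ez}$ is the composite $\mathrm{dec}_*\xrightarrow{\text{"}c^{\mathrm{op}}\text{"}\,\mathrm{dec}_*}\delta^*\mathrm{dec}^*\mathrm{dec}_*\to\delta^*$ (last map the counit). In functor categories, $[\mathcal{W}^{-1}]$ means inverting natural transformations that are object-wise in $\mathcal{W}$.
   Formalization: In the symmetric case the class of weak equivalences W is also assumed weakly saturated (identities; 2-out-of-3; ri = 1 and ir in W imply r in W), so that the reversed arrow in "c^op" lies in W; the strongly symmetric case needs no such assumption. *)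

theory Defs
  imports Main "HOL-Library.FuncSet"
begin

section \<open>Categories, functors, natural transformations\<close>

record ('o, 'm) cat =
  Obj :: "'o set"
  Arr :: "'m set"
  Dom :: "'m \<Rightarrow> 'o"
  Cod :: "'m \<Rightarrow> 'o"
  Idt :: "'o \<Rightarrow> 'm"
  Cmp :: "'m \<Rightarrow> 'm \<Rightarrow> 'm"  \<comment> \<open>\<open>Cmp C g f\<close> is \<open>g\<close> after \<open>f\<close>\<close>

definition hom :: "('o, 'm) cat \<Rightarrow> 'o \<Rightarrow> 'o \<Rightarrow> 'm set" where
  "hom C X Y = {f \<in> Arr C. Dom C f = X \<and> Cod C f = Y}"

locale category =
  fixes C :: "('o, 'm) cat"
  assumes Dom_Obj: "f \<in> Arr C \<Longrightarrow> Dom C f \<in> Obj C"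
    and Cod_Obj: "f \<in> Arr C \<Longrightarrow> Cod C f \<in> Obj C"
    and Idt_hom: "X \<in> Obj C \<Longrightarrow> Idt C X \<in> hom C X X"
    and Cmp_hom: "f \<in> hom C X Y \<Longrightarrow> g \<in> hom C Y Z \<Longrightarrow> Cmp C g f \<in> hom C X Z"
    and Cmp_Idt_left: "f \<in> hom C X Y \<Longrightarrow> Cmp C (Idt C Y) f = f"
    and Cmp_Idt_right: "f \<in> hom C X Y \<Longrightarrow> Cmp C f (Idt C X) = f"
    and Cmp_assoc: "f \<in> hom C X Y \<Longrightarrow> g \<in> hom C Y Z \<Longrightarrow> h \<in> hom C Z V \<Longrightarrow>
      Cmp C h (Cmp C g f) = Cmp C (Cmp C h g) f"

definition inverse_arrows :: "('o, 'm) cat \<Rightarrow> 'm \<Rightarrow> 'm \<Rightarrow> bool" where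
  "inverse_arrows C f g \<longleftrightarrow> f \<in> Arr C \<and> g \<in> hom C (Cod C f) (Dom C f) \<and>
     Cmp C g f = Idt C (Dom C f) \<and> Cmp C f g = Idt C (Cod C f)"

definition iso_arrow :: "('o, 'm) cat \<Rightarrow> 'm \<Rightarrow> bool" where
  "iso_arrow C f \<longleftrightarrow> (\<exists>g. inverse_arrows C f g)"

definition inv_arrow :: "('o, 'm) cat \<Rightarrow> 'm \<Rightarrow> 'm" where
  "inv_arrow C f = (THE g. inverse_arrows C f g)"

definition op_cat :: "('o, 'm) cat \<Rightarrow> ('o, 'm) cat" where
  "op_cat C = \<lparr>Obj = Obj C, Arr = Arr C, Dom = Cod C, Cod = Dom C, Idt = Idt C,
     Cmp = (\<lambda>g f. Cmp C f g)\<rparr>"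

definition prod_cat :: "('o, 'm) cat \<Rightarrow> ('p, 'n) cat \<Rightarrow> ('o \<times> 'p, 'm \<times> 'n) cat" where
  "prod_cat C D = \<lparr>Obj = Obj C \<times> Obj D, Arr = Arr C \<times> Arr D,
     Dom = map_prod (Dom C) (Dom D), Cod = map_prod (Cod C) (Cod D),
     Idt = map_prod (Idt C) (Idt D),
     Cmp = (\<lambda>(g, g') (f, f'). (Cmp C g f, Cmp D g' f'))\<rparr>"

text \<open>Functors and transformations are extensional functions (undefined outside the objects and
  arrows of the source), so that equality of functors is equality in HOL.\<close>

datatype ('a, 'b, 'c, 'd) ftr = Ftr (fob: "'a \<Rightarrow> 'c") (far: "'b \<Rightarrow> 'd")

definition is_functor :: "('a, 'b) cat \<Rightarrow> ('c, 'd) cat \<Rightarrow> ('a, 'b, 'c, 'd) ftr \<Rightarrow> bool" where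
  "is_functor J C F \<longleftrightarrow> fob F \<in> Obj J \<rightarrow>\<^sub>E Obj C \<and> far F \<in> Arr J \<rightarrow>\<^sub>E Arr C \<and>
     (\<forall>f\<in>Arr J. far F f \<in> hom C (fob F (Dom J f)) (fob F (Cod J f))) \<and>
     (\<forall>X\<in>Obj J. far F (Idt J X) = Idt C (fob F X)) \<and>
     (\<forall>f\<in>Arr J. \<forall>g\<in>Arr J. Cod J f = Dom J g \<longrightarrow>
        far F (Cmp J g f) = Cmp C (far F g) (far F f))"

definition id_ftr :: "('a, 'b) cat \<Rightarrow> ('a, 'b, 'a, 'b) ftr" where
  "id_ftr C = Ftr (\<lambda>X\<in>Obj C. X) (\<lambda>f\<in>Arr C. f)"

text \<open>\<open>comp_ftr J G F\<close> is \<open>G\<close> after \<open>F\<close>, where \<open>J\<close> is the source of \<open>F\<close>.\<close>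

definition comp_ftr ::
  "('a, 'b) cat \<Rightarrow> ('c, 'd, 'e, 'f) ftr \<Rightarrow> ('a, 'b, 'c, 'd) ftr \<Rightarrow> ('a, 'b, 'e, 'f) ftr" where
  "comp_ftr J G F = Ftr (\<lambda>X\<in>Obj J. fob G (fob F X)) (\<lambda>f\<in>Arr J. far G (far F f))"

datatype ('a, 'b, 'c, 'd) nt =
  NT (src: "('a, 'b, 'c, 'd) ftr") (tgt: "('a, 'b, 'c, 'd) ftr") (component: "'a \<Rightarrow> 'd")

definition is_nat_trans :: "('a, 'b) cat \<Rightarrow> ('c, 'd) cat \<Rightarrow> ('a, 'b, 'c, 'd) nt \<Rightarrow> bool" where
  "is_nat_trans J C t \<longleftrightarrow> is_functor J C (src t) \<and> is_functor J C (tgt t) \<and>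
     component t \<in> extensional (Obj J) \<and>
     (\<forall>X\<in>Obj J. component t X \<in> hom C (fob (src t) X) (fob (tgt t) X)) \<and>
     (\<forall>f\<in>Arr J. Cmp C (component t (Cod J f)) (far (src t) f) =
        Cmp C (far (tgt t) f) (component t (Dom J f)))"

definition fun_cat ::
  "('a, 'b) cat \<Rightarrow> ('c, 'd) cat \<Rightarrow> (('a, 'b, 'c, 'd) ftr, ('a, 'b, 'c, 'd) nt) cat" where
  "fun_cat J C = \<lparr>Obj = {F. is_functor J C F}, Arr = {t. is_nat_trans J C t},
     Dom = src, Cod = tgt,
     Idt = (\<lambda>F. NT F F (\<lambda>X\<in>Obj J. Idt C (fob F X))),
     Cmp = (\<lambda>s t. NT (src t) (tgt s) (\<lambda>X\<in>Obj J. Cmp C (component s X) (component t X)))\<rparr>"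

text \<open>Whiskering: \<open>whisker_left J H t\<close> is \<open>H t\<close>, and \<open>whisker_right J t K\<close> is \<open>t K\<close>; in both cases
  \<open>J\<close> is the source of the resulting functors.\<close>

definition whisker_left ::
  "('a, 'b) cat \<Rightarrow> ('c, 'd, 'e, 'f) ftr \<Rightarrow> ('a, 'b, 'c, 'd) nt \<Rightarrow> ('a, 'b, 'e, 'f) nt" where
  "whisker_left J H t = NT (comp_ftr J H (src t)) (comp_ftr J H (tgt t))
     (\<lambda>X\<in>Obj J. far H (component t X))"

definition whisker_right ::
  "('a, 'b) cat \<Rightarrow> ('c, 'd, 'e, 'f) nt \<Rightarrow> ('a, 'b, 'c, 'd) ftr \<Rightarrow> ('a, 'b, 'e, 'f) nt" where
  "whisker_right J t K = NT (comp_ftr J (src t) K) (comp_ftr J (tgt t) K)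
     (\<lambda>X\<in>Obj J. component t (fob K X))"

text \<open>For \<open>K : I \<rightarrow> J\<close>, the pull-back \<open>K\<^sup>* : C\<^sup>J \<rightarrow> C\<^sup>I\<close>.\<close>

definition pull_back ::
  "('a, 'b) cat \<Rightarrow> ('c, 'd) cat \<Rightarrow> ('e, 'f) cat \<Rightarrow> ('a, 'b, 'c, 'd) ftr \<Rightarrow>
   (('c, 'd, 'e, 'f) ftr, ('c, 'd, 'e, 'f) nt, ('a, 'b, 'e, 'f) ftr, ('a, 'b, 'e, 'f) nt) ftr" where
  "pull_back I J C K = Ftr (\<lambda>X\<in>Obj (fun_cat J C). comp_ftr I X K)
     (\<lambda>t\<in>Arr (fun_cat J C). whisker_right I t K)"

definition adjunction ::
  "('a, 'b) cat \<Rightarrow> ('c, 'd) cat \<Rightarrow> ('a, 'b, 'c, 'd) ftr \<Rightarrow> ('c, 'd, 'a, 'b) ftr \<Rightarrow>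
   ('a, 'b, 'a, 'b) nt \<Rightarrow> ('c, 'd, 'c, 'd) nt \<Rightarrow> bool" where
  "adjunction A B L R \<eta> \<epsilon> \<longleftrightarrow> is_functor A B L \<and> is_functor B A R \<and>
     \<eta> \<in> hom (fun_cat A A) (id_ftr A) (comp_ftr A R L) \<and>
     \<epsilon> \<in> hom (fun_cat B B) (comp_ftr B L R) (id_ftr B) \<and>
     (\<forall>X\<in>Obj A. Cmp B (component \<epsilon> (fob L X)) (far L (component \<eta> X)) = Idt B (fob L X)) \<and>
     (\<forall>Y\<in>Obj B. Cmp A (far R (component \<epsilon> Y)) (component \<eta> (fob R Y)) = Idt A (fob R Y))"


section \<open>Finite limits and colimits\<close>

definition is_cone ::
  "('a, 'b) cat \<Rightarrow> ('o, 'm) cat \<Rightarrow> ('a, 'b, 'o, 'm) ftr \<Rightarrow> 'o \<Rightarrow> ('a \<Rightarrow> 'm) \<Rightarrow> bool" where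
  "is_cone J C D L p \<longleftrightarrow> L \<in> Obj C \<and> (\<forall>j\<in>Obj J. p j \<in> hom C L (fob D j)) \<and>
     (\<forall>f\<in>Arr J. Cmp C (far D f) (p (Dom J f)) = p (Cod J f))"

definition is_limit ::
  "('a, 'b) cat \<Rightarrow> ('o, 'm) cat \<Rightarrow> ('a, 'b, 'o, 'm) ftr \<Rightarrow> 'o \<Rightarrow> ('a \<Rightarrow> 'm) \<Rightarrow> bool" where
  "is_limit J C D L p \<longleftrightarrow> is_cone J C D L p \<and>
     (\<forall>M q. is_cone J C D M q \<longrightarrow> (\<exists>!h. h \<in> hom C M L \<and> (\<forall>j\<in>Obj J. Cmp C (p j) h = q j)))"

text \<open>Every finite category is isomorphic to one whose objects and arrows are natural numbers.\<close>

definition finitely_complete :: "('o, 'm) cat \<Rightarrow> bool" where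
  "finitely_complete C \<longleftrightarrow> (\<forall>(J :: (nat, nat) cat) D.
     category J \<and> finite (Obj J) \<and> finite (Arr J) \<and> is_functor J C D \<longrightarrow>
     (\<exists>L p. is_limit J C D L p))"

definition finitely_cocomplete :: "('o, 'm) cat \<Rightarrow> bool" where
  "finitely_cocomplete C \<longleftrightarrow> finitely_complete (op_cat C)"

definition is_coproduct ::
  "('o, 'm) cat \<Rightarrow> 'i set \<Rightarrow> ('i \<Rightarrow> 'o) \<Rightarrow> 'o \<Rightarrow> ('i \<Rightarrow> 'm) \<Rightarrow> bool" where
  "is_coproduct C I A T j \<longleftrightarrow> T \<in> Obj C \<and> (\<forall>i\<in>I. j i \<in> hom C (A i) T) \<and>
     (\<forall>B\<in>Obj C. \<forall>f. (\<forall>i\<in>I. f i \<in> hom C (A i) B) \<longrightarrow>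
        (\<exists>!h. h \<in> hom C T B \<and> (\<forall>i\<in>I. Cmp C h (j i) = f i)))"


section \<open>Localization\<close>

text \<open>Gabriel--Zisman construction: the arrows of the localization of \<open>D\<close> at \<open>W\<close> are zigzags of
  arrows of \<open>D\<close> and reversed arrows of \<open>W\<close>, modulo the congruence generated by \<open>zz_basic\<close>.  A zigzag
  is read from left to right, i.e. its first step is applied first.\<close>

datatype 'm step = Fwd 'm | Bwd 'm

inductive zigzag :: "('o, 'm) cat \<Rightarrow> 'm set \<Rightarrow> 'o \<Rightarrow> 'm step list \<Rightarrow> 'o \<Rightarrow> bool"
  for D W where
  nil: "X \<in> Obj D \<Longrightarrow> zigzag D W X [] X"
| fwd: "f \<in> hom D X Y \<Longrightarrow> zigzag D W Y p Z \<Longrightarrow> zigzag D W X (Fwd f # p) Z"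
| bwd: "w \<in> W \<Longrightarrow> w \<in> hom D Y X \<Longrightarrow> zigzag D W Y p Z \<Longrightarrow> zigzag D W X (Bwd w # p) Z"

inductive zz_basic :: "('o, 'm) cat \<Rightarrow> 'm set \<Rightarrow> 'm step list \<Rightarrow> 'm step list \<Rightarrow> bool"
  for D W where
  idt: "X \<in> Obj D \<Longrightarrow> zz_basic D W [Fwd (Idt D X)] []"
| cmp: "f \<in> hom D X Y \<Longrightarrow> g \<in> hom D Y Z \<Longrightarrow> zz_basic D W [Fwd f, Fwd g] [Fwd (Cmp D g f)]"
| fwd_bwd: "w \<in> W \<Longrightarrow> w \<in> Arr D \<Longrightarrow> zz_basic D W [Fwd w, Bwd w] []"
| bwd_fwd: "w \<in> W \<Longrightarrow> w \<in> Arr D \<Longrightarrow> zz_basic D W [Bwd w, Fwd w] []"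

definition zz_move ::
  "('o, 'm) cat \<Rightarrow> 'm set \<Rightarrow> 'o \<Rightarrow> 'o \<Rightarrow> 'm step list \<Rightarrow> 'm step list \<Rightarrow> bool" where
  "zz_move D W X Y p q \<longleftrightarrow> zigzag D W X p Y \<and> zigzag D W X q Y \<and>
     (\<exists>a b l r. zz_basic D W l r \<and> p = a @ l @ b \<and> q = a @ r @ b)"

definition loc_class ::
  "('o, 'm) cat \<Rightarrow> 'm set \<Rightarrow> 'o \<Rightarrow> 'o \<Rightarrow> 'm step list \<Rightarrow> 'o \<times> 'o \<times> 'm step list set" where
  "loc_class D W X Y p = (X, Y, {q. equivclp (zz_move D W X Y) p q})"

definition localization ::
  "('o, 'm) cat \<Rightarrow> 'm set \<Rightarrow> ('o, 'o \<times> 'o \<times> 'm step list set) cat" where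
  "localization D W = \<lparr>Obj = Obj D,
     Arr = {loc_class D W X Y p | X Y p. zigzag D W X p Y},
     Dom = (\<lambda>(X, Y, P). X), Cod = (\<lambda>(X, Y, P). Y),
     Idt = (\<lambda>X. loc_class D W X X []),
     Cmp = (\<lambda>(Y, Z, Q) (X, Y', P).
       (X, Z, \<Union>p\<in>P. \<Union>q\<in>Q. snd (snd (loc_class D W X Z (p @ q)))))\<rparr>"

text \<open>The class of arrows of \<open>Fun(J, D)\<close> that are object-wise in \<open>W\<close>.\<close>

definition objectwise ::
  "('a, 'b) cat \<Rightarrow> ('c, 'd) cat \<Rightarrow> 'd set \<Rightarrow> ('a, 'b, 'c, 'd) nt set" where
  "objectwise J D W = {t \<in> Arr (fun_cat J D). \<forall>X\<in>Obj J. component t X \<in> W}"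

text \<open>Weakly saturated classes in the sense of Grothendieck and Maltsiniotis.  Every class of arrows
  containing the identities and satisfying 2-out-of-6, or satisfying 2-out-of-3 and closed under
  retracts, is weakly saturated; so is the class of all arrows inverted by a functor.\<close>

definition weakly_saturated :: "('o, 'm) cat \<Rightarrow> 'm set \<Rightarrow> bool" where
  "weakly_saturated D W \<longleftrightarrow> W \<subseteq> Arr D \<and> (\<forall>X\<in>Obj D. Idt D X \<in> W) \<and>
     (\<forall>X Y Z f g. f \<in> hom D X Y \<and> g \<in> hom D Y Z \<longrightarrow>
        (f \<in> W \<and> g \<in> W \<longrightarrow> Cmp D g f \<in> W) \<and>
        (f \<in> W \<and> Cmp D g f \<in> W \<longrightarrow> g \<in> W) \<and>
        (g \<in> W \<and> Cmp D g f \<in> W \<longrightarrow> f \<in> W)) \<and>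
     (\<forall>X Y i r. i \<in> hom D X Y \<and> r \<in> hom D Y X \<and> Cmp D r i = Idt D X \<and> Cmp D i r \<in> W \<longrightarrow> r \<in> W)"


section \<open>The simplex category and finite sets\<close>

type_synonym delta_arr = "nat \<times> nat \<times> (nat \<Rightarrow> nat)"

text \<open>The object \<open>n\<close> stands for \<open>[n] = {0, \<dots>, n}\<close>; an arrow carries its source, target and the
  (extensional) underlying function.\<close>

definition Delta :: "(nat, delta_arr) cat" where
  "Delta = \<lparr>Obj = UNIV,
     Arr = {(m, n, f). f \<in> {..m} \<rightarrow>\<^sub>E {..n} \<and> mono_on {..m} f},
     Dom = (\<lambda>(m, n, f). m), Cod = (\<lambda>(m, n, f). n),
     Idt = (\<lambda>n. (n, n, \<lambda>i\<in>{..n}. i)),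
     Cmp = (\<lambda>(_, k, g) (m, _, f). (m, k, compose {..m} g f))\<rparr>"

text \<open>The non-empty finite sets of natural numbers form a small category equivalent to that of all
  non-empty finite sets.  It contains every \<open>{0, \<dots>, n}\<close>.\<close>

type_synonym finset_arr = "nat set \<times> nat set \<times> (nat \<Rightarrow> nat)"

definition FinSet :: "(nat set, finset_arr) cat" where
  "FinSet = \<lparr>Obj = {S. finite S \<and> S \<noteq> {}},
     Arr = {(S, T, f). finite S \<and> S \<noteq> {} \<and> finite T \<and> T \<noteq> {} \<and> f \<in> S \<rightarrow>\<^sub>E T},
     Dom = (\<lambda>(S, T, f). S), Cod = (\<lambda>(S, T, f). T),
     Idt = (\<lambda>S. (S, S, \<lambda>x\<in>S. x)),
     Cmp = (\<lambda>(_, U, g) (S, _, f). (S, U, compose S g f))\<rparr>"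

text \<open>All functors between (products of) these categories are written down by their action on objects
  and arrows; the same data is used for the functor between the opposite categories.\<close>

definition diag :: "('a, 'b) cat \<Rightarrow> ('a, 'b, 'a \<times> 'a, 'b \<times> 'b) ftr" where
  "diag J = Ftr (\<lambda>X\<in>Obj J. (X, X)) (\<lambda>f\<in>Arr J. (f, f))"

definition dec :: "(nat \<times> nat, delta_arr \<times> delta_arr, nat, delta_arr) ftr" where
  "dec = Ftr (\<lambda>(n, m). n + m + 1)
     (\<lambda>((n, n', f), (m, m', g)) \<in> Arr (prod_cat Delta Delta).
        (n + m + 1, n' + m' + 1,
         \<lambda>i\<in>{..n + m + 1}. if i \<le> n then f i else n' + 1 + g (i - (n + 1))))"

definition incl1 :: "nat \<Rightarrow> nat \<Rightarrow> delta_arr" where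
  "incl1 n m = (n, n + m + 1, \<lambda>i\<in>{..n}. i)"

definition incl2 :: "nat \<Rightarrow> nat \<Rightarrow> delta_arr" where
  "incl2 n m = (m, n + m + 1, \<lambda>i\<in>{..m}. n + 1 + i)"

definition iota :: "(nat, delta_arr, nat set, finset_arr) ftr" where
  "iota = Ftr (\<lambda>n. {..n}) (\<lambda>(m, n, f) \<in> Arr Delta. ({..m}, {..n}, f))"

text \<open>The coproduct in \<open>FinSet\<close>: the second set is shifted beyond the maximum of the first one.  On
  the sets \<open>{0, \<dots>, n}\<close> this is concatenation, so that \<open>iota \<circ> dec = decs \<circ> (iota \<times> iota)\<close> strictly.\<close>

definition shift :: "nat set \<Rightarrow> nat" where
  "shift S = Suc (Max S)"

definition disj_union :: "nat set \<Rightarrow> nat set \<Rightarrow> nat set" where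
  "disj_union S T = S \<union> (\<lambda>t. shift S + t) ` T"

definition decs :: "(nat set \<times> nat set, finset_arr \<times> finset_arr, nat set, finset_arr) ftr" where
  "decs = Ftr (\<lambda>(S, T)\<in>Obj (prod_cat FinSet FinSet). disj_union S T)
     (\<lambda>((S, S', f), (T, T', g)) \<in> Arr (prod_cat FinSet FinSet).
        (disj_union S T, disj_union S' T',
         \<lambda>x\<in>disj_union S T. if x \<in> S then f x else shift S' + g (x - shift S)))"

definition fold_map :: "nat set \<Rightarrow> finset_arr" where
  "fold_map S = (disj_union S S, S, \<lambda>x\<in>disj_union S S. if x \<in> S then x else x - shift S)"


section \<open>Simplicial, bisimplicial and symmetric objects\<close>

abbreviation Deltaop :: "(nat, delta_arr) cat" where
  "Deltaop \<equiv> op_cat Delta"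

abbreviation Deltaop2 :: "(nat \<times> nat, delta_arr \<times> delta_arr) cat" where
  "Deltaop2 \<equiv> prod_cat Deltaop Deltaop"

abbreviation FinSetop :: "(nat set, finset_arr) cat" where
  "FinSetop \<equiv> op_cat FinSet"

abbreviation FinSetop2 :: "(nat set \<times> nat set, finset_arr \<times> finset_arr) cat" where
  "FinSetop2 \<equiv> prod_cat FinSetop FinSetop"

type_synonym ('o, 'm) simp_ob = "(nat, delta_arr, 'o, 'm) ftr"
type_synonym ('o, 'm) simp_ar = "(nat, delta_arr, 'o, 'm) nt"
type_synonym ('o, 'm) bisimp_ob = "(nat \<times> nat, delta_arr \<times> delta_arr, 'o, 'm) ftr"
type_synonym ('o, 'm) bisimp_ar = "(nat \<times> nat, delta_arr \<times> delta_arr, 'o, 'm) nt"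
type_synonym ('o, 'm) fin_ob = "(nat set, finset_arr, 'o, 'm) ftr"
type_synonym ('o, 'm) fin_ar = "(nat set, finset_arr, 'o, 'm) nt"

abbreviation Simp :: "('o, 'm) cat \<Rightarrow> (('o, 'm) simp_ob, ('o, 'm) simp_ar) cat" where
  "Simp C \<equiv> fun_cat Deltaop C"

abbreviation Bisimp :: "('o, 'm) cat \<Rightarrow> (('o, 'm) bisimp_ob, ('o, 'm) bisimp_ar) cat" where
  "Bisimp C \<equiv> fun_cat Deltaop2 C"

abbreviation Fin :: "('o, 'm) cat \<Rightarrow> (('o, 'm) fin_ob, ('o, 'm) fin_ar) cat" where
  "Fin C \<equiv> fun_cat FinSetop C"

abbreviation diag_pb where "diag_pb C \<equiv> pull_back Deltaop Deltaop2 C (diag Deltaop)"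
abbreviation dec_pb where "dec_pb C \<equiv> pull_back Deltaop2 Deltaop C dec"
abbreviation iota_pb where "iota_pb C \<equiv> pull_back Deltaop FinSetop C iota"
abbreviation diags_pb where "diags_pb C \<equiv> pull_back FinSetop FinSetop2 C (diag FinSetop)"
abbreviation decs_pb where "decs_pb C \<equiv> pull_back FinSetop2 FinSetop C decs"

definition u_op ::
  "('o, 'm) cat \<Rightarrow> (('o, 'm) bisimp_ob, ('o, 'm) bisimp_ar, ('o, 'm) bisimp_ob, ('o, 'm) bisimp_ar) nt"
  where
  "u_op C = NT (comp_ftr (Bisimp C) (dec_pb C) (diag_pb C)) (id_ftr (Bisimp C))
     (\<lambda>Y\<in>Obj (Bisimp C). NT (fob (comp_ftr (Bisimp C) (dec_pb C) (diag_pb C)) Y) Y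
        (\<lambda>(n, m). far Y (incl1 n m, incl2 n m)))"

definition c_op ::
  "('o, 'm) cat \<Rightarrow> (('o, 'm) fin_ob, ('o, 'm) fin_ar, ('o, 'm) fin_ob, ('o, 'm) fin_ar) nt" where
  "c_op C = NT (id_ftr (Fin C)) (comp_ftr (Fin C) (diags_pb C) (decs_pb C))
     (\<lambda>Z\<in>Obj (Fin C). NT Z (fob (comp_ftr (Fin C) (diags_pb C) (decs_pb C)) Z)
        (\<lambda>S\<in>Obj FinSetop. far Z (fold_map S)))"


section \<open>Axioms on the weak equivalences\<close>

text \<open>\<open>is_tensor C k X T j\<close>: the simplicial object \<open>T\<close> with the injections \<open>j n a : X\<^sub>n \<rightarrow> T\<^sub>n\<close> for
  \<open>a : [n] \<rightarrow> [k]\<close> is a point-wise tensoring \<open>\<Delta>\<^sub>k \<otimes> X\<close>.\<close>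

definition is_tensor :: "('o, 'm) cat \<Rightarrow> nat \<Rightarrow> ('o, 'm) simp_ob \<Rightarrow> ('o, 'm) simp_ob \<Rightarrow>
    (nat \<Rightarrow> delta_arr \<Rightarrow> 'm) \<Rightarrow> bool" where
  "is_tensor C k X T j \<longleftrightarrow> X \<in> Obj (Simp C) \<and> T \<in> Obj (Simp C) \<and>
     (\<forall>n. is_coproduct C (hom Delta n k) (\<lambda>_. fob X n) (fob T n) (j n)) \<and>
     (\<forall>m n. \<forall>f\<in>hom Delta m n. \<forall>a\<in>hom Delta n k.
        Cmp C (far T f) (j n a) = Cmp C (j m (Cmp Delta a f)) (far X f))"

text \<open>The tensoring is unique up to unique isomorphism only, and \<open>W\<close> is not assumed to be closed under
  isomorphisms; (W1) is required for at least one choice of it.\<close>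

definition W1 :: "('o, 'm) cat \<Rightarrow> ('o, 'm) simp_ar set \<Rightarrow> bool" where
  "W1 C W \<longleftrightarrow> (\<forall>X\<in>Obj (Simp C). \<exists>T j p. is_tensor C 1 X T j \<and> p \<in> hom (Simp C) T X \<and>
     (\<forall>n. \<forall>a\<in>hom Delta n 1. Cmp C (component p n) (j n a) = Idt C (fob X n)) \<and> p \<in> W)"

text \<open>The inclusions \<open>[m] \<mapsto> ([n], [m])\<close> and \<open>[m] \<mapsto> ([m], [n])\<close>.\<close>

definition slice1 :: "nat \<Rightarrow> (nat, delta_arr, nat \<times> nat, delta_arr \<times> delta_arr) ftr" where
  "slice1 n = Ftr (\<lambda>m. (n, m)) (\<lambda>f\<in>Arr Deltaop. (Idt Deltaop n, f))"

definition slice2 :: "nat \<Rightarrow> (nat, delta_arr, nat \<times> nat, delta_arr \<times> delta_arr) ftr" where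
  "slice2 n = Ftr (\<lambda>m. (m, n)) (\<lambda>f\<in>Arr Deltaop. (f, Idt Deltaop n))"

definition W2 :: "('o, 'm) cat \<Rightarrow> ('o, 'm) simp_ar set \<Rightarrow> bool" where
  "W2 C W \<longleftrightarrow> (\<forall>t\<in>Arr (Bisimp C).
     (\<forall>n. far (pull_back Deltaop Deltaop2 C (slice1 n)) t \<in> W) \<or>
     (\<forall>n. far (pull_back Deltaop Deltaop2 C (slice2 n)) t \<in> W) \<longrightarrow>
     far (diag_pb C) t \<in> W)"

type_synonym ('o, 'm) sym_ftr = "(('o, 'm) simp_ob, ('o, 'm) simp_ar, ('o, 'm) fin_ob, ('o, 'm) fin_ar) ftr"
type_synonym ('o, 'm) simp_nt = "(('o, 'm) simp_ob, ('o, 'm) simp_ar, ('o, 'm) simp_ob, ('o, 'm) simp_ar) nt"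
type_synonym ('o, 'm) bisimp_nt =
  "(('o, 'm) bisimp_ob, ('o, 'm) bisimp_ar, ('o, 'm) bisimp_ob, ('o, 'm) bisimp_ar) nt"
type_synonym ('o, 'm) tot_ftr =
  "(('o, 'm) bisimp_ob, ('o, 'm) bisimp_ar, ('o, 'm) simp_ob, ('o, 'm) simp_ar) ftr"
type_synonym ('o, 'm) tot_nt =
  "(('o, 'm) bisimp_ob, ('o, 'm) bisimp_ar, ('o, 'm) simp_ob, ('o, 'm) simp_ar) nt"

definition symmetric_data ::
  "('o, 'm) cat \<Rightarrow> ('o, 'm) sym_ftr \<Rightarrow> ('o, 'm) simp_nt \<Rightarrow> bool" where
  "symmetric_data C CC e \<longleftrightarrow> is_functor (Simp C) (Fin C) CC \<and>
     e \<in> hom (fun_cat (Simp C) (Simp C)) (id_ftr (Simp C)) (comp_ftr (Simp C) (iota_pb C) CC)"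

definition symmetric ::
  "('o, 'm) cat \<Rightarrow> ('o, 'm) simp_ar set \<Rightarrow> ('o, 'm) sym_ftr \<Rightarrow> ('o, 'm) simp_nt \<Rightarrow> bool" where
  "symmetric C W CC e \<longleftrightarrow> symmetric_data C CC e \<and> (\<forall>X\<in>Obj (Simp C). component e X \<in> W)"

definition strongly_symmetric ::
  "('o, 'm) cat \<Rightarrow> ('o, 'm) sym_ftr \<Rightarrow> ('o, 'm) simp_nt \<Rightarrow> bool" where
  "strongly_symmetric C CC e \<longleftrightarrow> symmetric_data C CC e \<and>
     (\<forall>X\<in>Obj (Simp C). iso_arrow (Simp C) (component e X))"


section \<open>The Alexander--Whitney and Eilenberg--Zilber morphisms\<close>

text \<open>Below, \<open>R\<close> is the right adjoint of the pull-back along \<open>dec\<close>, and \<open>\<eta>\<close>, \<open>\<epsilon>\<close> are the unit and counit.\<close>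

definition Aw_nt ::
  "('o, 'm) cat \<Rightarrow> ('o, 'm) tot_ftr \<Rightarrow> ('o, 'm) simp_nt \<Rightarrow> ('o, 'm) tot_nt" where
  "Aw_nt C R \<eta> = Cmp (fun_cat (Bisimp C) (Simp C))
     (whisker_left (Bisimp C) R (u_op C)) (whisker_right (Bisimp C) \<eta> (diag_pb C))"

text \<open>The transformation from the identity of simplicial objects to (the pull-back along the diagonal
  of) the pull-back along \<open>dec\<close>: first the three constituents, then the composite as a zigzag
  and, in the strongly symmetric case, as an honest transformation.\<close>

definition c_mid :: "('o, 'm) cat \<Rightarrow> ('o, 'm) sym_ftr \<Rightarrow> ('o, 'm) simp_nt" where
  "c_mid C CC = whisker_right (Simp C) (whisker_left (Fin C) (iota_pb C) (c_op C)) CC"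

definition c_last :: "('o, 'm) cat \<Rightarrow> ('o, 'm) simp_nt \<Rightarrow> ('o, 'm) simp_nt" where
  "c_last C e = whisker_left (Simp C) (comp_ftr (Simp C) (diag_pb C) (dec_pb C)) e"

definition c_zigzag ::
  "('o, 'm) cat \<Rightarrow> ('o, 'm) sym_ftr \<Rightarrow> ('o, 'm) simp_nt \<Rightarrow> ('o, 'm) simp_nt step list" where
  "c_zigzag C CC e = [Fwd e, Fwd (c_mid C CC), Bwd (c_last C e)]"

definition c_strong :: "('o, 'm) cat \<Rightarrow> ('o, 'm) sym_ftr \<Rightarrow> ('o, 'm) simp_nt \<Rightarrow> ('o, 'm) simp_nt" where
  "c_strong C CC e = (let D = fun_cat (Simp C) (Simp C) in
     Cmp D (inv_arrow D (c_last C e)) (Cmp D (c_mid C CC) e))"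

text \<open>Whiskering a zigzag with \<open>R\<close> is whiskering each of its steps.\<close>

definition Ez_zigzag :: "('o, 'm) cat \<Rightarrow> ('o, 'm) sym_ftr \<Rightarrow> ('o, 'm) simp_nt \<Rightarrow>
    ('o, 'm) tot_ftr \<Rightarrow> ('o, 'm) bisimp_nt \<Rightarrow> ('o, 'm) tot_nt step list" where
  "Ez_zigzag C CC e R \<epsilon> =
     map (map_step (\<lambda>t. whisker_right (Bisimp C) t R)) (c_zigzag C CC e) @
     [Fwd (whisker_left (Bisimp C) (diag_pb C) \<epsilon>)]"

definition Ez_strong_nt :: "('o, 'm) cat \<Rightarrow> ('o, 'm) sym_ftr \<Rightarrow> ('o, 'm) simp_nt \<Rightarrow>
    ('o, 'm) tot_ftr \<Rightarrow> ('o, 'm) bisimp_nt \<Rightarrow> ('o, 'm) tot_nt" where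
  "Ez_strong_nt C CC e R \<epsilon> = Cmp (fun_cat (Bisimp C) (Simp C))
     (whisker_left (Bisimp C) (diag_pb C) \<epsilon>) (whisker_right (Bisimp C) (c_strong C CC e) R)"

text \<open>The category \<open>Fun(C\<^bsup>\<Delta>op\<times>\<Delta>op\<^esup>, C\<^bsup>\<Delta>op\<^esup>)[W\<^sup>-\<^sup>1]\<close>.\<close>

abbreviation Loc_Fun where
  "Loc_Fun C W \<equiv> localization (fun_cat (Bisimp C) (Simp C)) (objectwise (Bisimp C) (Simp C) W)"

abbreviation Loc_Fun_class where
  "Loc_Fun_class C W \<equiv> loc_class (fun_cat (Bisimp C) (Simp C)) (objectwise (Bisimp C) (Simp C) W)"

definition Aw where
  "Aw C W R \<eta> = Loc_Fun_class C W (diag_pb C) R [Fwd (Aw_nt C R \<eta>)]"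

definition Ez where
  "Ez C W CC e R \<epsilon> = Loc_Fun_class C W R (diag_pb C) (Ez_zigzag C CC e R \<epsilon>)"

definition Ez_strong where
  "Ez_strong C W CC e R \<epsilon> = Loc_Fun_class C W R (diag_pb C) [Fwd (Ez_strong_nt C CC e R \<epsilon>)]"

end

theory Submission
  imports Defs
begin

text \<open>For functors on finite sets, restriction along the diagonal is right adjoint to restriction along
  the coproduct, with unit \<open>c_op\<close> and counit \<open>u_op\<close>.  On simplicial objects \<open>u_op\<close> still exists and the
  symmetric structure provides a substitute for \<open>c_op\<close>.  One triangle identity holds strictly, because
  the fold map splits the inclusions; it gives \<open>Aw \<circ> Ez = id\<close>.  The other one holds up to the homotopy
  \<open>a \<mapsto> (incl1, mix a)\<close> between \<open>(incl1, incl1)\<close> and \<open>(incl1, incl2)\<close>, which (W1) turns into an equality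
  in the localization; it gives \<open>Ez \<circ> Aw = id\<close>.  If the symmetric structure is not strong, commuting the
  inverse of \<open>c_last\<close> past the other arrows requires that \<open>e\<close> remains a weak equivalence after \<open>\<delta>\<^sup>* dec\<^sup>*\<close> and
  \<open>dec\<^sub>* dec\<^sup>*\<close>.  For the first functor this follows from the weak equivalence \<open>\<delta>\<^sup>* dec\<^sup>* X \<rightarrow> X\<close> provided by
  (W2) and the extra degeneracies of the decalage, for the second one from the weak equivalence
  \<open>X \<rightarrow> dec\<^sub>* dec\<^sup>* X\<close>, the target being a cotensor of \<open>X\<close> with \<open>\<Delta>\<^sub>1\<close>.\<close>

section \<open>Functor categories\<close>

text \<open>Both composites are computed with zigzags rather than with their classes. A formally
  inverted transformation can only be moved by naturality squares, so every identity between honest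
  arrows that meets an inverse is flipped across it.

  The adjunction enters through \<open>Aw_nt\<close> being the transpose of \<open>u_op\<close>:
  followed by the counit it gives back \<open>u_op\<close>, and on decalages, preceded by the fold
  map, it gives the unit.

  A homotopy yields an equality in the localization of a functor category only if it is natural in
  the bisimplicial object, whereas (W1) supplies cylinders one object at a time. Hence a functorial
  cylinder is assembled from arbitrary choices. Both of its ends are sections of one inverted
  projection, and are therefore equal.

  For the unit the cotensor itself is not constructed. What is extracted from it is a retraction of
  the unit, namely evaluation at the vertex 0, and a homotopy, which comes from the minimum map
  \<open>\<Delta>_1 x \<Delta>_1 -> \<Delta>_1\<close> contracting the interval to 0.\<close>

lemma hom_iff: "f \<in> hom C X Y \<longleftrightarrow> f \<in> Arr C \<and> Dom C f = X \<and> Cod C f = Y"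
  by (auto simp: hom_def)

lemma (in category) hom_Obj:
  assumes "f \<in> hom C X Y"
  shows "X \<in> Obj C" "Y \<in> Obj C"
  using assms Dom_Obj Cod_Obj by (auto simp: hom_iff)

lemma op_cat_simps [simp]:
  "Obj (op_cat C) = Obj C" "Arr (op_cat C) = Arr C" "Dom (op_cat C) = Cod C" "Cod (op_cat C) = Dom C"
  "Idt (op_cat C) = Idt C" "Cmp (op_cat C) g f = Cmp C f g"
  by (auto simp: op_cat_def)

lemma hom_op_cat [simp]: "hom (op_cat C) X Y = hom C Y X"
  by (auto simp: hom_def)

lemma prod_cat_simps [simp]:
  "Obj (prod_cat C D) = Obj C \<times> Obj D" "Arr (prod_cat C D) = Arr C \<times> Arr D"
  "Dom (prod_cat C D) = map_prod (Dom C) (Dom D)" "Cod (prod_cat C D) = map_prod (Cod C) (Cod D)"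
  "Idt (prod_cat C D) = map_prod (Idt C) (Idt D)"
  "Cmp (prod_cat C D) (g, g') (f, f') = (Cmp C g f, Cmp D g' f')"
  by (auto simp: prod_cat_def)

lemma hom_prod_cat [simp]: "hom (prod_cat C D) (X, X') (Y, Y') = hom C X Y \<times> hom D X' Y'"
  by (auto simp: hom_def)

lemma category_op: "category C \<Longrightarrow> category (op_cat C)"
  unfolding category_def by (simp, metis)

lemma category_prod:
  assumes "category C" "category D"
  shows "category (prod_cat C D)"
proof -
  interpret C: category C by fact
  interpret D: category D by fact
  show ?thesis
  proof
    fix f assume "f \<in> Arr (prod_cat C D)"
    then show "Dom (prod_cat C D) f \<in> Obj (prod_cat C D)" "Cod (prod_cat C D) f \<in> Obj (prod_cat C D)"
      by (auto simp: C.Dom_Obj D.Dom_Obj C.Cod_Obj D.Cod_Obj)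
  next
    fix X assume "X \<in> Obj (prod_cat C D)"
    then show "Idt (prod_cat C D) X \<in> hom (prod_cat C D) X X"
      by (cases X) (auto simp: C.Idt_hom D.Idt_hom)
  next
    fix f g X Y Z
    assume "f \<in> hom (prod_cat C D) X Y" "g \<in> hom (prod_cat C D) Y Z"
    then show "Cmp (prod_cat C D) g f \<in> hom (prod_cat C D) X Z"
      by (cases X; cases Y; cases Z) (auto intro: C.Cmp_hom D.Cmp_hom)
  next
    fix f X Y assume "f \<in> hom (prod_cat C D) X Y"
    then show "Cmp (prod_cat C D) (Idt (prod_cat C D) Y) f = f"
      "Cmp (prod_cat C D) f (Idt (prod_cat C D) X) = f"
      by (cases X; cases Y; auto simp: C.Cmp_Idt_left D.Cmp_Idt_left C.Cmp_Idt_right D.Cmp_Idt_right)+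
  next
    fix f X Y g Z h V
    assume "f \<in> hom (prod_cat C D) X Y" "g \<in> hom (prod_cat C D) Y Z" "h \<in> hom (prod_cat C D) Z V"
    then show "Cmp (prod_cat C D) h (Cmp (prod_cat C D) g f) =
        Cmp (prod_cat C D) (Cmp (prod_cat C D) h g) f"
      by (cases X; cases Y; cases Z; cases V) (auto simp: C.Cmp_assoc D.Cmp_assoc)
  qed
qed

lemma is_functor_hom:
  "is_functor J C F \<Longrightarrow> f \<in> hom J X Y \<Longrightarrow> far F f \<in> hom C (fob F X) (fob F Y)"
  by (auto simp: is_functor_def hom_iff)

lemma is_functor_Obj: "is_functor J C F \<Longrightarrow> X \<in> Obj J \<Longrightarrow> fob F X \<in> Obj C"
  by (auto simp: is_functor_def)

lemma is_functor_Idt: "is_functor J C F \<Longrightarrow> X \<in> Obj J \<Longrightarrow> far F (Idt J X) = Idt C (fob F X)"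
  by (auto simp: is_functor_def)

lemma is_functor_Cmp:
  "is_functor J C F \<Longrightarrow> f \<in> hom J X Y \<Longrightarrow> g \<in> hom J Y Z \<Longrightarrow>
    far F (Cmp J g f) = Cmp C (far F g) (far F f)"
  by (auto simp: is_functor_def hom_iff)

lemma is_functorI:
  assumes "fob F \<in> extensional (Obj J)" "far F \<in> extensional (Arr J)"
    and "\<And>X. X \<in> Obj J \<Longrightarrow> fob F X \<in> Obj C"
    and "\<And>f X Y. f \<in> hom J X Y \<Longrightarrow> far F f \<in> hom C (fob F X) (fob F Y)"
    and "\<And>X. X \<in> Obj J \<Longrightarrow> far F (Idt J X) = Idt C (fob F X)"
    and "\<And>f g X Y Z. f \<in> hom J X Y \<Longrightarrow> g \<in> hom J Y Z \<Longrightarrow> far F (Cmp J g f) = Cmp C (far F g) (far F f)"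
  shows "is_functor J C F"
proof -
  have "far F f \<in> hom C (fob F (Dom J f)) (fob F (Cod J f))" if "f \<in> Arr J" for f
    using that assms(4)[of f "Dom J f" "Cod J f"] by (simp add: hom_iff)
  moreover have "far F (Cmp J g f) = Cmp C (far F g) (far F f)"
    if "f \<in> Arr J" "g \<in> Arr J" "Cod J f = Dom J g" for f g
    using that assms(6)[of f "Dom J f" "Dom J g" g "Cod J g"] by (simp add: hom_iff)
  ultimately show ?thesis
    using assms(1-3,5) by (auto simp: is_functor_def PiE_def hom_iff)
qed

lemma ftr_eqI:
  assumes "is_functor J C F" "is_functor J C' G"
    and "\<And>X. X \<in> Obj J \<Longrightarrow> fob F X = fob G X" "\<And>f. f \<in> Arr J \<Longrightarrow> far F f = far G f"
  shows "F = G"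
proof -
  have "fob F = fob G"
    using assms by (intro extensionalityI[of _ "Obj J"]) (auto simp: is_functor_def PiE_def)
  moreover have "far F = far G"
    using assms by (intro extensionalityI[of _ "Arr J"]) (auto simp: is_functor_def PiE_def)
  ultimately show ?thesis by (rule ftr.expand[OF conjI])
qed

lemma fun_cat_simps [simp]:
  "Obj (fun_cat J C) = {F. is_functor J C F}" "Arr (fun_cat J C) = {t. is_nat_trans J C t}"
  "Dom (fun_cat J C) = src" "Cod (fun_cat J C) = tgt"
  "src (Cmp (fun_cat J C) s t) = src t" "tgt (Cmp (fun_cat J C) s t) = tgt s"
  "src (Idt (fun_cat J C) F) = F" "tgt (Idt (fun_cat J C) F) = F"
  "X \<in> Obj J \<Longrightarrow> component (Idt (fun_cat J C) F) X = Idt C (fob F X)"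
  "X \<in> Obj J \<Longrightarrow> component (Cmp (fun_cat J C) s t) X = Cmp C (component s X) (component t X)"
  by (auto simp: fun_cat_def)

lemma hom_fun_cat_iff: "t \<in> hom (fun_cat J C) F G \<longleftrightarrow> is_nat_trans J C t \<and> src t = F \<and> tgt t = G"
  by (auto simp: hom_iff)

lemma nat_component:
  "t \<in> hom (fun_cat J C) F G \<Longrightarrow> X \<in> Obj J \<Longrightarrow> component t X \<in> hom C (fob F X) (fob G X)"
  by (auto simp: hom_fun_cat_iff is_nat_trans_def)

lemma nat_functors:
  assumes "t \<in> hom (fun_cat J C) F G"
  shows "is_functor J C F" "is_functor J C G"
  using assms by (auto simp: hom_fun_cat_iff is_nat_trans_def)

lemma naturality:
  "t \<in> hom (fun_cat J C) F G \<Longrightarrow> f \<in> hom J X Y \<Longrightarrow>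
    Cmp C (component t Y) (far F f) = Cmp C (far G f) (component t X)"
  by (auto simp: hom_fun_cat_iff is_nat_trans_def hom_iff)

lemma nat_transI:
  assumes "is_functor J C F" "is_functor J C G" "c \<in> extensional (Obj J)"
    and "\<And>X. X \<in> Obj J \<Longrightarrow> c X \<in> hom C (fob F X) (fob G X)"
    and "\<And>f X Y. f \<in> hom J X Y \<Longrightarrow> Cmp C (c Y) (far F f) = Cmp C (far G f) (c X)"
  shows "NT F G c \<in> hom (fun_cat J C) F G"
  using assms by (auto simp: hom_fun_cat_iff is_nat_trans_def hom_iff)

lemma nt_eqI:
  assumes "s \<in> hom (fun_cat J C) F G" "t \<in> hom (fun_cat J C) F G"
    and "\<And>X. X \<in> Obj J \<Longrightarrow> component s X = component t X"
  shows "s = t"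
proof -
  have "component s = component t"
    using assms by (intro extensionalityI[of _ "Obj J"]) (auto simp: hom_fun_cat_iff is_nat_trans_def)
  then show ?thesis
    using assms(1,2) by (intro nt.expand) (auto simp: hom_fun_cat_iff)
qed

lemma category_fun_cat:
  assumes "category J" "category C"
  shows "category (fun_cat J C)"
proof -
  interpret J: category J by fact
  interpret C: category C by fact
  have Idt: "Idt (fun_cat J C) F \<in> hom (fun_cat J C) F F" if "is_functor J C F" for F
  proof -
    have "NT F F (\<lambda>X\<in>Obj J. Idt C (fob F X)) \<in> hom (fun_cat J C) F F"
    proof (rule nat_transI[OF that that])
      fix f X Y assume f: "f \<in> hom J X Y"
      show "Cmp C ((\<lambda>X\<in>Obj J. Idt C (fob F X)) Y) (far F f) =
          Cmp C (far F f) ((\<lambda>X\<in>Obj J. Idt C (fob F X)) X)"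
        using J.hom_Obj[OF f] is_functor_hom[OF that f] by (simp add: C.Cmp_Idt_left C.Cmp_Idt_right)
    qed (auto intro!: C.Idt_hom is_functor_Obj[OF that])
    then show ?thesis by (simp add: fun_cat_def)
  qed
  have Cmp: "Cmp (fun_cat J C) t s \<in> hom (fun_cat J C) F H"
    if s: "s \<in> hom (fun_cat J C) F G" and t: "t \<in> hom (fun_cat J C) G H" for s t F G H
  proof -
    have "NT F H (\<lambda>X\<in>Obj J. Cmp C (component t X) (component s X)) \<in> hom (fun_cat J C) F H"
    proof (rule nat_transI)
      fix X assume "X \<in> Obj J"
      then show "(\<lambda>X\<in>Obj J. Cmp C (component t X) (component s X)) X \<in> hom C (fob F X) (fob H X)"
        using nat_component[OF s] nat_component[OF t] by (auto intro: C.Cmp_hom)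
    next
      fix f X Y assume f: "f \<in> hom J X Y"
      note X = J.hom_Obj(1)[OF f] and Y = J.hom_Obj(2)[OF f]
      note F = nat_functors(1)[OF s] and G = nat_functors(1)[OF t] and H = nat_functors(2)[OF t]
      note a = is_functor_hom[OF F f] is_functor_hom[OF G f] is_functor_hom[OF H f]
        nat_component[OF s X] nat_component[OF s Y] nat_component[OF t X] nat_component[OF t Y]
      have "Cmp C (Cmp C (component t Y) (component s Y)) (far F f) =
          Cmp C (component t Y) (Cmp C (component s Y) (far F f))"
        using C.Cmp_assoc[OF a(1,5,7)] by simp
      also have "\<dots> = Cmp C (Cmp C (component t Y) (far G f)) (component s X)"
        using C.Cmp_assoc[OF a(4,2,7)] naturality[OF s f] by simp
      also have "\<dots> = Cmp C (far H f) (Cmp C (component t X) (component s X))"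
        using C.Cmp_assoc[OF a(4,6,3)] naturality[OF t f] by simp
      finally show "Cmp C ((\<lambda>X\<in>Obj J. Cmp C (component t X) (component s X)) Y) (far F f) =
          Cmp C (far H f) ((\<lambda>X\<in>Obj J. Cmp C (component t X) (component s X)) X)"
        using X Y by simp
    qed (use nat_functors[OF s] nat_functors[OF t] in auto)
    moreover have "Cmp (fun_cat J C) t s = NT F H (\<lambda>X\<in>Obj J. Cmp C (component t X) (component s X))"
      using s t by (simp add: hom_fun_cat_iff) (simp add: fun_cat_def)
    ultimately show ?thesis by simp
  qed
  show ?thesis
  proof
    fix f assume "f \<in> Arr (fun_cat J C)"
    then show "Dom (fun_cat J C) f \<in> Obj (fun_cat J C)" "Cod (fun_cat J C) f \<in> Obj (fun_cat J C)"
      by (auto simp: is_nat_trans_def)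
  next
    fix F assume "F \<in> Obj (fun_cat J C)"
    then show "Idt (fun_cat J C) F \<in> hom (fun_cat J C) F F" by (simp add: Idt)
  next
    fix s t F G H assume "s \<in> hom (fun_cat J C) F G" "t \<in> hom (fun_cat J C) G H"
    then show "Cmp (fun_cat J C) t s \<in> hom (fun_cat J C) F H" by (rule Cmp)
  next
    fix t F G assume t: "t \<in> hom (fun_cat J C) F G"
    show "Cmp (fun_cat J C) (Idt (fun_cat J C) G) t = t"
      by (rule nt_eqI[OF Cmp[OF t Idt[OF nat_functors(2)[OF t]]] t])
        (simp add: C.Cmp_Idt_left[OF nat_component[OF t]])
    show "Cmp (fun_cat J C) t (Idt (fun_cat J C) F) = t"
      by (rule nt_eqI[OF Cmp[OF Idt[OF nat_functors(1)[OF t]] t] t])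
        (simp add: C.Cmp_Idt_right[OF nat_component[OF t]])
  next
    fix s t r F G H K
    assume s: "s \<in> hom (fun_cat J C) F G" and t: "t \<in> hom (fun_cat J C) G H"
      and r: "r \<in> hom (fun_cat J C) H K"
    show "Cmp (fun_cat J C) r (Cmp (fun_cat J C) t s) = Cmp (fun_cat J C) (Cmp (fun_cat J C) r t) s"
      by (rule nt_eqI[OF Cmp[OF Cmp[OF s t] r] Cmp[OF s Cmp[OF t r]]])
        (simp add: C.Cmp_assoc[OF nat_component[OF s] nat_component[OF t] nat_component[OF r]])
  qed
qed

section \<open>Identity functors, composition of functors, whiskering\<close>

lemma is_functor_id: "category J \<Longrightarrow> is_functor J J (id_ftr J)"
  by (rule is_functorI)
    (auto simp: id_ftr_def category.Idt_hom[unfolded hom_iff] category.Cmp_hom[unfolded hom_iff]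
      dest: category.hom_Obj simp: hom_iff category.Dom_Obj category.Cod_Obj)

lemma id_ftr_simps [simp]:
  "X \<in> Obj J \<Longrightarrow> fob (id_ftr J) X = X" "f \<in> Arr J \<Longrightarrow> far (id_ftr J) f = f"
  by (auto simp: id_ftr_def)

lemma comp_ftr_simps [simp]:
  "X \<in> Obj J \<Longrightarrow> fob (comp_ftr J G F) X = fob G (fob F X)"
  "f \<in> Arr J \<Longrightarrow> far (comp_ftr J G F) f = far G (far F f)"
  by (auto simp: comp_ftr_def)

lemma is_functor_comp:
  assumes "category J" "is_functor J K F" "is_functor K M G"
  shows "is_functor J M (comp_ftr J G F)"
proof (rule is_functorI)
  interpret J: category J by fact
  note F = assms(2) and G = assms(3)
  show "fob (comp_ftr J G F) X \<in> Obj M" if "X \<in> Obj J" for X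
    using that is_functor_Obj[OF F that] is_functor_Obj[OF G] by simp
  show "far (comp_ftr J G F) f \<in> hom M (fob (comp_ftr J G F) X) (fob (comp_ftr J G F) Y)"
    if "f \<in> hom J X Y" for f X Y
    using that J.hom_Obj[OF that] is_functor_hom[OF G is_functor_hom[OF F that]] by (simp add: hom_iff)
  show "far (comp_ftr J G F) (Idt J X) = Idt M (fob (comp_ftr J G F) X)" if "X \<in> Obj J" for X
    using that J.Idt_hom[OF that] is_functor_Idt[OF F that] is_functor_Idt[OF G is_functor_Obj[OF F that]]
    by (simp add: hom_iff)
  show "far (comp_ftr J G F) (Cmp J g f) = Cmp M (far (comp_ftr J G F) g) (far (comp_ftr J G F) f)"
    if "f \<in> hom J X Y" "g \<in> hom J Y Z" for f g X Y Z
    using that J.Cmp_hom[OF that] is_functor_Cmp[OF F that]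
      is_functor_Cmp[OF G is_functor_hom[OF F that(1)] is_functor_hom[OF F that(2)]]
    by (simp add: hom_iff)
qed (auto simp: comp_ftr_def)

lemma comp_id_left:
  assumes "category J" "category K" "is_functor J K F"
  shows "comp_ftr J (id_ftr K) F = F"
  by (rule ftr_eqI[OF is_functor_comp[OF assms(1,3) is_functor_id[OF assms(2)]] assms(3)])
    (use assms(3) in \<open>auto simp: is_functor_def PiE_def Pi_def\<close>)

lemma comp_id_right:
  assumes "category J" "is_functor J K F"
  shows "comp_ftr J F (id_ftr J) = F"
  by (rule ftr_eqI[OF is_functor_comp[OF assms(1) is_functor_id[OF assms(1)] assms(2)] assms(2)]) auto

lemma comp_ftr_assoc:
  assumes "is_functor J K F"
  shows "comp_ftr J (comp_ftr K H G) F = comp_ftr J H (comp_ftr J G F)"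
  using assms
  by (auto simp: comp_ftr_def is_functor_def hom_iff PiE_def Pi_def restrict_def fun_eq_iff)

lemma whisker_left_simps [simp]:
  "src (whisker_left J H t) = comp_ftr J H (src t)" "tgt (whisker_left J H t) = comp_ftr J H (tgt t)"
  "X \<in> Obj J \<Longrightarrow> component (whisker_left J H t) X = far H (component t X)"
  by (auto simp: whisker_left_def)

lemma whisker_right_simps [simp]:
  "src (whisker_right J t K) = comp_ftr J (src t) K" "tgt (whisker_right J t K) = comp_ftr J (tgt t) K"
  "X \<in> Obj J \<Longrightarrow> component (whisker_right J t K) X = component t (fob K X)"
  by (auto simp: whisker_right_def)

lemma whisker_left_hom:
  assumes "category J" "is_functor K M H" "t \<in> hom (fun_cat J K) F G"
  shows "whisker_left J H t \<in> hom (fun_cat J M) (comp_ftr J H F) (comp_ftr J H G)"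
proof -
  interpret J: category J by fact
  note F = nat_functors(1)[OF assms(3)] and G = nat_functors(2)[OF assms(3)]
  have "NT (comp_ftr J H F) (comp_ftr J H G) (\<lambda>X\<in>Obj J. far H (component t X))
      \<in> hom (fun_cat J M) (comp_ftr J H F) (comp_ftr J H G)"
  proof (rule nat_transI[OF is_functor_comp[OF assms(1) F assms(2)] is_functor_comp[OF assms(1) G assms(2)]])
    fix X assume "X \<in> Obj J"
    then show "(\<lambda>X\<in>Obj J. far H (component t X)) X \<in> hom M (fob (comp_ftr J H F) X) (fob (comp_ftr J H G) X)"
      using is_functor_hom[OF assms(2) nat_component[OF assms(3)]] by simp
  next
    fix f X Y assume f: "f \<in> hom J X Y"
    note X = J.hom_Obj(1)[OF f] and Y = J.hom_Obj(2)[OF f]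
    have "far H (Cmp K (component t Y) (far F f)) = far H (Cmp K (far G f) (component t X))"
      using naturality[OF assms(3) f] by simp
    then show "Cmp M ((\<lambda>X\<in>Obj J. far H (component t X)) Y) (far (comp_ftr J H F) f) =
        Cmp M (far (comp_ftr J H G) f) ((\<lambda>X\<in>Obj J. far H (component t X)) X)"
      using X Y f is_functor_Cmp[OF assms(2) is_functor_hom[OF F f] nat_component[OF assms(3) Y]]
        is_functor_Cmp[OF assms(2) nat_component[OF assms(3) X] is_functor_hom[OF G f]]
      by (simp add: hom_iff)
  qed auto
  then show ?thesis using assms(3) by (simp add: whisker_left_def hom_fun_cat_iff)
qed

lemma whisker_right_hom:
  assumes "category J" "is_functor J K F" "t \<in> hom (fun_cat K M) H H'"
  shows "whisker_right J t F \<in> hom (fun_cat J M) (comp_ftr J H F) (comp_ftr J H' F)"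
proof -
  interpret J: category J by fact
  note H = nat_functors(1)[OF assms(3)] and H' = nat_functors(2)[OF assms(3)]
  have "NT (comp_ftr J H F) (comp_ftr J H' F) (\<lambda>X\<in>Obj J. component t (fob F X))
      \<in> hom (fun_cat J M) (comp_ftr J H F) (comp_ftr J H' F)"
  proof (rule nat_transI[OF is_functor_comp[OF assms(1,2) H] is_functor_comp[OF assms(1,2) H']])
    fix X assume "X \<in> Obj J"
    then show "(\<lambda>X\<in>Obj J. component t (fob F X)) X \<in> hom M (fob (comp_ftr J H F) X) (fob (comp_ftr J H' F) X)"
      using nat_component[OF assms(3) is_functor_Obj[OF assms(2)]] by simp
  next
    fix f X Y assume f: "f \<in> hom J X Y"
    show "Cmp M ((\<lambda>X\<in>Obj J. component t (fob F X)) Y) (far (comp_ftr J H F) f) =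
        Cmp M (far (comp_ftr J H' F) f) ((\<lambda>X\<in>Obj J. component t (fob F X)) X)"
      using J.hom_Obj[OF f] f naturality[OF assms(3) is_functor_hom[OF assms(2) f]] by (simp add: hom_iff)
  qed auto
  then show ?thesis using assms(3) by (simp add: whisker_right_def hom_fun_cat_iff)
qed

text \<open>The Godement interchange law, which is naturality of \<open>\<beta>\<close> at the
  components of \<open>\<alpha>\<close>. The squares that move \<open>Aw_nt\<close>,
  \<open>e\<close> or the counit past another transformation all come from it.\<close>

lemma whisker_interchange:
  assumes "category J" "category M"
    and "\<alpha> \<in> hom (fun_cat J K) F G" "\<beta> \<in> hom (fun_cat K M) H H'"
  shows "Cmp (fun_cat J M) (whisker_right J \<beta> G) (whisker_left J H \<alpha>) =
      Cmp (fun_cat J M) (whisker_left J H' \<alpha>) (whisker_right J \<beta> F)"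
proof -
  interpret D: category "fun_cat J M" using assms(1,2) by (rule category_fun_cat)
  note F = nat_functors[OF assms(3)] and H = nat_functors[OF assms(4)]
  show ?thesis
    by (rule nt_eqI[OF D.Cmp_hom[OF whisker_left_hom whisker_right_hom]
          D.Cmp_hom[OF whisker_right_hom whisker_left_hom]])
      (auto intro: assms F H simp: naturality[OF assms(4) nat_component[OF assms(3)]])
qed

lemma whisker_left_Cmp:
  assumes "category J" "category K" "category M" "is_functor K M H"
    and "s \<in> hom (fun_cat J K) F G" "t \<in> hom (fun_cat J K) G G'"
  shows "whisker_left J H (Cmp (fun_cat J K) t s) =
      Cmp (fun_cat J M) (whisker_left J H t) (whisker_left J H s)"
proof -
  interpret D: category "fun_cat J M" using assms by (simp add: category_fun_cat)
  interpret E: category "fun_cat J K" using assms by (simp add: category_fun_cat)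
  show ?thesis
    by (rule nt_eqI[OF whisker_left_hom[OF assms(1,4) E.Cmp_hom[OF assms(5,6)]]
          D.Cmp_hom[OF whisker_left_hom[OF assms(1,4,5)] whisker_left_hom[OF assms(1,4,6)]]])
      (simp add: is_functor_Cmp[OF assms(4) nat_component[OF assms(5)] nat_component[OF assms(6)]])
qed

lemma whisker_right_Cmp:
  assumes "category J" "category K" "category M" "is_functor J K F"
    and "s \<in> hom (fun_cat K M) H H'" "t \<in> hom (fun_cat K M) H' H''"
  shows "whisker_right J (Cmp (fun_cat K M) t s) F =
      Cmp (fun_cat J M) (whisker_right J t F) (whisker_right J s F)"
proof -
  interpret D: category "fun_cat J M" using assms by (simp add: category_fun_cat)
  interpret E: category "fun_cat K M" using assms by (simp add: category_fun_cat)
  show ?thesis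
    by (rule nt_eqI[OF whisker_right_hom[OF assms(1,4) E.Cmp_hom[OF assms(5,6)]]
          D.Cmp_hom[OF whisker_right_hom[OF assms(1,4,5)] whisker_right_hom[OF assms(1,4,6)]]])
      (simp add: is_functor_Obj[OF assms(4)])
qed

lemma whisker_left_id:
  assumes "category J" "category K" "t \<in> hom (fun_cat J K) F G"
  shows "whisker_left J (id_ftr K) t = t"
proof -
  note F = nat_functors[OF assms(3)]
  have "whisker_left J (id_ftr K) t \<in> hom (fun_cat J K) F G"
    using whisker_left_hom[OF assms(1) is_functor_id[OF assms(2)] assms(3)] F assms(1,2)
    by (simp add: comp_id_left)
  then show ?thesis
    by (rule nt_eqI[OF _ assms(3)]) (use nat_component[OF assms(3)] in \<open>auto simp: hom_iff\<close>)
qed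

lemma whisker_right_id:
  assumes "category J" "t \<in> hom (fun_cat J K) F G"
  shows "whisker_right J t (id_ftr J) = t"
proof -
  note F = nat_functors[OF assms(2)]
  have "whisker_right J t (id_ftr J) \<in> hom (fun_cat J K) F G"
    using whisker_right_hom[OF assms(1) is_functor_id[OF assms(1)] assms(2)] F assms(1)
    by (simp add: comp_id_right)
  then show ?thesis
    by (rule nt_eqI[OF _ assms(2)]) auto
qed

lemma pull_back_simps [simp]:
  "is_functor J C X \<Longrightarrow> fob (pull_back I J C K) X = comp_ftr I X K"
  "is_nat_trans J C t \<Longrightarrow> far (pull_back I J C K) t = whisker_right I t K"
  by (auto simp: pull_back_def)

lemma is_functor_pull_back:
  assumes "category I" "category J" "category C" "is_functor I J K"
  shows "is_functor (fun_cat J C) (fun_cat I C) (pull_back I J C K)"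
proof (rule is_functorI)
  interpret C: category C by fact
  show "fob (pull_back I J C K) X \<in> Obj (fun_cat I C)" if "X \<in> Obj (fun_cat J C)" for X
    using that assms by (simp add: is_functor_comp)
  show "far (pull_back I J C K) f \<in> hom (fun_cat I C) (fob (pull_back I J C K) X) (fob (pull_back I J C K) Y)"
    if "f \<in> hom (fun_cat J C) X Y" for f X Y
    using whisker_right_hom[OF assms(1,4) that] nat_functors[OF that] that
    by (simp add: hom_fun_cat_iff)
  show "far (pull_back I J C K) (Idt (fun_cat J C) X) = Idt (fun_cat I C) (fob (pull_back I J C K) X)"
    if "X \<in> Obj (fun_cat J C)" for X
  proof -
    have X: "is_functor J C X" using that by simp
    interpret J: category "fun_cat J C" using assms by (simp add: category_fun_cat)
    interpret I: category "fun_cat I C" using assms by (simp add: category_fun_cat)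
    have "whisker_right I (Idt (fun_cat J C) X) K = Idt (fun_cat I C) (comp_ftr I X K)"
      by (rule nt_eqI[OF whisker_right_hom[OF assms(1,4) J.Idt_hom[OF that]] I.Idt_hom])
        (use X assms in \<open>auto simp: is_functor_comp is_functor_Obj\<close>)
    then show ?thesis using X J.Idt_hom[OF that] by (simp add: hom_fun_cat_iff)
  qed
  show "far (pull_back I J C K) (Cmp (fun_cat J C) g f) =
      Cmp (fun_cat I C) (far (pull_back I J C K) g) (far (pull_back I J C K) f)"
    if "f \<in> hom (fun_cat J C) X Y" "g \<in> hom (fun_cat J C) Y Z" for f g X Y Z
  proof -
    interpret J: category "fun_cat J C" using assms by (simp add: category_fun_cat)
    show ?thesis
      using whisker_right_Cmp[OF assms(1,2,3,4) that] that J.Cmp_hom[OF that]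
      by (simp add: hom_fun_cat_iff)
  qed
qed (auto simp: pull_back_def)

text \<open>Keeps the literal \<open>1\<close> in \<open>n + m + 1\<close> and in
  \<open>hom Delta n 1\<close>, so that simplified goals still match the facts about
  \<open>incl1\<close>, \<open>vertex\<close> and \<open>dec\<close>.\<close>

declare One_nat_def [simp del]

section \<open>Zigzags\<close>

lemma zigzag_simps [simp]:
  "zigzag D W X [] Y \<longleftrightarrow> X \<in> Obj D \<and> X = Y"
  "zigzag D W X (Fwd f # p) Y \<longleftrightarrow> f \<in> Arr D \<and> Dom D f = X \<and> zigzag D W (Cod D f) p Y"
  "zigzag D W X (Bwd f # p) Y \<longleftrightarrow> f \<in> W \<and> f \<in> Arr D \<and> Cod D f = X \<and> zigzag D W (Dom D f) p Y"
  by (subst zigzag.simps; auto simp: hom_iff)+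

text \<open>Well-typedness of both zigzags is part of the relation, because \<open>equivclp\<close>
  is reflexive and would relate an ill-typed list to itself.\<close>

definition zeq :: "('o, 'm) cat \<Rightarrow> 'm set \<Rightarrow> 'o \<Rightarrow> 'o \<Rightarrow> 'm step list \<Rightarrow> 'm step list \<Rightarrow> bool" where
  "zeq D W X Y p q \<longleftrightarrow> zigzag D W X p Y \<and> zigzag D W X q Y \<and> equivclp (zz_move D W X Y) p q"

text \<open>Formal inverses of weak equivalences and genuine inverses of isomorphisms are both
  instances, so one calculation serves the weak and the strongly symmetric case.\<close>

definition zinv :: "('o, 'm) cat \<Rightarrow> 'm set \<Rightarrow> 'o \<Rightarrow> 'o \<Rightarrow> 'm step list \<Rightarrow> 'm step list \<Rightarrow> bool" where
  "zinv D W X Y p q \<longleftrightarrow> zigzag D W X p Y \<and> zigzag D W Y q X \<and>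
     zeq D W X X (p @ q) [] \<and> zeq D W Y Y (q @ p) []"

lemma zeq_zigzag:
  assumes "zeq D W X Y p q"
  shows "zigzag D W X p Y" "zigzag D W X q Y"
  using assms by (auto simp: zeq_def)

lemma zeq_refl: "zigzag D W X p Y \<Longrightarrow> zeq D W X Y p p"
  by (simp add: zeq_def)

lemma zeq_sym: "zeq D W X Y p q \<Longrightarrow> zeq D W X Y q p"
  by (auto simp: zeq_def intro: equivclp_sym)

lemma zeq_trans [trans]: "zeq D W X Y p q \<Longrightarrow> zeq D W X Y q r \<Longrightarrow> zeq D W X Y p r"
  by (auto simp: zeq_def intro: equivclp_trans)

context category
begin

lemma zigzag_append: "zigzag C W X p Y \<Longrightarrow> zigzag C W Y q Z \<Longrightarrow> zigzag C W X (p @ q) Z"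
  by (induction rule: zigzag.induct) (auto simp: hom_iff)

lemma zigzag_Obj:
  assumes "zigzag C W X p Y"
  shows "X \<in> Obj C" "Y \<in> Obj C"
  using assms by (induction rule: zigzag.induct) (auto dest: hom_Obj)

text \<open>A move inside \<open>r\<close> is also a move inside \<open>a @ r @ b\<close>, with
  longer untouched ends; induction along the chain of moves does the rest.\<close>

lemma zeq_context:
  assumes "zeq C W X Y p q" "zigzag C W A a X" "zigzag C W Y b B"
  shows "zeq C W A B (a @ p @ b) (a @ q @ b)"
proof -
  have zz: "zigzag C W A (a @ r @ b) B" if "zigzag C W X r Y" for r
    using that assms(2,3) by (blast intro: zigzag_append)
  have "equivclp (zz_move C W X Y) p q" using assms(1) by (simp add: zeq_def)
  then have "equivclp (zz_move C W A B) (a @ p @ b) (a @ q @ b)"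
  proof (induction rule: equivclp_induct)
    case (step r s)
    have move: "zz_move C W A B (a @ r @ b) (a @ s @ b)" if rs: "zz_move C W X Y r s" for r s
    proof -
      obtain c d l k where "zz_basic C W l k" "r = c @ l @ d" "s = c @ k @ d"
        using rs unfolding zz_move_def by metis
      then have "zz_basic C W l k \<and> a @ r @ b = (a @ c) @ l @ (d @ b) \<and> a @ s @ b = (a @ c) @ k @ (d @ b)"
        by simp
      then show ?thesis using rs zz unfolding zz_move_def by blast
    qed
    from step(2) have "equivclp (zz_move C W A B) (a @ r @ b) (a @ s @ b)"
      using move by (auto intro: r_into_equivclp converse_r_into_equivclp)
    with step(3) show ?case by (rule equivclp_trans)
  qed simp
  then show ?thesis using zz assms(1) by (simp add: zeq_def)
qed

lemma zeq_append:
  assumes "zeq C W X Y p p'" "zeq C W Y Z q q'"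
  shows "zeq C W X Z (p @ q) (p' @ q')"
proof -
  note X = zigzag_Obj(1)[OF zeq_zigzag(1)[OF assms(1)]] and Z = zigzag_Obj(2)[OF zeq_zigzag(1)[OF assms(2)]]
  have "zeq C W X Z (p @ q) (p' @ q)"
    using zeq_context[OF assms(1), of X "[]" q Z] X zeq_zigzag[OF assms(2)] by simp
  also have "zeq C W X Z (p' @ q) (p' @ q')"
    using zeq_context[OF assms(2), of X p' "[]" Z] Z zeq_zigzag[OF assms(1)] by simp
  finally show ?thesis .
qed

lemma zeq_basic:
  assumes "zz_basic C W p q" "zigzag C W X p Y" "zigzag C W X q Y"
  shows "zeq C W X Y p q"
proof -
  have "zz_move C W X Y p q"
    unfolding zz_move_def using assms by (intro conjI exI[of _ "[]"] exI[of _ p] exI[of _ q]) auto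
  then show ?thesis using assms by (auto simp: zeq_def intro: r_into_equivclp)
qed

lemma zeq_Cmp:
  assumes "f \<in> hom C X Y" "g \<in> hom C Y Z"
  shows "zeq C W X Z [Fwd f, Fwd g] [Fwd (Cmp C g f)]"
  by (rule zeq_basic[OF zz_basic.cmp[OF assms]])
    (use Cmp_hom[OF assms] assms in \<open>auto simp: hom_iff Cod_Obj\<close>)

lemma zeq_Idt: "X \<in> Obj C \<Longrightarrow> zeq C W X X [Fwd (Idt C X)] []"
  by (rule zeq_basic[OF zz_basic.idt]) (use Idt_hom[of X] in \<open>auto simp: hom_iff\<close>)

lemma zeq_square:
  assumes "f \<in> hom C X Y" "g \<in> hom C Y Z" "h \<in> hom C X V" "k \<in> hom C V Z" "Cmp C g f = Cmp C k h"
  shows "zeq C W X Z [Fwd f, Fwd g] [Fwd h, Fwd k]"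
  using zeq_trans[OF zeq_Cmp[OF assms(1,2)] zeq_sym[OF zeq_Cmp[OF assms(3,4), folded assms(5)]]] .

lemma zinv_weq: "w \<in> W \<Longrightarrow> w \<in> hom C X Y \<Longrightarrow> zinv C W X Y [Fwd w] [Bwd w]"
  using zeq_basic[OF zz_basic.fwd_bwd, of w W X X] zeq_basic[OF zz_basic.bwd_fwd, of w W Y Y] hom_Obj[of w X Y]
  by (simp add: zinv_def hom_iff)

lemma zinv_iso:
  assumes "inverse_arrows C f g" "f \<in> hom C X Y"
  shows "zinv C W X Y [Fwd f] [Fwd g]"
proof -
  have g: "g \<in> hom C Y X" and gf: "Cmp C g f = Idt C X" and fg: "Cmp C f g = Idt C Y"
    using assms by (auto simp: inverse_arrows_def hom_iff)
  note o = hom_Obj[OF assms(2)]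
  show ?thesis
    using zeq_trans[OF zeq_Cmp[OF assms(2) g, unfolded gf] zeq_Idt[OF o(1)]]
      zeq_trans[OF zeq_Cmp[OF g assms(2), unfolded fg] zeq_Idt[OF o(2)]] assms(2) g o
    by (simp add: zinv_def hom_iff)
qed

text \<open>In a commutative square two invertible parallel sides may be replaced by their inverses:
  \<open>p' h ~ p' h q q' ~ p' p g q' ~ g q'\<close>. This is how a formal inverse is moved past an
  arrow.\<close>

lemma zeq_flip:
  assumes "zeq C W X Z (p @ g) (h @ q)" "zinv C W X Y p p'" "zinv C W V Z q q'"
    and g: "zigzag C W Y g Z" and h: "zigzag C W X h V"
  shows "zeq C W Y V (p' @ h) (g @ q')"
proof -
  have z: "zigzag C W X p Y" "zigzag C W Y p' X" "zigzag C W V q Z" "zigzag C W Z q' V"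
    and pp: "zeq C W Y Y (p' @ p) []" and qq: "zeq C W V V (q @ q') []"
    using assms(2,3) by (auto simp: zinv_def)
  have "zeq C W Y V (p' @ h @ q @ q') (p' @ h @ [])"
    using zeq_append[OF zeq_refl[OF z(2)] zeq_append[OF zeq_refl[OF h] qq]] .
  then have "zeq C W Y V (p' @ h) (p' @ h @ q @ q')" by (auto intro: zeq_sym)
  also have "zeq C W Y V (p' @ h @ q @ q') (p' @ p @ g @ q')"
    using zeq_context[OF zeq_sym[OF assms(1)] z(2,4)] by simp
  also have "zeq C W Y V (p' @ p @ g @ q') (g @ q')"
    using zeq_append[OF pp zeq_refl[OF zigzag_append[OF g z(4)]]] by simp
  finally show ?thesis .
qed

section \<open>From zigzags to arrows of the localization\<close>

lemma loc_class_eqI: "zeq C W X Y p q \<Longrightarrow> loc_class C W X Y p = loc_class C W X Y q"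
  unfolding loc_class_def zeq_def by (auto intro: equivclp_trans equivclp_sym)

text \<open>Moves connect well-typed zigzags only, so nothing ill-typed enters the class of a
  well-typed one.\<close>

lemma loc_class_mem: "zigzag C W X p Y \<Longrightarrow> equivclp (zz_move C W X Y) p q \<longleftrightarrow> zeq C W X Y p q"
proof -
  assume p: "zigzag C W X p Y"
  have "zigzag C W X q Y" if "equivclp (zz_move C W X Y) p q"
    using that p by (induction rule: equivclp_induct) (auto simp: zz_move_def)
  then show ?thesis using p by (auto simp: zeq_def)
qed

text \<open>Composition is encoded as a union over all representatives; by \<open>zeq_append\<close>
  the sets in this union are all equal.\<close>

lemma localization_Cmp:
  assumes "zigzag C W X p Y" "zigzag C W Y q Z"
  shows "Cmp (localization C W) (loc_class C W Y Z q) (loc_class C W X Y p) = loc_class C W X Z (p @ q)"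
proof -
  have "snd (snd (loc_class C W X Z (p' @ q'))) = snd (snd (loc_class C W X Z (p @ q)))"
    if "zeq C W X Y p p'" "zeq C W Y Z q q'" for p' q'
    using loc_class_eqI[OF zeq_append[OF that]] by simp
  moreover have "zeq C W X Y p p" "zeq C W Y Z q q" using assms by (auto intro: zeq_refl)
  ultimately have "(\<Union>p'\<in>{r. zeq C W X Y p r}. \<Union>q'\<in>{r. zeq C W Y Z q r}. snd (snd (loc_class C W X Z (p' @ q')))) =
      snd (snd (loc_class C W X Z (p @ q)))"
    by blast
  then show ?thesis
    by (simp add: localization_def loc_class_def loc_class_mem[OF assms(1)] loc_class_mem[OF assms(2)])
qed

lemma inverse_arrows_localization:
  assumes "zinv C W X Y p q"
  shows "inverse_arrows (localization C W) (loc_class C W X Y p) (loc_class C W Y X q)"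
proof -
  have z: "zigzag C W X p Y" "zigzag C W Y q X"
    and e: "zeq C W X X (p @ q) []" "zeq C W Y Y (q @ p) []"
    using assms by (auto simp: zinv_def)
  have [simp]: "Dom (localization C W) (loc_class C W X Y p) = X"
    "Cod (localization C W) (loc_class C W X Y p) = Y" for X Y p
    by (auto simp: localization_def loc_class_def)
  have "loc_class C W X Y p \<in> Arr (localization C W)" if "zigzag C W X p Y" for X Y p
    using that by (auto simp: localization_def)
  moreover have "Idt (localization C W) X = loc_class C W X X []" for X
    by (simp add: localization_def)
  ultimately show ?thesis
    using z localization_Cmp[OF z] localization_Cmp[OF z(2,1)] loc_class_eqI[OF e(1)] loc_class_eqI[OF e(2)]
    by (simp add: inverse_arrows_def hom_iff)
qed

end


section \<open>The simplex category\<close>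

text \<open>Any total function may represent the map and is restricted on the spot. Composites
  become plain lambda terms that are compared on \<open>{..m}\<close>, and the extensionality in
  \<open>Delta\<close> stays hidden.\<close>

definition dmap :: "nat \<Rightarrow> nat \<Rightarrow> (nat \<Rightarrow> nat) \<Rightarrow> delta_arr" where
  "dmap m n f = (m, n, \<lambda>i\<in>{..m}. f i)"

lemma Obj_Delta [simp]: "Obj Delta = UNIV"
  by (simp add: Delta_def)

lemma hom_Delta: "hom Delta m n = {(m, n, f) | f. f \<in> {..m} \<rightarrow>\<^sub>E {..n} \<and> mono_on {..m} f}"
  by (auto simp: hom_def Delta_def)

lemma dmap_hom:
  assumes "\<And>i. i \<le> m \<Longrightarrow> f i \<le> n" "\<And>i j. i \<le> j \<Longrightarrow> j \<le> m \<Longrightarrow> f i \<le> f j"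
  shows "dmap m n f \<in> hom Delta m n"
  using assms by (auto simp: hom_Delta dmap_def intro!: mono_onI)

lemma dmap_cases:
  assumes "a \<in> hom Delta m n"
  obtains f where "a = dmap m n f" "\<And>i. i \<le> m \<Longrightarrow> f i \<le> n" "\<And>i j. i \<le> j \<Longrightarrow> j \<le> m \<Longrightarrow> f i \<le> f j"
proof -
  from assms obtain f where f: "a = (m, n, f)" "f \<in> {..m} \<rightarrow>\<^sub>E {..n}" "mono_on {..m} f"
    by (auto simp: hom_Delta)
  show ?thesis
    by (rule that[of f]) (use f in \<open>auto simp: dmap_def extensional_restrict PiE_def Pi_def intro: mono_onD[of "{..m}"]\<close>)
qed

lemma dmap_eq_iff: "dmap m n f = dmap m n g \<longleftrightarrow> (\<forall>i\<le>m. f i = g i)"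
  by (auto simp: dmap_def restrict_def fun_eq_iff)

lemma Cmp_dmap:
  assumes "\<And>i. i \<le> m \<Longrightarrow> f i \<le> n"
  shows "Cmp Delta (dmap n k g) (dmap m n f) = dmap m k (\<lambda>i. g (f i))"
  using assms by (auto simp: Delta_def dmap_def compose_def restrict_def fun_eq_iff)

lemma Idt_Delta: "Idt Delta n = dmap n n (\<lambda>i. i)"
  by (simp add: Delta_def dmap_def)

lemma category_Delta: "category Delta"
proof
  fix f assume "f \<in> Arr Delta"
  show "Dom Delta f \<in> Obj Delta" "Cod Delta f \<in> Obj Delta" by simp_all
next
  fix n show "Idt Delta n \<in> hom Delta n n" by (auto simp: Idt_Delta intro: dmap_hom)
next
  fix f g m n k assume "f \<in> hom Delta m n" "g \<in> hom Delta n k"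
  then show "Cmp Delta g f \<in> hom Delta m k"
    by (elim dmap_cases) (auto simp: Cmp_dmap intro!: dmap_hom)
next
  fix f m n assume "f \<in> hom Delta m n"
  then show "Cmp Delta (Idt Delta n) f = f" "Cmp Delta f (Idt Delta m) = f"
    by (auto elim!: dmap_cases simp: Cmp_dmap Idt_Delta)
next
  fix f g h m n k l assume "f \<in> hom Delta m n" "g \<in> hom Delta n k" "h \<in> hom Delta k l"
  then show "Cmp Delta h (Cmp Delta g f) = Cmp Delta (Cmp Delta h g) f"
    by (auto elim!: dmap_cases simp: Cmp_dmap)
qed

lemma incl_dmap:
  "incl1 n m = dmap n (n + m + 1) (\<lambda>i. i)" "incl2 n m = dmap m (n + m + 1) (\<lambda>i. n + 1 + i)"
  by (auto simp: incl1_def incl2_def dmap_def)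

lemma incl_hom:
  "incl1 n m \<in> hom Delta n (n + m + 1)" "incl2 n m \<in> hom Delta m (n + m + 1)"
  by (auto simp: incl_dmap intro: dmap_hom)

lemma fob_dec [simp]: "fob dec (n, m) = n + m + 1"
  by (simp add: dec_def)

lemma far_dec:
  assumes "dmap n n' f \<in> hom Delta n n'" "dmap m m' g \<in> hom Delta m m'"
  shows "far dec (dmap n n' f, dmap m m' g) =
    dmap (n + m + 1) (n' + m' + 1) (\<lambda>i. if i \<le> n then f i else n' + 1 + g (i - (n + 1)))"
  using assms by (auto simp: dec_def hom_iff) (auto simp: dmap_def fun_eq_iff restrict_def)

lemma dmap_homD:
  assumes "dmap m n f \<in> hom Delta m n"
  shows "i \<le> m \<Longrightarrow> f i \<le> n" "i \<le> j \<Longrightarrow> j \<le> m \<Longrightarrow> f i \<le> f j"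
  using assms by (auto elim!: dmap_cases simp: dmap_eq_iff)

lemma far_dec_hom:
  assumes "a \<in> hom Delta n n'" "b \<in> hom Delta m m'"
  shows "far dec (a, b) \<in> hom Delta (n + m + 1) (n' + m' + 1)"
proof -
  from assms obtain f g where ab: "a = dmap n n' f" "b = dmap m m' g"
    by (metis dmap_cases)
  note f = dmap_homD[OF assms(1)[unfolded ab]] and g = dmap_homD[OF assms(2)[unfolded ab]]
  show ?thesis
    unfolding ab far_dec[OF assms[unfolded ab]]
  proof (rule dmap_hom)
    fix i assume "i \<le> n + m + 1"
    then show "(if i \<le> n then f i else n' + 1 + g (i - (n + 1))) \<le> n' + m' + 1"
      using f(1)[of i] g(1)[of "i - (n + 1)"] by auto
  next
    fix i j assume "i \<le> j" "j \<le> n + m + 1"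
    then show "(if i \<le> n then f i else n' + 1 + g (i - (n + 1))) \<le> (if j \<le> n then f j else n' + 1 + g (j - (n + 1)))"
      using f(1)[of i] f(2)[of i j] g(2)[of "i - (n + 1)" "j - (n + 1)"] by auto
  qed
qed

lemma category_Deltaop: "category Deltaop"
  by (intro category_op category_Delta)

lemma category_Deltaop2: "category Deltaop2"
  by (intro category_prod category_Deltaop)

lemma is_functor_dec: "is_functor Deltaop2 Deltaop dec"
proof (rule is_functorI)
  show "fob dec \<in> extensional (Obj Deltaop2)" by (simp add: extensional_def)
  show "far dec \<in> extensional (Arr Deltaop2)" by (auto simp: dec_def extensional_def)
  show "far dec f \<in> hom Deltaop (fob dec X) (fob dec Y)" if "f \<in> hom Deltaop2 X Y" for f X Y
    using that far_dec_hom by (cases f; cases X; cases Y) auto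
  show "far dec (Idt Deltaop2 X) = Idt Deltaop (fob dec X)" if "X \<in> Obj Deltaop2" for X
    by (cases X) (auto simp: Idt_Delta far_dec dmap_eq_iff dmap_hom)
  show "far dec (Cmp Deltaop2 g f) = Cmp Deltaop (far dec g) (far dec f)"
    if "f \<in> hom Deltaop2 X Y" "g \<in> hom Deltaop2 Y Z" for f g X Y Z
  proof -
    obtain f1 f2 g1 g2 x1 x2 y1 y2 z1 z2 where
      [simp]: "f = (f1, f2)" "g = (g1, g2)" "X = (x1, x2)" "Y = (y1, y2)" "Z = (z1, z2)"
      by (metis surj_pair)
    have h: "f1 \<in> hom Delta y1 x1" "f2 \<in> hom Delta y2 x2" "g1 \<in> hom Delta z1 y1" "g2 \<in> hom Delta z2 y2"
      using that by auto
    then obtain a b c d where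
      e: "f1 = dmap y1 x1 a" "f2 = dmap y2 x2 b" "g1 = dmap z1 y1 c" "g2 = dmap z2 y2 d"
      by (metis dmap_cases)
    note h' = h[unfolded e]
    have 1: "Cmp Delta f1 g1 = dmap z1 x1 (\<lambda>i. a (c i))" "Cmp Delta f2 g2 = dmap z2 x2 (\<lambda>i. b (d i))"
      unfolding e using dmap_homD(1)[OF h'(3)] dmap_homD(1)[OF h'(4)] by (simp_all add: Cmp_dmap)
    have 2: "Cmp Delta f1 g1 \<in> hom Delta z1 x1" "Cmp Delta f2 g2 \<in> hom Delta z2 x2"
      using h category.Cmp_hom[OF category_Delta] by auto
    have 3: "(if i \<le> z1 then c i else y1 + 1 + d (i - (z1 + 1))) \<le> y1 + y2 + 1" if "i \<le> z1 + z2 + 1" for i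
      using that dmap_homD(1)[OF h'(3), of i] dmap_homD(1)[OF h'(4), of "i - (z1 + 1)"] by auto
    show ?thesis
      using 2 dmap_homD(1)[OF h'(3)] unfolding 1
      by (simp add: 1 far_dec, simp add: e far_dec h' Cmp_dmap[OF 3] dmap_eq_iff)
  qed
qed (auto simp: dec_def)

lemma is_functor_diag: "category J \<Longrightarrow> is_functor J (prod_cat J J) (diag J)"
  by (rule is_functorI)
    (auto simp: diag_def category.Idt_hom[unfolded hom_iff] category.Cmp_hom[unfolded hom_iff]
      dest: category.hom_Obj simp: hom_iff category.Dom_Obj category.Cod_Obj)

lemma diag_simps [simp]:
  "X \<in> Obj J \<Longrightarrow> fob (diag J) X = (X, X)" "f \<in> Arr J \<Longrightarrow> far (diag J) f = (f, f)"
  by (auto simp: diag_def)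


section \<open>Simplicial objects and tensors\<close>

lemma
  assumes "is_functor Deltaop C X"
  shows simp_ob_Obj: "fob X n \<in> Obj C"
    and simp_ob_hom: "a \<in> hom Delta m n \<Longrightarrow> far X a \<in> hom C (fob X n) (fob X m)"
    and simp_ob_Idt: "far X (Idt Delta n) = Idt C (fob X n)"
    and simp_ob_Cmp: "a \<in> hom Delta m n \<Longrightarrow> b \<in> hom Delta n k \<Longrightarrow>
      far X (Cmp Delta b a) = Cmp C (far X a) (far X b)"
  using is_functor_Obj[OF assms, of n] is_functor_hom[OF assms, of a n m]
    is_functor_Idt[OF assms, of n] is_functor_Cmp[OF assms, of b k n a m] by auto

lemma
  assumes "is_functor Deltaop2 C Y"
  shows bisimp_ob_hom: "a \<in> hom Delta m n \<Longrightarrow> a' \<in> hom Delta m' n' \<Longrightarrow>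
      far Y (a, a') \<in> hom C (fob Y (n, n')) (fob Y (m, m'))"
    and bisimp_ob_Cmp: "a \<in> hom Delta m n \<Longrightarrow> b \<in> hom Delta n k \<Longrightarrow>
      a' \<in> hom Delta m' n' \<Longrightarrow> b' \<in> hom Delta n' k' \<Longrightarrow>
      far Y (Cmp Delta b a, Cmp Delta b' a') = Cmp C (far Y (a, a')) (far Y (b, b'))"
  using is_functor_hom[OF assms, of "(a, a')" "(n, n')" "(m, m')"]
    is_functor_Cmp[OF assms, of "(b, b')" "(k, k')" "(n, n')" "(a, a')" "(m, m')"] by auto

lemma simp_component:
  "t \<in> hom (Simp C) X Y \<Longrightarrow> component t n \<in> hom C (fob X n) (fob Y n)"
  using nat_component[of t Deltaop C X Y n] by simp

lemma bisimp_component: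
  "t \<in> hom (Bisimp C) X Y \<Longrightarrow> component t (n, m) \<in> hom C (fob X (n, m)) (fob Y (n, m))"
  using nat_component[of t Deltaop2 C X Y "(n, m)"] by simp

lemma simp_naturality:
  "t \<in> hom (Simp C) X Y \<Longrightarrow> a \<in> hom Delta m n \<Longrightarrow>
    Cmp C (component t m) (far X a) = Cmp C (far Y a) (component t n)"
  using naturality[of t Deltaop C X Y a n m] by simp

lemma bisimp_naturality:
  "t \<in> hom (Bisimp C) X Y \<Longrightarrow> a \<in> hom Delta m n \<Longrightarrow> a' \<in> hom Delta m' n' \<Longrightarrow>
    Cmp C (component t (m, m')) (far X (a, a')) = Cmp C (far Y (a, a')) (component t (n, n'))"
  using naturality[of t Deltaop2 C X Y "(a, a')" "(n, n')" "(m, m')"] by simp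

lemma simp_homI:
  assumes "is_functor Deltaop C X" "is_functor Deltaop C Y"
    and "\<And>n. c n \<in> hom C (fob X n) (fob Y n)"
    and "\<And>a m n. a \<in> hom Delta m n \<Longrightarrow> Cmp C (c m) (far X a) = Cmp C (far Y a) (c n)"
  shows "NT X Y c \<in> hom (Simp C) X Y"
  using assms by (intro nat_transI) auto

lemma bisimp_homI:
  assumes "is_functor Deltaop2 C X" "is_functor Deltaop2 C Y"
    and "\<And>n m. c (n, m) \<in> hom C (fob X (n, m)) (fob Y (n, m))"
    and "\<And>a a' m m' n n'. a \<in> hom Delta m n \<Longrightarrow> a' \<in> hom Delta m' n' \<Longrightarrow>
      Cmp C (c (m, m')) (far X (a, a')) = Cmp C (far Y (a, a')) (c (n, n'))"
  shows "NT X Y c \<in> hom (Bisimp C) X Y"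
proof (rule nat_transI[OF assms(1,2)])
  fix f X' Y' assume "f \<in> hom Deltaop2 X' Y'"
  then show "Cmp C (c Y') (far X f) = Cmp C (far Y f) (c X')"
    using assms(4) by (cases f; cases X'; cases Y') auto
qed (use assms(3) in \<open>auto simp: extensional_def\<close>)

lemma category_Simp: "category C \<Longrightarrow> category (Simp C)"
  by (intro category_fun_cat category_Deltaop)

lemma category_Bisimp: "category C \<Longrightarrow> category (Bisimp C)"
  by (intro category_fun_cat category_Deltaop2)

lemma is_functor_dec_pb: "category C \<Longrightarrow> is_functor (Simp C) (Bisimp C) (dec_pb C)"
  by (intro is_functor_pull_back category_Deltaop category_Deltaop2 is_functor_dec)

lemma is_functor_diag_pb: "category C \<Longrightarrow> is_functor (Bisimp C) (Simp C) (diag_pb C)"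
  by (intro is_functor_pull_back category_Deltaop category_Deltaop2 is_functor_diag)

section \<open>Cylinders: tensors with the interval and homotopies\<close>

definition vertex :: "nat \<Rightarrow> nat \<Rightarrow> delta_arr" where
  "vertex c n = dmap n 1 (\<lambda>_. c)"

lemma vertex_hom: "c \<le> 1 \<Longrightarrow> vertex c n \<in> hom Delta n 1"
  by (auto simp: vertex_def intro: dmap_hom)

lemma Cmp_vertex: "f \<in> hom Delta m n \<Longrightarrow> Cmp Delta (vertex c n) f = vertex c m"
  by (elim dmap_cases) (simp add: vertex_def Cmp_dmap)

text \<open>A morphism \<open>\<Delta>\<^sub>1 \<otimes> X \<rightarrow> B\<close>, given by its restrictions to the summands of \<open>(\<Delta>\<^sub>1 \<otimes> X)\<^sub>n\<close>.\<close>

definition homotopy ::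
  "('o, 'm) cat \<Rightarrow> ('o, 'm) simp_ob \<Rightarrow> ('o, 'm) simp_ob \<Rightarrow> (nat \<Rightarrow> delta_arr \<Rightarrow> 'm) \<Rightarrow> bool" where
  "homotopy C X B h \<longleftrightarrow> (\<forall>n. \<forall>a\<in>hom Delta n 1. h n a \<in> hom C (fob X n) (fob B n)) \<and>
     (\<forall>m n. \<forall>f\<in>hom Delta m n. \<forall>a\<in>hom Delta n 1.
        Cmp C (far B f) (h n a) = Cmp C (h m (Cmp Delta a f)) (far X f))"

lemma homotopyD:
  assumes "homotopy C X B h" "a \<in> hom Delta n 1"
  shows "h n a \<in> hom C (fob X n) (fob B n)"
    and "f \<in> hom Delta m n \<Longrightarrow> Cmp C (far B f) (h n a) = Cmp C (h m (Cmp Delta a f)) (far X f)"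
  using assms by (auto simp: homotopy_def)

context category
begin

lemma coproduct_eqI:
  assumes "is_coproduct C I A T j" "h \<in> hom C T B" "h' \<in> hom C T B"
    and "\<And>i. i \<in> I \<Longrightarrow> Cmp C h (j i) = Cmp C h' (j i)"
  shows "h = h'"
proof -
  have j: "\<forall>i\<in>I. Cmp C h' (j i) \<in> hom C (A i) B" "B \<in> Obj C"
    using assms(1,3) hom_Obj(2)[OF assms(3)] by (auto simp: is_coproduct_def intro: Cmp_hom)
  then have "\<exists>!k. k \<in> hom C T B \<and> (\<forall>i\<in>I. Cmp C k (j i) = Cmp C h' (j i))"
    using assms(1) by (simp add: is_coproduct_def)
  then show ?thesis using assms(2-4) by blast
qed

lemma coproduct_lift:
  assumes "is_coproduct C I A T j" "B \<in> Obj C" "\<And>i. i \<in> I \<Longrightarrow> f i \<in> hom C (A i) B"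
  shows "\<exists>h. h \<in> hom C T B \<and> (\<forall>i\<in>I. Cmp C h (j i) = f i)"
proof -
  have "\<exists>!h. h \<in> hom C T B \<and> (\<forall>i\<in>I. Cmp C h (j i) = f i)"
    using assms by (simp add: is_coproduct_def)
  then show ?thesis by (rule ex1_implies_ex)
qed

lemma tensorD:
  assumes "is_tensor C k X T j"
  shows "is_functor Deltaop C X" "is_functor Deltaop C T"
    and "is_coproduct C (hom Delta n k) (\<lambda>_. fob X n) (fob T n) (j n)"
    and "a \<in> hom Delta n k \<Longrightarrow> j n a \<in> hom C (fob X n) (fob T n)"
    and "f \<in> hom Delta m n \<Longrightarrow> a \<in> hom Delta n k \<Longrightarrow>
      Cmp C (far T f) (j n a) = Cmp C (j m (Cmp Delta a f)) (far X f)"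
  using assms by (auto simp: is_tensor_def is_coproduct_def)

lemma tensor_eqI:
  assumes "is_tensor C k X T j" "H \<in> hom (Simp C) T B" "H' \<in> hom (Simp C) T B"
    and "\<And>n a. a \<in> hom Delta n k \<Longrightarrow> Cmp C (component H n) (j n a) = Cmp C (component H' n) (j n a)"
  shows "H = H'"
  using assms(2,3)
proof (rule nt_eqI)
  fix n
  show "component H n = component H' n"
    by (rule coproduct_eqI[OF tensorD(3)[OF assms(1), of n] simp_component[OF assms(2)] simp_component[OF assms(3)]])
      (rule assms(4))
qed

text \<open>The coproducts give the map degree by degree. Simplicial naturality is tested on the
  summands, where it becomes the compatibility condition in \<open>homotopy\<close>.\<close>

lemma tensor_lift:
  assumes T: "is_tensor C 1 X T j" and B: "is_functor Deltaop C B" and h: "homotopy C X B h"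
  shows "\<exists>H\<in>hom (Simp C) T B. \<forall>n. \<forall>a\<in>hom Delta n 1. Cmp C (component H n) (j n a) = h n a"
proof -
  have "\<exists>H. H \<in> hom C (fob T n) (fob B n) \<and> (\<forall>a\<in>hom Delta n 1. Cmp C H (j n a) = h n a)" for n
    by (rule coproduct_lift[OF tensorD(3)[OF T] simp_ob_Obj[OF B] homotopyD(1)[OF h]])
  then obtain H where H: "\<And>n. H n \<in> hom C (fob T n) (fob B n)"
    and Hj: "\<And>n a. a \<in> hom Delta n 1 \<Longrightarrow> Cmp C (H n) (j n a) = h n a"
    by metis
  have "NT T B H \<in> hom (Simp C) T B"
  proof (rule simp_homI[OF tensorD(2)[OF T] B H])
    fix f m n assume f: "f \<in> hom Delta m n"
    note Tf = simp_ob_hom[OF tensorD(2)[OF T] f] and Bf = simp_ob_hom[OF B f]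
      and Xf = simp_ob_hom[OF tensorD(1)[OF T] f]
    show "Cmp C (H m) (far T f) = Cmp C (far B f) (H n)"
    proof (rule coproduct_eqI[OF tensorD(3)[OF T, of n] Cmp_hom[OF Tf H] Cmp_hom[OF H Bf]])
      fix a assume a: "a \<in> hom Delta n 1"
      have af: "Cmp Delta a f \<in> hom Delta m 1"
        using category.Cmp_hom[OF category_Delta f a] .
      have "Cmp C (Cmp C (H m) (far T f)) (j n a) = Cmp C (H m) (Cmp C (j m (Cmp Delta a f)) (far X f))"
        using Cmp_assoc[OF tensorD(4)[OF T a] Tf H] tensorD(5)[OF T f a] by simp
      also have "\<dots> = Cmp C (h m (Cmp Delta a f)) (far X f)"
        using Cmp_assoc[OF Xf tensorD(4)[OF T af] H] Hj[OF af] by simp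
      also have "\<dots> = Cmp C (Cmp C (far B f) (H n)) (j n a)"
        using Cmp_assoc[OF tensorD(4)[OF T a] H Bf] Hj[OF a] homotopyD(2)[OF h a f] by simp
      finally show "Cmp C (Cmp C (H m) (far T f)) (j n a) = Cmp C (Cmp C (far B f) (H n)) (j n a)" .
    qed
  qed
  then show ?thesis using Hj by (intro bexI[of _ "NT T B H"]) auto
qed

lemma tensor_end:
  assumes T: "is_tensor C 1 X T j" and c: "c \<le> 1"
  shows "NT X T (\<lambda>n. j n (vertex c n)) \<in> hom (Simp C) X T"
  by (rule simp_homI[OF tensorD(1,2)[OF T] tensorD(4)[OF T]])
    (use tensorD(5)[OF T _ vertex_hom[OF c]] in \<open>auto simp: Cmp_vertex vertex_hom[OF c]\<close>)

text \<open>Both ends are sections of \<open>p\<close>, hence in \<open>W\<close> by 2-out-of-3, and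
  composing \<open>H\<close> with an element of \<open>W\<close> does not affect whether it lies in
  \<open>W\<close>.\<close>

lemma tensor_ends_weq_iff:
  assumes W: "weakly_saturated (Simp C) W" and T: "is_tensor C 1 X T j"
    and p: "p \<in> hom (Simp C) T X" "p \<in> W"
    and pj: "\<And>n a. a \<in> hom Delta n 1 \<Longrightarrow> Cmp C (component p n) (j n a) = Idt C (fob X n)"
    and H: "H \<in> hom (Simp C) T B"
  shows "Cmp (Simp C) H (NT X T (\<lambda>n. j n (vertex 0 n))) \<in> W \<longleftrightarrow>
    Cmp (Simp C) H (NT X T (\<lambda>n. j n (vertex 1 n))) \<in> W"
proof -
  interpret S: category "Simp C" by (intro category_Simp category_axioms)
  note X = tensorD(1)[OF T]
  define i where "i c = NT X T (\<lambda>n. j n (vertex c n))" for c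
  have i: "i c \<in> hom (Simp C) X T" if "c \<le> 1" for c
    using tensor_end[OF T that] by (simp add: i_def)
  have "Cmp (Simp C) p (i c) = Idt (Simp C) X" if "c \<le> 1" for c
    by (rule nt_eqI[OF S.Cmp_hom[OF i[OF that] p(1)] S.Idt_hom])
      (use X in \<open>auto simp: i_def pj vertex_hom[OF that]\<close>)
  moreover have "Idt (Simp C) X \<in> W" using W X by (simp add: weakly_saturated_def)
  ultimately have "i c \<in> W" if "c \<le> 1" for c
    using W i[OF that] p that unfolding weakly_saturated_def by metis
  then have "Cmp (Simp C) H (i c) \<in> W \<longleftrightarrow> H \<in> W" if "c \<le> 1" for c
    using W i[OF that] that H unfolding weakly_saturated_def by blast
  from this[of 0] this[of 1] show ?thesis by (simp add: i_def)
qed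

lemma homotopic_weq_iff:
  assumes W: "W1 C W" "weakly_saturated (Simp C) W"
    and f: "f \<in> hom (Simp C) X B" and g: "g \<in> hom (Simp C) X B" and h: "homotopy C X B h"
    and hf: "\<And>n. component f n = h n (vertex 0 n)" and hg: "\<And>n. component g n = h n (vertex 1 n)"
  shows "f \<in> W \<longleftrightarrow> g \<in> W"
proof -
  interpret S: category "Simp C" by (intro category_Simp category_axioms)
  obtain T j p where T: "is_tensor C 1 X T j" and p: "p \<in> hom (Simp C) T X" "p \<in> W"
    and pj: "\<And>n a. a \<in> hom Delta n 1 \<Longrightarrow> Cmp C (component p n) (j n a) = Idt C (fob X n)"
    using W(1) nat_functors(1)[OF f] unfolding W1_def fun_cat_simps by blast
  obtain H where H: "H \<in> hom (Simp C) T B"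
    and Hj: "\<And>n a. a \<in> hom Delta n 1 \<Longrightarrow> Cmp C (component H n) (j n a) = h n a"
    using tensor_lift[OF T nat_functors(2)[OF f] h] by blast
  have "Cmp (Simp C) H (NT X T (\<lambda>n. j n (vertex 0 n))) = f"
    by (rule nt_eqI[OF S.Cmp_hom[OF tensor_end[OF T] H] f]) (simp_all add: Hj vertex_hom hf)
  moreover have "Cmp (Simp C) H (NT X T (\<lambda>n. j n (vertex 1 n))) = g"
    by (rule nt_eqI[OF S.Cmp_hom[OF tensor_end[OF T] H] g]) (simp_all add: Hj vertex_hom hg)
  ultimately show ?thesis using tensor_ends_weq_iff[OF W(2) T p pj H] by simp
qed

end

text \<open>With a cylinder functorial in \<open>Y\<close>, the two ends are sections of the same
  object-wise weak equivalence and thus both equal its formal inverse; \<open>s\<close> and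
  \<open>t\<close> arise from them by composition with one and the same arrow.\<close>

lemma (in category) homotopic_zeq:
  assumes J: "category J" and W: "W1 C W"
    and s: "s \<in> hom (fun_cat J (Simp C)) F G" and t: "t \<in> hom (fun_cat J (Simp C)) F G"
    and h: "\<And>Y. Y \<in> Obj J \<Longrightarrow> homotopy C (fob F Y) (fob G Y) (h Y)"
    and hs: "\<And>Y n. Y \<in> Obj J \<Longrightarrow> component (component s Y) n = h Y n (vertex 0 n)"
    and ht: "\<And>Y n. Y \<in> Obj J \<Longrightarrow> component (component t Y) n = h Y n (vertex 1 n)"
    and nat: "\<And>f Y Y' n a. f \<in> hom J Y Y' \<Longrightarrow> a \<in> hom Delta n 1 \<Longrightarrow>
      Cmp C (component (far G f) n) (h Y n a) = Cmp C (h Y' n a) (component (far F f) n)"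
  shows "zeq (fun_cat J (Simp C)) (objectwise J (Simp C) W) F G [Fwd s] [Fwd t]"
proof -
  interpret J: category J by (rule J)
  interpret S: category "Simp C" by (intro category_Simp category_axioms)
  interpret D: category "fun_cat J (Simp C)" by (intro category_fun_cat J S.category_axioms)
  note F = nat_functors(1)[OF s] and G = nat_functors(2)[OF s]
  \<comment> \<open>(W1) offers a cylinder for each simplicial object, without any relation between
    them. One is chosen for each object and then indexed along \<open>F\<close>.\<close>
  obtain T j p where T': "\<And>X. X \<in> Obj (Simp C) \<Longrightarrow> is_tensor C 1 X (T X) (j X)"
    and p': "\<And>X. X \<in> Obj (Simp C) \<Longrightarrow> p X \<in> hom (Simp C) (T X) X"
    and pj': "\<And>X n a. X \<in> Obj (Simp C) \<Longrightarrow> a \<in> hom Delta n 1 \<Longrightarrow> Cmp C (component (p X) n) (j X n a) = Idt C (fob X n)"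
    and pW': "\<And>X. X \<in> Obj (Simp C) \<Longrightarrow> p X \<in> W"
    using W unfolding W1_def by metis
  define TY jY pY where "TY Y = T (fob F Y)" and "jY Y = j (fob F Y)" and "pY Y = p (fob F Y)" for Y
  have T: "is_tensor C 1 (fob F Y) (TY Y) (jY Y)"
    and p: "pY Y \<in> hom (Simp C) (TY Y) (fob F Y)" and pW: "pY Y \<in> W" if "Y \<in> Obj J" for Y
    using is_functor_Obj[OF F that] by (auto simp: TY_def jY_def pY_def intro: T' p' pW')
  have pj: "Cmp C (component (pY Y) n) (jY Y n a) = Idt C (fob (fob F Y) n)"
    if "Y \<in> Obj J" "a \<in> hom Delta n 1" for Y n a
    using is_functor_Obj[OF F that(1)] that(2) by (auto simp: jY_def pY_def intro: pj')
  note jh = tensorD(4)[OF T]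
  have ex: "\<exists>H\<in>hom (Simp C) (TY Y) (TY Y'). \<forall>n. \<forall>a\<in>hom Delta n 1.
      Cmp C (component H n) (jY Y n a) = Cmp C (jY Y' n a) (component (far F f) n)"
    if f: "f \<in> hom J Y Y'" for f Y Y'
  proof (rule tensor_lift[OF T[OF J.hom_Obj(1)[OF f]] tensorD(2)[OF T[OF J.hom_Obj(2)[OF f]]]])
    note Y' = J.hom_Obj(2)[OF f] and Ff = is_functor_hom[OF F f]
    note Ffn = simp_component[OF Ff]
    show "homotopy C (fob F Y) (TY Y') (\<lambda>n a. Cmp C (jY Y' n a) (component (far F f) n))"
      unfolding homotopy_def
    proof (intro conjI allI ballI)
      fix n a assume a: "a \<in> hom Delta n 1"
      show "Cmp C (jY Y' n a) (component (far F f) n) \<in> hom C (fob (fob F Y) n) (fob (TY Y') n)"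
        by (rule Cmp_hom[OF Ffn jh[OF Y' a]])
      fix m g assume g: "g \<in> hom Delta m n"
      have ag: "Cmp Delta a g \<in> hom Delta m 1" using category.Cmp_hom[OF category_Delta g a] .
      note Fg = simp_ob_hom[OF nat_functors(1)[OF Ff] g] and Fg' = simp_ob_hom[OF nat_functors(2)[OF Ff] g]
        and Tg = simp_ob_hom[OF tensorD(2)[OF T[OF Y']] g]
      show "Cmp C (far (TY Y') g) (Cmp C (jY Y' n a) (component (far F f) n)) =
          Cmp C (Cmp C (jY Y' m (Cmp Delta a g)) (component (far F f) m)) (far (fob F Y) g)"
        using Cmp_assoc[OF Ffn jh[OF Y' a] Tg] tensorD(5)[OF T[OF Y'] g a]
          Cmp_assoc[OF Ffn Fg' jh[OF Y' ag]] simp_naturality[OF Ff g] Cmp_assoc[OF Fg Ffn jh[OF Y' ag]]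
        by simp
    qed
  qed
  \<comment> \<open>Maps out of a cylinder are determined by their restrictions to the summands
    (\<open>tensor_eqI\<close>); this uniqueness makes the chosen maps functorial.\<close>
  define \<tau> where "\<tau> f = (SOME H. H \<in> hom (Simp C) (TY (Dom J f)) (TY (Cod J f)) \<and> (\<forall>n. \<forall>a\<in>hom Delta n 1.
      Cmp C (component H n) (jY (Dom J f) n a) = Cmp C (jY (Cod J f) n a) (component (far F f) n)))" for f
  have \<tau>': "\<tau> f \<in> hom (Simp C) (TY Y) (TY Y') \<and> (\<forall>n. \<forall>a\<in>hom Delta n 1.
      Cmp C (component (\<tau> f) n) (jY Y n a) = Cmp C (jY Y' n a) (component (far F f) n))"
    if f: "f \<in> hom J Y Y'" for f Y Y'
    using someI_ex[OF ex[OF f, unfolded Bex_def]] f by (simp add: \<tau>_def hom_iff)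
  then have \<tau>: "\<tau> f \<in> hom (Simp C) (TY Y) (TY Y')"
    and \<tau>j: "\<And>n a. a \<in> hom Delta n 1 \<Longrightarrow>
      Cmp C (component (\<tau> f) n) (jY Y n a) = Cmp C (jY Y' n a) (component (far F f) n)"
    if "f \<in> hom J Y Y'" for f Y Y'
    using that by blast+
  define TF where "TF = Ftr (\<lambda>Y\<in>Obj J. TY Y) (\<lambda>f\<in>Arr J. \<tau> f)"
  have fobT: "fob TF Y = TY Y" if "Y \<in> Obj J" for Y using that by (simp add: TF_def)
  have farT: "far TF f = \<tau> f" if "f \<in> hom J Y Y'" for f Y Y' using that by (simp add: TF_def hom_iff)
  have TF: "is_functor J (Simp C) TF"
  proof (rule is_functorI)
    show "fob TF Y \<in> Obj (Simp C)" if "Y \<in> Obj J" for Y using tensorD(2)[OF T[OF that]] that by (simp add: fobT)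
    show "far TF f \<in> hom (Simp C) (fob TF Y) (fob TF Y')" if "f \<in> hom J Y Y'" for f Y Y'
      using \<tau>[OF that] J.hom_Obj[OF that] that by (simp add: fobT farT)
    show "far TF (Idt J Y) = Idt (Simp C) (fob TF Y)" if Y: "Y \<in> Obj J" for Y
      unfolding fobT[OF Y] farT[OF J.Idt_hom[OF Y]]
    proof (rule tensor_eqI[OF T[OF Y] \<tau>[OF J.Idt_hom[OF Y]] S.Idt_hom])
      fix n a assume a: "a \<in> hom Delta n 1"
      show "Cmp C (component (\<tau> (Idt J Y)) n) (jY Y n a) = Cmp C (component (Idt (Simp C) (TY Y)) n) (jY Y n a)"
        using \<tau>j[OF J.Idt_hom[OF Y] a] Cmp_Idt_left[OF jh[OF Y a]] Cmp_Idt_right[OF jh[OF Y a]]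
        by (simp add: is_functor_Idt[OF F Y])
    qed (use tensorD(2)[OF T[OF Y]] in simp)
    show "far TF (Cmp J g f) = Cmp (Simp C) (far TF g) (far TF f)"
      if f: "f \<in> hom J Y Y'" and g: "g \<in> hom J Y' Y''" for f g Y Y' Y''
      unfolding farT[OF J.Cmp_hom[OF f g]] farT[OF f] farT[OF g]
    proof (rule tensor_eqI[OF T[OF J.hom_Obj(1)[OF f]] \<tau>[OF J.Cmp_hom[OF f g]] S.Cmp_hom[OF \<tau>[OF f] \<tau>[OF g]]])
      fix n a assume a: "a \<in> hom Delta n 1"
      note Y = J.hom_Obj[OF f] J.hom_Obj(2)[OF g]
      note Ff = simp_component[OF is_functor_hom[OF F f]] and Fg = simp_component[OF is_functor_hom[OF F g]]
      have "Cmp C (component (Cmp (Simp C) (\<tau> g) (\<tau> f)) n) (jY Y n a) =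
          Cmp C (component (\<tau> g) n) (Cmp C (jY Y' n a) (component (far F f) n))"
        using Cmp_assoc[OF jh[OF Y(1) a] simp_component[OF \<tau>[OF f]] simp_component[OF \<tau>[OF g]]] \<tau>j[OF f a]
        by simp
      also have "\<dots> = Cmp C (jY Y'' n a) (Cmp C (component (far F g) n) (component (far F f) n))"
        using Cmp_assoc[OF Ff jh[OF Y(2) a] simp_component[OF \<tau>[OF g]]] \<tau>j[OF g a]
          Cmp_assoc[OF Ff Fg jh[OF Y(3) a]] by simp
      also have "\<dots> = Cmp C (component (\<tau> (Cmp J g f)) n) (jY Y n a)"
        using \<tau>j[OF J.Cmp_hom[OF f g] a] is_functor_Cmp[OF F f g] by simp
      finally show "Cmp C (component (\<tau> (Cmp J g f)) n) (jY Y n a) =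
          Cmp C (component (Cmp (Simp C) (\<tau> g) (\<tau> f)) n) (jY Y n a)" by simp
    qed
  qed (auto simp: TF_def)
  \<comment> \<open>The projections assemble to the transformation that gets inverted.\<close>
  define P where "P = NT TF F (\<lambda>Y\<in>Obj J. pY Y)"
  have P: "P \<in> hom (fun_cat J (Simp C)) TF F"
    unfolding P_def
  proof (rule nat_transI[OF TF F])
    fix f Y Y' assume f: "f \<in> hom J Y Y'"
    note Y = J.hom_Obj[OF f]
    have "Cmp (Simp C) (pY Y') (\<tau> f) = Cmp (Simp C) (far F f) (pY Y)"
    proof (rule tensor_eqI[OF T[OF Y(1)] S.Cmp_hom[OF \<tau>[OF f] p[OF Y(2)]]
          S.Cmp_hom[OF p[OF Y(1)] is_functor_hom[OF F f]]])
      fix n a assume a: "a \<in> hom Delta n 1"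
      note Ff = simp_component[OF is_functor_hom[OF F f], of n]
      have "Cmp C (component (Cmp (Simp C) (pY Y') (\<tau> f)) n) (jY Y n a) = component (far F f) n"
        using Cmp_assoc[OF jh[OF Y(1) a] simp_component[OF \<tau>[OF f]] simp_component[OF p[OF Y(2)]]] \<tau>j[OF f a]
          Cmp_assoc[OF Ff jh[OF Y(2) a] simp_component[OF p[OF Y(2)]]] pj[OF Y(2) a] Cmp_Idt_left[OF Ff]
        by simp
      also have "\<dots> = Cmp C (component (Cmp (Simp C) (far F f) (pY Y)) n) (jY Y n a)"
        using Cmp_assoc[OF jh[OF Y(1) a] simp_component[OF p[OF Y(1)]] Ff] pj[OF Y(1) a] Cmp_Idt_right[OF Ff]
        by simp
      finally show "Cmp C (component (Cmp (Simp C) (pY Y') (\<tau> f)) n) (jY Y n a) =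
          Cmp C (component (Cmp (Simp C) (far F f) (pY Y)) n) (jY Y n a)" .
    qed
    then show "Cmp (Simp C) ((\<lambda>Y\<in>Obj J. pY Y) Y') (far TF f) = Cmp (Simp C) (far F f) ((\<lambda>Y\<in>Obj J. pY Y) Y)"
      using Y by (simp add: farT[OF f])
  qed (use p in \<open>auto simp: fobT\<close>)
  have PW: "P \<in> objectwise J (Simp C) W"
    using P pW by (auto simp: objectwise_def hom_iff P_def)
  let ?i = "\<lambda>c Y. NT (fob F Y) (TY Y) (\<lambda>n. jY Y n (vertex c n))"
  define I where "I c = NT F TF (\<lambda>Y\<in>Obj J. ?i c Y)" for c
  have I: "I c \<in> hom (fun_cat J (Simp C)) F TF" if c: "c \<le> 1" for c
    unfolding I_def
  proof (rule nat_transI[OF F TF])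
    fix f Y Y' assume f: "f \<in> hom J Y Y'"
    note Y = J.hom_Obj[OF f]
    have "Cmp (Simp C) (?i c Y') (far F f) =
        Cmp (Simp C) (\<tau> f) (?i c Y)"
      by (rule nt_eqI[OF S.Cmp_hom[OF is_functor_hom[OF F f] tensor_end[OF T[OF Y(2)] c]]
            S.Cmp_hom[OF tensor_end[OF T[OF Y(1)] c] \<tau>[OF f]]])
        (simp add: \<tau>j[OF f vertex_hom[OF c]])
    then show "Cmp (Simp C) ((\<lambda>Y\<in>Obj J. ?i c Y) Y') (far F f) =
        Cmp (Simp C) (far TF f) ((\<lambda>Y\<in>Obj J. ?i c Y) Y)"
      using Y by (simp add: farT[OF f])
  qed (use tensor_end[OF T c] in \<open>auto simp: fobT\<close>)
  have PI: "Cmp (fun_cat J (Simp C)) P (I c) = Idt (fun_cat J (Simp C)) F" if c: "c \<le> 1" for c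
  proof (rule nt_eqI[OF D.Cmp_hom[OF I[OF c] P] D.Idt_hom])
    fix Y assume Y: "Y \<in> Obj J"
    have "Cmp (Simp C) (pY Y) (?i c Y) = Idt (Simp C) (fob F Y)"
      by (rule nt_eqI[OF S.Cmp_hom[OF tensor_end[OF T[OF Y] c] p[OF Y]] S.Idt_hom])
        (use is_functor_Obj[OF F Y] in \<open>auto simp: pj[OF Y vertex_hom[OF c]]\<close>)
    then show "component (Cmp (fun_cat J (Simp C)) P (I c)) Y = component (Idt (fun_cat J (Simp C)) F) Y"
      using Y by (simp add: P_def I_def)
  qed (use F in simp)
  have "\<exists>H\<in>hom (Simp C) (TY Y) (fob G Y). \<forall>n. \<forall>a\<in>hom Delta n 1. Cmp C (component H n) (jY Y n a) = h Y n a"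
    if Y: "Y \<in> Obj J" for Y
    using tensor_lift[OF T[OF Y] _ h[OF Y]] is_functor_Obj[OF G Y] by simp
  then obtain H where H: "\<And>Y. Y \<in> Obj J \<Longrightarrow> H Y \<in> hom (Simp C) (TY Y) (fob G Y)"
    and Hj: "\<And>Y n a. Y \<in> Obj J \<Longrightarrow> a \<in> hom Delta n 1 \<Longrightarrow> Cmp C (component (H Y) n) (jY Y n a) = h Y n a"
    by metis
  \<comment> \<open>The homotopy as one transformation out of the cylinder, with restrictions
    \<open>s\<close> and \<open>t\<close> to the ends.\<close>
  define HN where "HN = NT TF G (\<lambda>Y\<in>Obj J. H Y)"
  have HN: "HN \<in> hom (fun_cat J (Simp C)) TF G"
    unfolding HN_def
  proof (rule nat_transI[OF TF G])
    fix f Y Y' assume f: "f \<in> hom J Y Y'"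
    note Y = J.hom_Obj[OF f]
    have "Cmp (Simp C) (H Y') (\<tau> f) = Cmp (Simp C) (far G f) (H Y)"
    proof (rule tensor_eqI[OF T[OF Y(1)] S.Cmp_hom[OF \<tau>[OF f] H[OF Y(2)]]
          S.Cmp_hom[OF H[OF Y(1)] is_functor_hom[OF G f]]])
      fix n a assume a: "a \<in> hom Delta n 1"
      note Ff = simp_component[OF is_functor_hom[OF F f], of n]
        and Gf = simp_component[OF is_functor_hom[OF G f], of n]
      show "Cmp C (component (Cmp (Simp C) (H Y') (\<tau> f)) n) (jY Y n a) =
          Cmp C (component (Cmp (Simp C) (far G f) (H Y)) n) (jY Y n a)"
        using Cmp_assoc[OF jh[OF Y(1) a] simp_component[OF \<tau>[OF f]] simp_component[OF H[OF Y(2)]]]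
          \<tau>j[OF f a] Cmp_assoc[OF Ff jh[OF Y(2) a] simp_component[OF H[OF Y(2)]]] Hj[OF Y(2) a]
          Cmp_assoc[OF jh[OF Y(1) a] simp_component[OF H[OF Y(1)]] Gf] Hj[OF Y(1) a] nat[OF f a]
        by simp
    qed
    then show "Cmp (Simp C) ((\<lambda>Y\<in>Obj J. H Y) Y') (far TF f) = Cmp (Simp C) (far G f) ((\<lambda>Y\<in>Obj J. H Y) Y)"
      using Y by (simp add: farT[OF f])
  qed (use H in \<open>auto simp: fobT\<close>)
  have HI: "Cmp (fun_cat J (Simp C)) HN (I c) = r"
    if c: "c \<le> 1" and r: "r \<in> hom (fun_cat J (Simp C)) F G"
      and rh: "\<And>Y n. Y \<in> Obj J \<Longrightarrow> component (component r Y) n = h Y n (vertex c n)" for c r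
  proof (rule nt_eqI[OF D.Cmp_hom[OF I[OF c] HN] r])
    fix Y assume Y: "Y \<in> Obj J"
    have "Cmp (Simp C) (H Y) (?i c Y) = component r Y"
      by (rule nt_eqI[OF S.Cmp_hom[OF tensor_end[OF T[OF Y] c] H[OF Y]] nat_component[OF r Y]])
        (auto simp: Hj[OF Y vertex_hom[OF c]] rh[OF Y])
    then show "component (Cmp (fun_cat J (Simp C)) HN (I c)) Y = component r Y"
      using Y by (simp add: HN_def I_def)
  qed
  let ?D = "fun_cat J (Simp C)" and ?V = "objectwise J (Simp C) W"
  \<comment> \<open>Read from left to right, \<open>I c\<close> equals \<open>I c\<close> followed
    by \<open>P\<close> and its inverse, and \<open>I c\<close> followed by \<open>P\<close> is the
    identity. The result does not depend on \<open>c\<close>.\<close>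
  have "zeq ?D ?V F TF [Fwd (I c)] [Bwd P]" if c: "c \<le> 1" for c
  proof -
    have IP: "zeq ?D ?V F F [Fwd (I c), Fwd P] []"
      using zeq_trans[OF D.zeq_Cmp[OF I[OF c] P, unfolded PI[OF c]] D.zeq_Idt] F by simp
    have z: "zinv ?D ?V TF F [Fwd P] [Bwd P]" using D.zinv_weq[OF PW P] .
    have "zeq ?D ?V F TF ([Fwd (I c)] @ []) ([Fwd (I c)] @ [Fwd P, Bwd P])"
      by (rule D.zeq_append[OF zeq_refl zeq_sym]) (use z I[OF c] TF in \<open>auto simp: zinv_def hom_iff\<close>)
    also have "zeq ?D ?V F TF ([Fwd (I c)] @ [Fwd P, Bwd P]) ([] @ [Bwd P])"
      using D.zeq_append[OF IP zeq_refl, of "[Bwd P]" TF] z TF by (simp add: zinv_def)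
    finally show ?thesis by simp
  qed
  note this[of 0] this[of 1]
  then have "zeq ?D ?V F TF [Fwd (I 0)] [Fwd (I 1)]"
    by (auto intro: zeq_trans zeq_sym)
  from D.zeq_append[OF this zeq_refl, of "[Fwd HN]" G]
  have "zeq ?D ?V F G [Fwd (I 0), Fwd HN] [Fwd (I 1), Fwd HN]"
    using HN nat_functors(2)[OF HN] by (simp add: hom_iff)
  note e = this
  have "zeq ?D ?V F G [Fwd s] [Fwd (I 0), Fwd HN]"
    using zeq_sym[OF D.zeq_Cmp[OF I HN, of 0]] HI[OF _ s hs] by simp
  also note e
  also have "zeq ?D ?V F G [Fwd (I 1), Fwd HN] [Fwd t]"
    using D.zeq_Cmp[OF I HN, of 1] HI[OF _ t ht] by simp
  finally show ?thesis .
qed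

section \<open>Finite sets\<close>

definition fmap :: "nat set \<Rightarrow> nat set \<Rightarrow> (nat \<Rightarrow> nat) \<Rightarrow> finset_arr" where
  "fmap S T f = (S, T, \<lambda>x\<in>S. f x)"

lemma Obj_FinSet [simp]: "S \<in> Obj FinSet \<longleftrightarrow> finite S \<and> S \<noteq> {}"
  by (simp add: FinSet_def)

lemma hom_FinSet:
  "hom FinSet S T = {(S, T, f) | f. finite S \<and> S \<noteq> {} \<and> finite T \<and> T \<noteq> {} \<and> f \<in> S \<rightarrow>\<^sub>E T}"
  by (auto simp: hom_def FinSet_def)

lemma fmap_hom_iff:
  "fmap S T f \<in> hom FinSet S T \<longleftrightarrow> finite S \<and> S \<noteq> {} \<and> finite T \<and> T \<noteq> {} \<and> (\<forall>x\<in>S. f x \<in> T)"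
  by (auto simp: hom_FinSet fmap_def)

lemma fmap_cases:
  assumes "a \<in> hom FinSet S T"
  obtains f where "a = fmap S T f" "\<And>x. x \<in> S \<Longrightarrow> f x \<in> T" "finite S" "S \<noteq> {}" "finite T" "T \<noteq> {}"
proof -
  from assms obtain f where "a = (S, T, f)" "finite S" "S \<noteq> {}" "finite T" "T \<noteq> {}" "f \<in> S \<rightarrow>\<^sub>E T"
    by (auto simp: hom_FinSet)
  then show ?thesis
    by (intro that[of f]) (auto simp: fmap_def extensional_restrict PiE_def)
qed

lemma fmap_eq_iff: "fmap S T f = fmap S T g \<longleftrightarrow> (\<forall>x\<in>S. f x = g x)"
  by (auto simp: fmap_def restrict_def fun_eq_iff)

lemma Cmp_fmap:
  assumes "\<And>x. x \<in> S \<Longrightarrow> f x \<in> T"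
  shows "Cmp FinSet (fmap T U g) (fmap S T f) = fmap S U (\<lambda>x. g (f x))"
  using assms by (auto simp: FinSet_def fmap_def compose_def restrict_def fun_eq_iff)

lemma Idt_FinSet: "Idt FinSet S = fmap S S (\<lambda>x. x)"
  by (simp add: FinSet_def fmap_def)

lemma category_FinSet: "category FinSet"
proof
  fix f assume "f \<in> Arr FinSet"
  then show "Dom FinSet f \<in> Obj FinSet" "Cod FinSet f \<in> Obj FinSet" by (auto simp: FinSet_def)
next
  fix S assume "S \<in> Obj FinSet"
  then show "Idt FinSet S \<in> hom FinSet S S" by (auto simp: Idt_FinSet fmap_hom_iff)
next
  fix f g S T U assume "f \<in> hom FinSet S T" "g \<in> hom FinSet T U"
  then show "Cmp FinSet g f \<in> hom FinSet S U"
    by (elim fmap_cases) (auto simp: Cmp_fmap fmap_hom_iff)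
next
  fix f S T assume "f \<in> hom FinSet S T"
  then show "Cmp FinSet (Idt FinSet T) f = f" "Cmp FinSet f (Idt FinSet S) = f"
    by (auto elim!: fmap_cases simp: Cmp_fmap Idt_FinSet)
next
  fix f g h S T U V assume "f \<in> hom FinSet S T" "g \<in> hom FinSet T U" "h \<in> hom FinSet U V"
  then show "Cmp FinSet h (Cmp FinSet g f) = Cmp FinSet (Cmp FinSet h g) f"
    by (auto elim!: fmap_cases simp: Cmp_fmap)
qed

lemma category_FinSetop: "category FinSetop"
  by (intro category_op category_FinSet)

lemma category_FinSetop2: "category FinSetop2"
  by (intro category_prod category_FinSetop)

lemma iota_simps [simp]: "fob iota n = {..n}"
  by (simp add: iota_def)

lemma far_iota: "dmap m n f \<in> hom Delta m n \<Longrightarrow> far iota (dmap m n f) = fmap {..m} {..n} f"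
  by (auto simp: iota_def hom_iff) (auto simp: dmap_def fmap_def)

lemma far_iota_hom: "a \<in> hom Delta m n \<Longrightarrow> far iota a \<in> hom FinSet {..m} {..n}"
  by (auto elim!: dmap_cases simp: far_iota dmap_hom fmap_hom_iff)

lemma is_functor_iota: "is_functor Deltaop FinSetop iota"
proof (rule is_functorI)
  fix n show "far iota (Idt Deltaop n) = Idt FinSetop (fob iota n)"
    by (simp add: Idt_Delta far_iota dmap_hom Idt_FinSet)
next
  fix f g m n k assume "f \<in> hom Deltaop m n" "g \<in> hom Deltaop n k"
  then have h: "f \<in> hom Delta n m" "g \<in> hom Delta k n" by simp_all
  then obtain a b where e: "f = dmap n m a" "g = dmap k n b" by (metis dmap_cases)
  note h' = h[unfolded e]
  have 1: "Cmp Delta f g = dmap k m (\<lambda>i. a (b i))"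
    unfolding e using dmap_homD(1)[OF h'(2)] by (rule Cmp_dmap)
  have "far iota (Cmp Delta f g) = fmap {..k} {..m} (\<lambda>i. a (b i))"
    using category.Cmp_hom[OF category_Delta h(2,1)] unfolding 1 by (rule far_iota)
  also have "\<dots> = Cmp FinSet (far iota f) (far iota g)"
    unfolding e far_iota[OF h'(1)] far_iota[OF h'(2)]
    by (rule Cmp_fmap[symmetric]) (use dmap_homD(1)[OF h'(2)] in simp)
  finally show "far iota (Cmp Deltaop g f) = Cmp FinSetop (far iota g) (far iota f)" by simp
qed (auto simp: far_iota_hom, auto simp: iota_def)

section \<open>Disjoint unions of finite sets\<close>

lemma lt_shift: "finite S \<Longrightarrow> x \<in> S \<Longrightarrow> x < shift S"
  by (simp add: shift_def less_Suc_eq_le)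

lemma shift_notin: "finite S \<Longrightarrow> shift S + t \<notin> S"
  using lt_shift by fastforce

lemma shift_atMost [simp]: "shift {..n} = Suc n"
proof -
  have "Max {..n} = n" by (rule Max_eqI) auto
  then show ?thesis by (simp add: shift_def)
qed

lemma disj_union_atMost [simp]: "disj_union {..n} {..m} = {..n + m + 1}"
proof -
  have "x \<in> (\<lambda>t. Suc n + t) ` {..m}" if "x \<le> n + m + 1" "\<not> x \<le> n" for x
    using that by (intro image_eqI[of _ _ "x - Suc n"]) auto
  then show ?thesis by (auto simp: disj_union_def)
qed

lemma disj_union_cases:
  assumes "x \<in> disj_union S T" "finite S"
  obtains "x \<in> S" | t where "t \<in> T" "x = shift S + t" "x \<notin> S"
  using assms shift_notin by (auto simp: disj_union_def)

lemma far_decs: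
  assumes "fmap S S' f \<in> hom FinSet S S'" "fmap T T' g \<in> hom FinSet T T'"
  shows "far decs (fmap S S' f, fmap T T' g) = fmap (disj_union S T) (disj_union S' T')
    (\<lambda>x. if x \<in> S then f x else shift S' + g (x - shift S))"
proof -
  have fin: "finite S" using assms by (simp add: fmap_hom_iff)
  show ?thesis using assms
    by (auto simp: decs_def hom_iff)
      (auto simp: fmap_def fun_eq_iff restrict_def elim!: disj_union_cases[OF _ fin])
qed

lemma fob_decs: "S \<in> Obj FinSet \<Longrightarrow> T \<in> Obj FinSet \<Longrightarrow> fob decs (S, T) = disj_union S T"
  by (simp add: decs_def)

lemma disj_union_Obj: "S \<in> Obj FinSet \<Longrightarrow> T \<in> Obj FinSet \<Longrightarrow> disj_union S T \<in> Obj FinSet"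
  by (auto simp: disj_union_def)

lemma decs_map_mem:
  assumes "x \<in> disj_union S T" "finite S" "\<And>x. x \<in> S \<Longrightarrow> f x \<in> S'" "\<And>x. x \<in> T \<Longrightarrow> g x \<in> T'"
  shows "(if x \<in> S then f x else shift S' + g (x - shift S)) \<in> disj_union S' T'"
  using assms by (auto elim!: disj_union_cases[OF _ assms(2)] simp: disj_union_def)

lemma far_decs_hom:
  assumes "a \<in> hom FinSet S S'" "b \<in> hom FinSet T T'"
  shows "far decs (a, b) \<in> hom FinSet (disj_union S T) (disj_union S' T')"
proof -
  from assms obtain f g where ab: "a = fmap S S' f" "b = fmap T T' g" by (metis fmap_cases)
  note h = assms[unfolded ab]
  have o: "disj_union S T \<in> Obj FinSet" "disj_union S' T' \<in> Obj FinSet"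
    using h disj_union_Obj by (auto simp: fmap_hom_iff)
  have "\<forall>x\<in>disj_union S T. (if x \<in> S then f x else shift S' + g (x - shift S)) \<in> disj_union S' T'"
    by (intro ballI decs_map_mem) (use h in \<open>auto simp: fmap_hom_iff\<close>)
  then show ?thesis
    unfolding ab far_decs[OF h] fmap_hom_iff using o by simp
qed

lemma is_functor_decs: "is_functor FinSetop2 FinSetop decs"
proof (rule is_functorI)
  show "fob decs \<in> extensional (Obj FinSetop2)" by (auto simp: decs_def extensional_def)
  show "far decs \<in> extensional (Arr FinSetop2)" by (auto simp: decs_def extensional_def)
  show "fob decs X \<in> Obj FinSetop" if "X \<in> Obj FinSetop2" for X
    using that disj_union_Obj by (cases X) (auto simp: fob_decs)
  show "far decs f \<in> hom FinSetop (fob decs X) (fob decs Y)" if "f \<in> hom FinSetop2 X Y" for f X Y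
  proof -
    obtain f1 f2 x1 x2 y1 y2 where e: "f = (f1, f2)" "X = (x1, x2)" "Y = (y1, y2)"
      by (metis surj_pair)
    have h: "f1 \<in> hom FinSet y1 x1" "f2 \<in> hom FinSet y2 x2" using that by (auto simp: e)
    show ?thesis
      using far_decs_hom[OF h] category.hom_Obj[OF category_FinSet h(1)]
        category.hom_Obj[OF category_FinSet h(2)]
      by (simp add: e fob_decs del: Obj_FinSet)
  qed
  show "far decs (Idt FinSetop2 X) = Idt FinSetop (fob decs X)" if X: "X \<in> Obj FinSetop2" for X
  proof -
    obtain S T where e: "X = (S, T)" by (metis surj_pair)
    have o: "S \<in> Obj FinSet" "T \<in> Obj FinSet" using X by (simp_all add: e)
    have h: "fmap S S (\<lambda>x. x) \<in> hom FinSet S S" "fmap T T (\<lambda>x. x) \<in> hom FinSet T T"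
      using o by (simp_all add: fmap_hom_iff)
    have "(if x \<in> S then x else shift S + (x - shift S)) = x" if "x \<in> disj_union S T" for x
      using that o by (auto simp: disj_union_def)
    then show ?thesis
      unfolding e using o by (simp add: Idt_FinSet far_decs[OF h] fob_decs fmap_eq_iff del: Obj_FinSet)
  qed
  show "far decs (Cmp FinSetop2 g f) = Cmp FinSetop (far decs g) (far decs f)"
    if "f \<in> hom FinSetop2 X Y" "g \<in> hom FinSetop2 Y Z" for f g X Y Z
  proof -
    obtain f1 f2 g1 g2 x1 x2 y1 y2 z1 z2 where
      p: "f = (f1, f2)" "g = (g1, g2)" "X = (x1, x2)" "Y = (y1, y2)" "Z = (z1, z2)"
      by (metis surj_pair)
    have h: "f1 \<in> hom FinSet y1 x1" "f2 \<in> hom FinSet y2 x2" "g1 \<in> hom FinSet z1 y1" "g2 \<in> hom FinSet z2 y2"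
      using that by (auto simp: p)
    then obtain a b c d where
      e: "f1 = fmap y1 x1 a" "f2 = fmap y2 x2 b" "g1 = fmap z1 y1 c" "g2 = fmap z2 y2 d"
      by (metis fmap_cases)
    note h' = h[unfolded e]
    have m: "c i \<in> y1" if "i \<in> z1" for i using h'(3) that by (simp add: fmap_hom_iff)
    have m': "d i \<in> y2" if "i \<in> z2" for i using h'(4) that by (simp add: fmap_hom_iff)
    have fin: "finite z1" "finite y1" using h'(1,3) by (simp_all add: fmap_hom_iff)
    have 1: "Cmp FinSet f1 g1 = fmap z1 x1 (\<lambda>i. a (c i))" "Cmp FinSet f2 g2 = fmap z2 x2 (\<lambda>i. b (d i))"
      unfolding e using m m' by (simp_all add: Cmp_fmap)
    have 2: "Cmp FinSet f1 g1 \<in> hom FinSet z1 x1" "Cmp FinSet f2 g2 \<in> hom FinSet z2 x2"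
      using h category.Cmp_hom[OF category_FinSet] by blast+
    have "far decs (Cmp FinSet f1 g1, Cmp FinSet f2 g2) = fmap (disj_union z1 z2) (disj_union x1 x2)
        (\<lambda>x. if x \<in> z1 then a (c x) else shift x1 + b (d (x - shift z1)))"
      using 2 unfolding 1 by (rule far_decs)
    also have "\<dots> = fmap (disj_union z1 z2) (disj_union x1 x2)
        (\<lambda>x. (\<lambda>x. if x \<in> y1 then a x else shift x1 + b (x - shift y1))
          (if x \<in> z1 then c x else shift y1 + d (x - shift z1)))"
      unfolding fmap_eq_iff using shift_notin[OF fin(2)] m by auto
    also have "\<dots> = Cmp FinSet (far decs (f1, f2)) (far decs (g1, g2))"
      unfolding e far_decs[OF h'(1,2)] far_decs[OF h'(3,4)]
      by (rule Cmp_fmap[symmetric]) (rule decs_map_mem[OF _ fin(1) m m'])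
    finally show ?thesis by (simp add: p)
  qed
qed

text \<open>Since \<open>shift {..n} = n + 1\<close>, the disjoint union of initial segments is
  concatenation, with the same formula on maps. The equality is strict, so no coherence isomorphisms
  have to be carried along.\<close>

lemma decs_iota:
  assumes "a \<in> hom Delta m n" "b \<in> hom Delta m' n'"
  shows "far decs (far iota a, far iota b) = far iota (far dec (a, b))"
proof -
  from assms obtain f g where ab: "a = dmap m n f" "b = dmap m' n' g" by (metis dmap_cases)
  note h = assms[unfolded ab]
  have i: "fmap {..m} {..n} f \<in> hom FinSet {..m} {..n}" "fmap {..m'} {..n'} g \<in> hom FinSet {..m'} {..n'}"
    using far_iota_hom[OF h(1)] far_iota_hom[OF h(2)] by (simp_all add: far_iota h)
  show ?thesis
    using far_dec_hom[OF h] unfolding ab far_dec[OF h] far_iota[OF h(1)] far_iota[OF h(2)] far_decs[OF i]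
    by (simp add: far_iota fmap_eq_iff flip: Suc_eq_plus1)
qed

section \<open>Fold maps and the transformation \<open>c_op\<close>\<close>

lemma fold_map_fmap: "fold_map S = fmap (disj_union S S) S (\<lambda>x. if x \<in> S then x else x - shift S)"
  by (simp add: fold_map_def fmap_def)

lemma fold_map_hom: "S \<in> Obj FinSet \<Longrightarrow> fold_map S \<in> hom FinSet (disj_union S S) S"
  using disj_union_Obj[of S S] by (auto simp: fold_map_fmap fmap_hom_iff elim!: disj_union_cases)

lemma fold_map_natural:
  assumes "a \<in> hom FinSet S T"
  shows "Cmp FinSet (fold_map T) (far decs (a, a)) = Cmp FinSet a (fold_map S)"
proof -
  from assms obtain f where a: "a = fmap S T f" and f: "\<And>x. x \<in> S \<Longrightarrow> f x \<in> T" and fin: "finite S" "finite T"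
    by (metis fmap_cases)
  have 1: "(if x \<in> S then x else x - shift S) \<in> S" if "x \<in> disj_union S S" for x
    using that by (auto elim!: disj_union_cases[OF _ fin(1)])
  have "Cmp FinSet (fold_map T) (far decs (a, a)) = fmap (disj_union S S) T
      (\<lambda>x. (\<lambda>x. if x \<in> T then x else x - shift T) (if x \<in> S then f x else shift T + f (x - shift S)))"
    unfolding a far_decs[OF assms[unfolded a] assms[unfolded a]] fold_map_fmap
    by (rule Cmp_fmap) (rule decs_map_mem[OF _ fin(1) f f])
  also have "\<dots> = fmap (disj_union S S) T (\<lambda>x. f (if x \<in> S then x else x - shift S))"
    unfolding fmap_eq_iff using shift_notin[OF fin(2)] f by auto
  also have "\<dots> = Cmp FinSet a (fold_map S)"
    unfolding a fold_map_fmap by (rule Cmp_fmap[symmetric]) (rule 1)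
  finally show ?thesis .
qed

text \<open>Each point may be sent to either of its two copies. The pattern that stays in the first
  copy is used in \<open>front_c_mid\<close>, the one that changes over to the second copy in
  \<open>\<theta>_c_mid\<close>.\<close>

lemma fold_map_section:
  assumes "dmap n (n + n + 1) g \<in> hom Delta n (n + n + 1)" "\<And>i. i \<le> n \<Longrightarrow> g i = i \<or> g i = n + 1 + i"
  shows "Cmp FinSet (fold_map {..n}) (far iota (dmap n (n + n + 1) g)) = Idt FinSet {..n}"
  unfolding far_iota[OF assms(1)] fold_map_fmap Idt_FinSet disj_union_atMost
  by (subst Cmp_fmap) (use dmap_homD(1)[OF assms(1)] assms(2) in \<open>fastforce simp: fmap_eq_iff\<close>)+

lemma
  assumes "is_functor FinSetop C Z"
  shows fin_ob_hom: "a \<in> hom FinSet S T \<Longrightarrow> far Z a \<in> hom C (fob Z T) (fob Z S)"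
    and fin_ob_Idt: "S \<in> Obj FinSet \<Longrightarrow> far Z (Idt FinSet S) = Idt C (fob Z S)"
    and fin_ob_Cmp: "a \<in> hom FinSet S T \<Longrightarrow> b \<in> hom FinSet T U \<Longrightarrow>
      far Z (Cmp FinSet b a) = Cmp C (far Z a) (far Z b)"
  using is_functor_hom[OF assms, of a T S] is_functor_Idt[OF assms, of S]
    is_functor_Cmp[OF assms, of b U T a S] by auto

context category
begin

lemma category_Fin: "category (Fin C)"
  by (intro category_fun_cat category_FinSetop category_axioms)

lemma is_functor_iota_pb: "is_functor (Fin C) (Simp C) (iota_pb C)"
  by (intro is_functor_pull_back category_Deltaop category_FinSetop is_functor_iota category_axioms)

lemma is_functor_decs_pb: "is_functor (Fin C) (fun_cat FinSetop2 C) (decs_pb C)"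
  by (intro is_functor_pull_back category_FinSetop category_FinSetop2 is_functor_decs category_axioms)

lemma is_functor_diags_pb: "is_functor (fun_cat FinSetop2 C) (Fin C) (diags_pb C)"
  by (intro is_functor_pull_back category_FinSetop category_FinSetop2 is_functor_diag category_axioms)

text \<open>Naturality in the finite set is \<open>fold_map_natural\<close>; naturality in the
  functor holds because its morphisms commute with the images of all maps, in particular of fold
  maps.\<close>

lemma c_op_hom: "c_op C \<in> hom (fun_cat (Fin C) (Fin C)) (id_ftr (Fin C)) (comp_ftr (Fin C) (diags_pb C) (decs_pb C))"
proof -
  let ?G = "comp_ftr (Fin C) (diags_pb C) (decs_pb C)"
  let ?c = "\<lambda>Z. NT Z (fob ?G Z) (\<lambda>S\<in>Obj FinSetop. far Z (fold_map S))"
  interpret F: category "Fin C" by (rule category_Fin)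
  have G: "is_functor (Fin C) (Fin C) ?G"
    by (rule is_functor_comp[OF category_Fin is_functor_decs_pb is_functor_diags_pb])
  have fobG: "fob ?G Z = comp_ftr FinSetop (comp_ftr FinSetop2 Z decs) (diag FinSetop)"
    if "is_functor FinSetop C Z" for Z
    using that is_functor_comp[OF category_FinSetop2 is_functor_decs that] by simp
  have c: "?c Z \<in> hom (Fin C) Z (fob ?G Z)"
    if Z: "is_functor FinSetop C Z" for Z
  proof (rule nat_transI[OF Z])
    show "is_functor FinSetop C (fob ?G Z)" using is_functor_Obj[OF G] Z by simp
    show "(\<lambda>S\<in>Obj FinSetop. far Z (fold_map S)) S \<in> hom C (fob Z S) (fob (fob ?G Z) S)" if "S \<in> Obj FinSetop" for S
      using fin_ob_hom[OF Z fold_map_hom[of S]] that by (simp add: fobG[OF Z] fob_decs del: Obj_FinSet)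
    show "Cmp C ((\<lambda>S\<in>Obj FinSetop. far Z (fold_map S)) T) (far Z f) =
        Cmp C (far (fob ?G Z) f) ((\<lambda>S\<in>Obj FinSetop. far Z (fold_map S)) S)"
      if f: "f \<in> hom FinSetop S T" for f S T
    proof -
      have f': "f \<in> hom FinSet T S" using f by simp
      note o = category.hom_Obj[OF category_FinSet f']
      show ?thesis
        using fin_ob_Cmp[OF Z fold_map_hom[OF o(1)] f'] fin_ob_Cmp[OF Z far_decs_hom[OF f' f'] fold_map_hom[OF o(2)]]
          fold_map_natural[OF f'] o f'
        by (simp add: fobG[OF Z] hom_iff del: Obj_FinSet)
    qed
  qed auto
  have "NT (id_ftr (Fin C)) ?G (\<lambda>Z\<in>Obj (Fin C). ?c Z)
      \<in> hom (fun_cat (Fin C) (Fin C)) (id_ftr (Fin C)) ?G"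
  proof (rule nat_transI[OF is_functor_id[OF category_Fin] G])
    fix f Z Z' assume f: "f \<in> hom (Fin C) Z Z'"
    note Z = nat_functors[OF f]
    have "Cmp (Fin C) (?c Z') f =
        Cmp (Fin C) (far ?G f) (?c Z)"
    proof (rule nt_eqI[OF F.Cmp_hom[OF f c[OF Z(2)]] F.Cmp_hom[OF c[OF Z(1)] is_functor_hom[OF G f]]])
      fix S assume S: "S \<in> Obj FinSetop"
      have "f \<in> Arr (Fin C)" using f by (simp add: hom_iff)
      moreover have "whisker_right FinSetop2 f decs \<in> Arr (fun_cat FinSetop2 C)"
        using whisker_right_hom[OF category_FinSetop2 is_functor_decs f] by (simp add: hom_iff)
      ultimately show "component (Cmp (Fin C) (?c Z') f) S =
          component (Cmp (Fin C) (far ?G f) (?c Z)) S"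
        using S naturality[OF f, of "fold_map S" S "disj_union S S"] fold_map_hom[of S]
        by (simp add: fob_decs)
    qed
    then show "Cmp (Fin C) ((\<lambda>Z\<in>Obj (Fin C). ?c Z) Z') (far (id_ftr (Fin C)) f) =
        Cmp (Fin C) (far ?G f) ((\<lambda>Z\<in>Obj (Fin C). ?c Z) Z)"
      using Z f by (simp add: hom_iff)
  qed (use c in auto)
  then show ?thesis by (simp add: c_op_def)
qed

end

section \<open>The subdivision and its faces\<close>

lemma dec_incl:
  assumes "a \<in> hom Delta m n" "a' \<in> hom Delta m' n'"
  shows "Cmp Delta (far dec (a, a')) (incl1 m m') = Cmp Delta (incl1 n n') a"
    and "Cmp Delta (far dec (a, a')) (incl2 m m') = Cmp Delta (incl2 n n') a'"
proof -
  from assms obtain f g where ab: "a = dmap m n f" "a' = dmap m' n' g" by (metis dmap_cases)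
  note h = assms[unfolded ab]
  show "Cmp Delta (far dec (a, a')) (incl1 m m') = Cmp Delta (incl1 n n') a"
    unfolding ab far_dec[OF h] incl_dmap
    using dmap_homD(1)[OF h(1)] by (subst (1 2) Cmp_dmap) (auto simp: dmap_eq_iff)
  show "Cmp Delta (far dec (a, a')) (incl2 m m') = Cmp Delta (incl2 n n') a'"
    unfolding ab far_dec[OF h] incl_dmap
    using dmap_homD(1)[OF h(2)] by (subst (1 2) Cmp_dmap) (auto simp: dmap_eq_iff)
qed

text \<open>The composite of \<open>dec_pb\<close> and \<open>diag_pb\<close> is the edgewise
  subdivision, and this is its projection to the first copy of \<open>[n]\<close>. Unlike
  \<open>u_op\<close> it lives on simplicial objects, so naturality moves it past
  \<open>e\<close>.\<close>

definition front :: "('o, 'm) cat \<Rightarrow> ('o, 'm) simp_nt" where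
  "front C = NT (comp_ftr (Simp C) (diag_pb C) (dec_pb C)) (id_ftr (Simp C))
     (\<lambda>X\<in>Obj (Simp C). NT (fob (comp_ftr (Simp C) (diag_pb C) (dec_pb C)) X) X (\<lambda>n. far X (incl1 n n)))"

text \<open>The map \<open>[n] \<rightarrow> [n] \<star> [n]\<close> interpolating between the two inclusions.\<close>

definition mix :: "nat \<Rightarrow> delta_arr \<Rightarrow> delta_arr" where
  "mix n a = dmap n (n + n + 1) (\<lambda>i. if snd (snd a) i = 0 then i else n + 1 + i)"

lemma snd_snd_dmap [simp]: "i \<le> m \<Longrightarrow> snd (snd (dmap m n f)) i = f i"
  by (simp add: dmap_def)

text \<open>Monotone because \<open>a\<close> is: once a point lies in the second copy, so do all
  later ones.\<close>

lemma mix_hom: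
  assumes "a \<in> hom Delta n 1"
  shows "mix n a \<in> hom Delta n (n + n + 1)"
proof -
  from assms obtain f where a: "a = dmap n 1 f" by (metis dmap_cases)
  show ?thesis
    unfolding mix_def
  proof (rule dmap_hom)
    fix i j assume "i \<le> j" "j \<le> n"
    then show "(if snd (snd a) i = 0 then i else n + 1 + i) \<le> (if snd (snd a) j = 0 then j else n + 1 + j)"
      using dmap_homD(2)[OF assms[unfolded a], of i j] by (auto simp: a)
  qed auto
qed

lemma mix_vertex: "mix n (vertex 0 n) = incl1 n n" "mix n (vertex 1 n) = incl2 n n"
  by (auto simp: mix_def vertex_def incl_dmap dmap_eq_iff)

text \<open>Both sides send \<open>i\<close> to the image of \<open>i\<close> under
  \<open>g\<close>, in the copy selected by the value of \<open>a\<close> there. This is the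
  simplicial compatibility of the homotopy.\<close>

lemma Cmp_mix:
  assumes "g \<in> hom Delta m n" "a \<in> hom Delta n 1"
  shows "Cmp Delta (mix n a) g = Cmp Delta (far dec (g, g)) (mix m (Cmp Delta a g))"
proof -
  from assms obtain b f where e: "g = dmap m n b" "a = dmap n 1 f" by (metis dmap_cases)
  note h = assms[unfolded e]
  have b: "b i \<le> n" if "i \<le> m" for i using dmap_homD(1)[OF h(1) that] .
  have ag: "Cmp Delta a g = dmap m 1 (\<lambda>i. f (b i))"
    unfolding e by (rule Cmp_dmap) (rule b)
  have "Cmp Delta (mix n a) g = dmap m (n + n + 1) (\<lambda>i. if f (b i) = 0 then b i else n + 1 + b i)"
    unfolding e mix_def using b by (subst Cmp_dmap) (auto simp: dmap_eq_iff)
  moreover have "Cmp Delta (far dec (g, g)) (mix m (Cmp Delta a g)) =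
      dmap m (n + n + 1) (\<lambda>i. if f (b i) = 0 then b i else n + 1 + b i)"
    unfolding ag unfolding e far_dec[OF h(1) h(1)] mix_def
    by (subst Cmp_dmap) (auto simp: dmap_eq_iff)
  ultimately show ?thesis by simp
qed

section \<open>The transformations \<open>u_op\<close> and \<open>front\<close>\<close>

context category
begin

lemma u_op_hom: "u_op C \<in> hom (fun_cat (Bisimp C) (Bisimp C)) (comp_ftr (Bisimp C) (dec_pb C) (diag_pb C)) (id_ftr (Bisimp C))"
proof -
  let ?G = "comp_ftr (Bisimp C) (dec_pb C) (diag_pb C)"
  let ?u = "\<lambda>Y. NT (fob ?G Y) Y (\<lambda>(n, m). far Y (incl1 n m, incl2 n m))"
  interpret B: category "Bisimp C" by (intro category_Bisimp category_axioms)
  have G: "is_functor (Bisimp C) (Bisimp C) ?G"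
    using is_functor_comp[OF B.category_axioms is_functor_diag_pb is_functor_dec_pb] category_axioms by blast
  have dY: "is_functor Deltaop C (comp_ftr Deltaop Y (diag Deltaop))" if "is_functor Deltaop2 C Y" for Y
    by (rule is_functor_comp[OF category_Deltaop is_functor_diag[OF category_Deltaop] that])
  have fobG: "fob ?G Y = comp_ftr Deltaop2 (comp_ftr Deltaop Y (diag Deltaop)) dec"
    if "is_functor Deltaop2 C Y" for Y using that dY[OF that] by simp
  have u: "?u Y \<in> hom (Bisimp C) (fob ?G Y) Y"
    if Y: "is_functor Deltaop2 C Y" for Y
  proof (rule bisimp_homI[OF _ Y])
    show "is_functor Deltaop2 C (fob ?G Y)" using is_functor_Obj[OF G] Y by simp
    show "(case (n, m) of (n, m) \<Rightarrow> far Y (incl1 n m, incl2 n m)) \<in> hom C (fob (fob ?G Y) (n, m)) (fob Y (n, m))" for n m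
      using bisimp_ob_hom[OF Y incl_hom] by (simp add: fobG[OF Y])
    show "Cmp C (case (m, m') of (n, m) \<Rightarrow> far Y (incl1 n m, incl2 n m)) (far (fob ?G Y) (a, a')) =
        Cmp C (far Y (a, a')) (case (n, n') of (n, m) \<Rightarrow> far Y (incl1 n m, incl2 n m))"
      if a: "a \<in> hom Delta m n" "a' \<in> hom Delta m' n'" for a a' m m' n n'
      using bisimp_ob_Cmp[OF Y incl_hom(1) far_dec_hom[OF a] incl_hom(2) far_dec_hom[OF a]]
        bisimp_ob_Cmp[OF Y a(1) incl_hom(1) a(2) incl_hom(2), of n' n] dec_incl[OF a] a far_dec_hom[OF a]
      by (simp add: fobG[OF Y] hom_iff)
  qed
  have "NT ?G (id_ftr (Bisimp C)) (\<lambda>Y\<in>Obj (Bisimp C). ?u Y)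
      \<in> hom (fun_cat (Bisimp C) (Bisimp C)) ?G (id_ftr (Bisimp C))"
  proof (rule nat_transI[OF G is_functor_id[OF B.category_axioms]])
    fix f Y Y' assume f: "f \<in> hom (Bisimp C) Y Y'"
    note Y = nat_functors[OF f]
    have "Cmp (Bisimp C) (?u Y') (far ?G f) =
        Cmp (Bisimp C) f (?u Y)"
    proof (rule nt_eqI[OF B.Cmp_hom[OF is_functor_hom[OF G f] u[OF Y(2)]] B.Cmp_hom[OF u[OF Y(1)] f]])
      fix nm :: "nat \<times> nat"
      have "f \<in> Arr (Bisimp C)" using f by (simp add: hom_iff)
      moreover have "whisker_right Deltaop f (diag Deltaop) \<in> Arr (Simp C)"
        using whisker_right_hom[OF category_Deltaop is_functor_diag[OF category_Deltaop] f] by (simp add: hom_iff)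
      ultimately show "component (Cmp (Bisimp C) (?u Y') (far ?G f)) nm =
          component (Cmp (Bisimp C) f (?u Y)) nm"
        using bisimp_naturality[OF f incl_hom(1) incl_hom(2), of "fst nm" "snd nm" "snd nm" "fst nm"]
        by (cases nm) simp
    qed
    then show "Cmp (Bisimp C) ((\<lambda>Y\<in>Obj (Bisimp C). ?u Y) Y') (far ?G f) =
        Cmp (Bisimp C) (far (id_ftr (Bisimp C)) f)
          ((\<lambda>Y\<in>Obj (Bisimp C). ?u Y) Y)"
      using Y f by (simp add: hom_iff)
  qed (use u in auto)
  then show ?thesis by (simp add: u_op_def)
qed

lemma component_u_op:
  "is_functor Deltaop2 C Y \<Longrightarrow> component (component (u_op C) Y) (n, m) = far Y (incl1 n m, incl2 n m)"
  by (simp add: u_op_def)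

lemma is_functor_subdivision: "is_functor (Simp C) (Simp C) (comp_ftr (Simp C) (diag_pb C) (dec_pb C))"
  using is_functor_comp[OF category_Simp is_functor_dec_pb is_functor_diag_pb] category_axioms by blast

lemma subdivision_simps:
  assumes "is_functor Deltaop C X"
  shows "fob (fob (comp_ftr (Simp C) (diag_pb C) (dec_pb C)) X) n = fob X (n + n + 1)"
    and "a \<in> Arr Delta \<Longrightarrow> far (fob (comp_ftr (Simp C) (diag_pb C) (dec_pb C)) X) a = far X (far dec (a, a))"
  using assms is_functor_comp[OF category_Deltaop2 is_functor_dec assms] by simp_all

lemma component_subdivision:
  assumes "f \<in> hom (Simp C) X Y"
  shows "component (far (comp_ftr (Simp C) (diag_pb C) (dec_pb C)) f) n = component f (n + n + 1)"
proof -
  have "f \<in> Arr (Simp C)" using assms by (simp add: hom_iff)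
  moreover have "whisker_right Deltaop2 f dec \<in> Arr (Bisimp C)"
    using whisker_right_hom[OF category_Deltaop2 is_functor_dec assms] by (simp add: hom_iff)
  ultimately show ?thesis by simp
qed

lemma front_hom:
  "front C \<in> hom (fun_cat (Simp C) (Simp C)) (comp_ftr (Simp C) (diag_pb C) (dec_pb C)) (id_ftr (Simp C))"
proof -
  let ?G = "comp_ftr (Simp C) (diag_pb C) (dec_pb C)"
  let ?v = "\<lambda>X. NT (fob ?G X) X (\<lambda>n. far X (incl1 n n))"
  interpret S: category "Simp C" by (intro category_Simp category_axioms)
  note G = is_functor_subdivision
  have v: "?v X \<in> hom (Simp C) (fob ?G X) X"
    if X: "is_functor Deltaop C X" for X
  proof (rule simp_homI[OF _ X])
    show "is_functor Deltaop C (fob ?G X)" using is_functor_Obj[OF G] X by simp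
    show "far X (incl1 n n) \<in> hom C (fob (fob ?G X) n) (fob X n)" for n
      using simp_ob_hom[OF X incl_hom(1)] by (simp add: subdivision_simps[OF X])
    show "Cmp C (far X (incl1 m m)) (far (fob ?G X) a) = Cmp C (far X a) (far X (incl1 n n))"
      if a: "a \<in> hom Delta m n" for a m n
      using simp_ob_Cmp[OF X incl_hom(1) far_dec_hom[OF a a]] simp_ob_Cmp[OF X a incl_hom(1)] dec_incl[OF a a] a
      by (simp add: subdivision_simps[OF X] hom_iff)
  qed
  have "NT ?G (id_ftr (Simp C)) (\<lambda>X\<in>Obj (Simp C). ?v X)
      \<in> hom (fun_cat (Simp C) (Simp C)) ?G (id_ftr (Simp C))"
  proof (rule nat_transI[OF G is_functor_id[OF S.category_axioms]])
    fix f X Y assume f: "f \<in> hom (Simp C) X Y"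
    note X = nat_functors[OF f]
    have "Cmp (Simp C) (?v Y) (far ?G f) =
        Cmp (Simp C) f (?v X)"
      by (rule nt_eqI[OF S.Cmp_hom[OF is_functor_hom[OF G f] v[OF X(2)]] S.Cmp_hom[OF v[OF X(1)] f]])
        (simp add: component_subdivision[OF f] simp_naturality[OF f incl_hom(1)] del: comp_ftr_simps)
    then show "Cmp (Simp C) ((\<lambda>X\<in>Obj (Simp C). ?v X) Y) (far ?G f) =
        Cmp (Simp C) (far (id_ftr (Simp C)) f) ((\<lambda>X\<in>Obj (Simp C). ?v X) X)"
      using X f by (simp add: hom_iff)
  qed (use v in auto)
  then show ?thesis by (simp add: front_def)
qed

lemma component_front: "is_functor Deltaop C X \<Longrightarrow> component (component (front C) X) n = far X (incl1 n n)"
  by (simp add: front_def)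

text \<open>Trades \<open>u_op\<close>, which takes a bisimplicial argument, for
  \<open>front\<close>, which commutes with \<open>e\<close> by \<open>front_e\<close> and is split
  by the fold map.\<close>

lemma u_op_zeq_front:
  assumes W: "W1 C W"
  shows "zeq (fun_cat (Bisimp C) (Simp C)) (objectwise (Bisimp C) (Simp C) W)
    (comp_ftr (Bisimp C) (comp_ftr (Simp C) (diag_pb C) (dec_pb C)) (diag_pb C)) (diag_pb C)
    [Fwd (whisker_left (Bisimp C) (diag_pb C) (u_op C))] [Fwd (whisker_right (Bisimp C) (front C) (diag_pb C))]"
proof -
  let ?S = "comp_ftr (Simp C) (diag_pb C) (dec_pb C)"
  let ?F = "comp_ftr (Bisimp C) ?S (diag_pb C)"
  have B: "category (Bisimp C)" and S: "category (Simp C)"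
    by (intro category_Bisimp category_Simp category_axioms)+
  have d: "is_functor (Bisimp C) (Simp C) (diag_pb C)" by (intro is_functor_diag_pb category_axioms)
  have dY: "is_functor Deltaop C (comp_ftr Deltaop Y (diag Deltaop))" if "is_functor Deltaop2 C Y" for Y
    by (rule is_functor_comp[OF category_Deltaop is_functor_diag[OF category_Deltaop] that])
  have u: "whisker_left (Bisimp C) (diag_pb C) (u_op C) \<in> hom (fun_cat (Bisimp C) (Simp C)) ?F (diag_pb C)"
    using whisker_left_hom[OF B d u_op_hom] by (simp add: comp_ftr_assoc[OF d] comp_id_right[OF B d])
  have v: "whisker_right (Bisimp C) (front C) (diag_pb C) \<in> hom (fun_cat (Bisimp C) (Simp C)) ?F (diag_pb C)"
    using whisker_right_hom[OF B d front_hom] by (simp add: comp_id_left[OF B S d])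
  \<comment> \<open>Only the second simplicial direction is deformed, from the first copy to the
    second one.\<close>
  define h where "h Y n a = far Y (incl1 n n, mix n a)"
    for Y :: "('o, 'm) bisimp_ob" and n and a
  have Farr: "far (fob ?F Y) g = far Y (far dec (g, g), far dec (g, g))" and Fob: "fob (fob ?F Y) n = fob Y (n + n + 1, n + n + 1)"
    if "is_functor Deltaop2 C Y" "g \<in> hom Delta m n" for Y g m n
    using that dY[OF that(1)] subdivision_simps[OF dY[OF that(1)]] far_dec_hom[OF that(2) that(2)]
    by (simp_all add: hom_iff)
  have Fcomp: "component (far ?F f) n = component f (n + n + 1, n + n + 1)" if f: "f \<in> hom (Bisimp C) Y Y'" for f Y Y' n
  proof -
    have 1: "f \<in> Arr (Bisimp C)" using f by (simp add: hom_iff)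
    moreover have 2: "whisker_right Deltaop f (diag Deltaop) \<in> hom (Simp C) (comp_ftr Deltaop Y (diag Deltaop)) (comp_ftr Deltaop Y' (diag Deltaop))"
      using whisker_right_hom[OF category_Deltaop is_functor_diag[OF category_Deltaop] f] .
    ultimately show ?thesis using component_subdivision[OF 2]
      by (simp del: comp_ftr_simps add: comp_ftr_simps(2)[of f "Bisimp C"])
  qed
  show ?thesis
  \<comment> \<open>The homotopy runs from \<open>front\<close> at the vertex 0 to
    \<open>u_op\<close> at the vertex 1, hence the reversal.\<close>
  proof (rule zeq_sym, rule homotopic_zeq[OF B W v u, of h])
    fix Y assume "Y \<in> Obj (Bisimp C)"
    then have Y: "is_functor Deltaop2 C Y" by simp
    note i = category.Idt_hom[OF category_Delta, of "_ :: nat", simplified]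
    show "homotopy C (fob ?F Y) (fob (diag_pb C) Y) (h Y)"
      unfolding homotopy_def
    proof (intro conjI allI ballI)
      fix n a assume a: "a \<in> hom Delta n 1"
      show "h Y n a \<in> hom C (fob (fob ?F Y) n) (fob (fob (diag_pb C) Y) n)"
        using bisimp_ob_hom[OF Y incl_hom(1) mix_hom[OF a]] Y unfolding h_def Fob[OF Y i] by simp
      fix m g assume g: "g \<in> hom Delta m n"
      have ag: "Cmp Delta a g \<in> hom Delta m 1" using category.Cmp_hom[OF category_Delta g a] .
      have "g \<in> Arr Delta" using g by (simp add: hom_iff)
      then show "Cmp C (far (fob (diag_pb C) Y) g) (h Y n a) = Cmp C (h Y m (Cmp Delta a g)) (far (fob ?F Y) g)"
        using bisimp_ob_Cmp[OF Y g incl_hom(1) g mix_hom[OF a]]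
          bisimp_ob_Cmp[OF Y incl_hom(1) far_dec_hom[OF g g] mix_hom[OF ag] far_dec_hom[OF g g]]
          Cmp_mix[OF g a] dec_incl(1)[OF g g] Y
        unfolding h_def Farr[OF Y g] by simp
    qed
    show "component (component (whisker_right (Bisimp C) (front C) (diag_pb C)) Y) n = h Y n (vertex 0 n)" for n
      using Y dY[OF Y] incl_hom(1)[of n n] by (simp add: component_front h_def mix_vertex hom_iff)
    have uY: "component (u_op C) Y \<in> hom (Bisimp C) (fob (comp_ftr (Bisimp C) (dec_pb C) (diag_pb C)) Y) Y"
      using nat_component[OF u_op_hom, of Y] Y by simp
    then show "component (component (whisker_left (Bisimp C) (diag_pb C) (u_op C)) Y) n = h Y n (vertex 1 n)" for n
      using Y by (simp add: component_u_op h_def mix_vertex hom_iff)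
  next
    fix f Y Y' n a assume f: "f \<in> hom (Bisimp C) Y Y'" and a: "a \<in> hom Delta n 1"
    have "f \<in> Arr (Bisimp C)" using f by (simp add: hom_iff)
    then show "Cmp C (component (far (diag_pb C) f) n) (h Y n a) = Cmp C (h Y' n a) (component (far ?F f) n)"
      using bisimp_naturality[OF f incl_hom(1) mix_hom[OF a]] unfolding Fcomp[OF f] h_def by simp
  qed
qed

end

section \<open>Weak equivalences obtained from homotopies\<close>

lemma weakly_saturatedD:
  assumes "weakly_saturated D W"
  shows "X \<in> Obj D \<Longrightarrow> Idt D X \<in> W"
    and "f \<in> hom D X Y \<Longrightarrow> g \<in> hom D Y Z \<Longrightarrow> f \<in> W \<Longrightarrow> g \<in> W \<Longrightarrow> Cmp D g f \<in> W"
    and "f \<in> hom D X Y \<Longrightarrow> g \<in> hom D Y Z \<Longrightarrow> f \<in> W \<Longrightarrow> Cmp D g f \<in> W \<Longrightarrow> g \<in> W"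
    and "f \<in> hom D X Y \<Longrightarrow> g \<in> hom D Y Z \<Longrightarrow> g \<in> W \<Longrightarrow> Cmp D g f \<in> W \<Longrightarrow> f \<in> W"
    and "i \<in> hom D X Y \<Longrightarrow> r \<in> hom D Y X \<Longrightarrow> Cmp D r i = Idt D X \<Longrightarrow> Cmp D i r \<in> W \<Longrightarrow> r \<in> W"
  using assms unfolding weakly_saturated_def by blast+

section \<open>Extra degeneracies of the decalage\<close>

definition fst_ftr :: "(nat \<times> nat, delta_arr \<times> delta_arr, nat, delta_arr) ftr" where
  "fst_ftr = Ftr fst (\<lambda>f\<in>Arr Deltaop2. fst f)"

lemma fst_ftr_simps [simp]: "fob fst_ftr (n, m) = n" "a \<in> Arr Delta \<Longrightarrow> b \<in> Arr Delta \<Longrightarrow> far fst_ftr (a, b) = a"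
  by (auto simp: fst_ftr_def)

lemma is_functor_fst: "is_functor Deltaop2 Deltaop fst_ftr"
proof (rule is_functorI)
  show "far fst_ftr (Cmp Deltaop2 g f) = Cmp Deltaop (far fst_ftr g) (far fst_ftr f)"
    if "f \<in> hom Deltaop2 X Y" "g \<in> hom Deltaop2 Y Z" for f g X Y Z
    using that category.Cmp_hom[OF category_Deltaop2 that]
    by (cases f; cases g) (auto simp: fst_ftr_def hom_iff)
next
  show "far fst_ftr (Idt Deltaop2 X) = Idt Deltaop (fob fst_ftr X)" if "X \<in> Obj Deltaop2" for X
    using category.Idt_hom[OF category_Deltaop2 that] by (cases X) (auto simp: fst_ftr_def hom_iff)
qed (auto simp: fst_ftr_def hom_iff extensional_def)

lemma is_functor_slice1: "is_functor Deltaop Deltaop2 (slice1 n)"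
proof -
  interpret category Delta by (rule category_Delta)
  show ?thesis
  proof (rule is_functorI)
    fix f g X Y Z assume "f \<in> hom Deltaop X Y" "g \<in> hom Deltaop Y Z"
    then show "far (slice1 n) (Cmp Deltaop g f) = Cmp Deltaop2 (far (slice1 n) g) (far (slice1 n) f)"
      using Cmp_hom[of g Z Y f X] Cmp_Idt_left[OF Idt_hom, of n] by (simp add: slice1_def hom_iff)
  next
    show "far (slice1 n) (Idt Deltaop X) = Idt Deltaop2 (fob (slice1 n) X)" for X
      using Idt_hom[of X] by (simp add: slice1_def hom_iff)
  next
    show "far (slice1 n) f \<in> hom Deltaop2 (fob (slice1 n) X) (fob (slice1 n) Y)" if "f \<in> hom Deltaop X Y" for f X Y
      using Idt_hom[of n] that by (simp add: slice1_def hom_iff)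
  qed (auto simp: slice1_def)
qed

lemma slice1_simps [simp]: "fob (slice1 n) m = (n, m)" "a \<in> Arr Delta \<Longrightarrow> far (slice1 n) a = (Idt Delta n, a)"
  by (auto simp: slice1_def)

lemma Idt_Delta_Arr [simp]: "Idt Delta n \<in> Arr Delta"
  using category.Idt_hom[OF category_Delta, of n] by (simp add: hom_iff)

text \<open>A retraction of \<open>incl1 n m\<close>; pulled back, it is an iterated extra
  degeneracy. \<open>squash n 0\<close> is the last degeneracy, which returns in the treatment of
  the unit.\<close>

definition squash :: "nat \<Rightarrow> nat \<Rightarrow> delta_arr" where
  "squash n m = dmap (n + m + 1) n (\<lambda>i. min i n)"

lemma squash_hom: "squash n m \<in> hom Delta (n + m + 1) n"
  by (auto simp: squash_def intro: dmap_hom)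

lemma squash_incl1: "Cmp Delta (squash n m) (incl1 n m) = Idt Delta n"
  unfolding squash_def incl_dmap Idt_Delta by (subst Cmp_dmap) (auto simp: dmap_eq_iff)

text \<open>The contraction of \<open>[n] \<star> [m]\<close> onto \<open>[n]\<close>, moving the points of \<open>[m]\<close> to the last point of \<open>[n]\<close>.\<close>

definition contract :: "nat \<Rightarrow> nat \<Rightarrow> delta_arr \<Rightarrow> delta_arr" where
  "contract n m a = dmap (n + m + 1) (n + m + 1)
    (\<lambda>i. if i \<le> n then i else if snd (snd a) (i - (n + 1)) = 0 then n else i)"

lemma contract_hom:
  assumes "a \<in> hom Delta m 1"
  shows "contract n m a \<in> hom Delta (n + m + 1) (n + m + 1)"
proof -
  from assms obtain f where a: "a = dmap m 1 f" by (metis dmap_cases)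
  show ?thesis
    unfolding contract_def
  proof (rule dmap_hom)
    fix i j assume "i \<le> j" "j \<le> n + m + 1"
    moreover from this have "i - (n + 1) \<le> j - (n + 1)" "j - (n + 1) \<le> m" by linarith+
    ultimately show "(if i \<le> n then i else if snd (snd a) (i - (n + 1)) = 0 then n else i) \<le>
        (if j \<le> n then j else if snd (snd a) (j - (n + 1)) = 0 then n else j)"
      using dmap_homD(2)[OF assms[unfolded a], of "i - (n + 1)" "j - (n + 1)"] by (auto simp: a)
  qed auto
qed

lemma contract_vertex:
  "contract n m (vertex 0 m) = Cmp Delta (incl1 n m) (squash n m)"
  "contract n m (vertex 1 m) = Idt Delta (n + m + 1)"
proof -
  show "contract n m (vertex 0 m) = Cmp Delta (incl1 n m) (squash n m)"
    unfolding contract_def squash_def incl_dmap vertex_def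
    by (subst Cmp_dmap) (auto simp: dmap_eq_iff)
qed (auto simp: contract_def vertex_def Idt_Delta dmap_eq_iff)

text \<open>The contraction keeps the first block fixed, so it is compatible with maps of the second
  block. Accordingly the homotopy runs in the second simplicial direction, with \<open>n\<close> as
  a parameter.\<close>

lemma Cmp_contract:
  assumes "g \<in> hom Delta m m'" "a \<in> hom Delta m' 1"
  shows "Cmp Delta (contract n m' a) (far dec (Idt Delta n, g)) =
    Cmp Delta (far dec (Idt Delta n, g)) (contract n m (Cmp Delta a g))"
proof -
  from assms obtain b f where e: "g = dmap m m' b" "a = dmap m' 1 f" by (metis dmap_cases)
  note h = assms[unfolded e]
  have b: "b i \<le> m'" if "i \<le> m" for i using dmap_homD(1)[OF h(1) that] .
  have i: "dmap n n (\<lambda>i. i) \<in> hom Delta n n" by (auto intro: dmap_hom)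
  have ag: "Cmp Delta a g = dmap m 1 (\<lambda>i. f (b i))"
    unfolding e by (rule Cmp_dmap) (rule b)
  let ?k = "\<lambda>i. if i \<le> n then i else if f (b (i - (n + 1))) = 0 then n else n + 1 + b (i - (n + 1))"
  have "Cmp Delta (contract n m' a) (far dec (Idt Delta n, g)) = dmap (n + m + 1) (n + m' + 1) ?k"
    unfolding e contract_def Idt_Delta far_dec[OF i h(1)]
  proof (subst Cmp_dmap)
    fix j assume "j \<le> n + m + 1"
    then show "(if j \<le> n then j else n + 1 + b (j - (n + 1))) \<le> n + m' + 1" using b[of "j - (n + 1)"] by auto
  next
    show "dmap (n + m + 1) (n + m' + 1)
       (\<lambda>i. if (if i \<le> n then i else n + 1 + b (i - (n + 1))) \<le> n
             then if i \<le> n then i else n + 1 + b (i - (n + 1))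
             else if snd (snd (dmap m' 1 f)) ((if i \<le> n then i else n + 1 + b (i - (n + 1))) - (n + 1)) = 0 then n
                  else if i \<le> n then i else n + 1 + b (i - (n + 1))) = dmap (n + m + 1) (n + m' + 1) ?k"
      unfolding dmap_eq_iff using b by auto
  qed
  moreover have "Cmp Delta (far dec (Idt Delta n, g)) (contract n m (Cmp Delta a g)) = dmap (n + m + 1) (n + m' + 1) ?k"
    unfolding ag unfolding e contract_def Idt_Delta far_dec[OF i h(1)]
    by (subst Cmp_dmap) (auto simp: dmap_eq_iff)
  ultimately show ?thesis by simp
qed

text \<open>\<open>front\<close> is the diagonal of a bisimplicial morphism that restricts
  \<open>X\<close> from \<open>[n]\<close> concatenated with \<open>[m]\<close> to
  \<open>[n]\<close>. For fixed \<open>n\<close> it is a deformation retraction in \<open>m\<close>,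
  and (W2) passes to the diagonal.\<close>

lemma (in category) front_weq:
  assumes W: "W1 C W" "W2 C W" "weakly_saturated (Simp C) W" and X: "is_functor Deltaop C X"
  shows "component (front C) X \<in> W"
proof -
  interpret S: category "Simp C" by (intro category_Simp category_axioms)
  note wsat = weakly_saturatedD[OF W(3)]
  define Y where "Y = comp_ftr Deltaop2 X dec"
  \<comment> \<open>Constant in the second direction; its diagonal is \<open>X\<close>
    again.\<close>
  define Y' where "Y' = comp_ftr Deltaop2 X fst_ftr"
  have Y: "is_functor Deltaop2 C Y" and Y': "is_functor Deltaop2 C Y'"
    unfolding Y_def Y'_def
    by (rule is_functor_comp[OF category_Deltaop2 is_functor_dec X],
        rule is_functor_comp[OF category_Deltaop2 is_functor_fst X])
  have Ys [simp]: "fob Y (n, m) = fob X (n + m + 1)" "fob Y' (n, m) = fob X n"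
    "a \<in> Arr Delta \<Longrightarrow> b \<in> Arr Delta \<Longrightarrow> far Y (a, b) = far X (far dec (a, b))"
    "a \<in> Arr Delta \<Longrightarrow> b \<in> Arr Delta \<Longrightarrow> far Y' (a, b) = far X a" for n m a b
    by (simp_all add: Y_def Y'_def)
  define t where "t = NT Y Y' (\<lambda>(n, m). far X (incl1 n m))"
  have t: "t \<in> hom (Bisimp C) Y Y'"
    unfolding t_def
  proof (rule bisimp_homI[OF Y Y'])
    show "(case (n, m) of (n, m) \<Rightarrow> far X (incl1 n m)) \<in> hom C (fob Y (n, m)) (fob Y' (n, m))" for n m
      using simp_ob_hom[OF X incl_hom(1)] by simp
    show "Cmp C (case (m, m') of (n, m) \<Rightarrow> far X (incl1 n m)) (far Y (a, a')) =
        Cmp C (far Y' (a, a')) (case (n, n') of (n, m) \<Rightarrow> far X (incl1 n m))"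
      if a: "a \<in> hom Delta m n" "a' \<in> hom Delta m' n'" for a a' m m' n n'
      using simp_ob_Cmp[OF X incl_hom(1) far_dec_hom[OF a]] simp_ob_Cmp[OF X a(1) incl_hom(1), of n']
        dec_incl(1)[OF a] a
      by (simp add: hom_iff)
  qed
  have tarr: "is_nat_trans Deltaop2 C t" using t by (simp add: hom_fun_cat_iff)
  have "far (pull_back Deltaop Deltaop2 C (slice1 n)) t \<in> W" for n
  proof -
    define A where "A = comp_ftr Deltaop Y (slice1 n)"
    define A' where "A' = comp_ftr Deltaop Y' (slice1 n)"
    define r where "r = whisker_right Deltaop t (slice1 n)"
    have r: "r \<in> hom (Simp C) A A'"
      unfolding r_def A_def A'_def by (rule whisker_right_hom[OF category_Deltaop is_functor_slice1 t])
    note A = nat_functors[OF r]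
    have As [simp]: "fob A m = fob X (n + m + 1)" "fob A' m = fob X n"
      "a \<in> Arr Delta \<Longrightarrow> far A a = far X (far dec (Idt Delta n, a))"
      "a \<in> Arr Delta \<Longrightarrow> far A' a = Idt C (fob X n)" for m a
      using simp_ob_Idt[OF X] by (simp_all add: A_def A'_def)
    have r_comp: "component r m = far X (incl1 n m)" for m by (simp add: r_def t_def)
    \<comment> \<open>In the second direction the target is constant, so naturality of the section
      \<open>s\<close> amounts to this invariance of \<open>squash\<close>.\<close>
    have sdec: "Cmp Delta (squash n m') (far dec (Idt Delta n, a)) = squash n m" if a: "a \<in> hom Delta m m'" for a m m'
    proof -
      from a obtain b where e: "a = dmap m m' b" by (metis dmap_cases)
      have i: "dmap n n (\<lambda>i. i) \<in> hom Delta n n" by (auto intro: dmap_hom)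
      show ?thesis
        unfolding e squash_def Idt_Delta far_dec[OF i a[unfolded e]]
      proof (subst Cmp_dmap)
        fix j assume "j \<le> n + m + 1"
        then show "(if j \<le> n then j else n + 1 + b (j - (n + 1))) \<le> n + m' + 1"
          using dmap_homD(1)[OF a[unfolded e], of "j - (n + 1)"] by auto
      qed (auto simp: dmap_eq_iff)
    qed
    define s where "s = NT A' A (\<lambda>m. far X (squash n m))"
    have s: "s \<in> hom (Simp C) A' A"
      unfolding s_def
    proof (rule simp_homI[OF A(2,1)])
      show "far X (squash n m) \<in> hom C (fob A' m) (fob A m)" for m
        using simp_ob_hom[OF X squash_hom] by simp
      show "Cmp C (far X (squash n m)) (far A' a) = Cmp C (far A a) (far X (squash n m'))"
        if a: "a \<in> hom Delta m m'" for a m m'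
        using simp_ob_Cmp[OF X far_dec_hom[OF category.Idt_hom[OF category_Delta] a] squash_hom, of n]
          sdec[OF a] Cmp_Idt_right[OF simp_ob_hom[OF X squash_hom, of n m]] a
        by (simp add: hom_iff)
    qed
    have rs: "Cmp (Simp C) r s = Idt (Simp C) A'"
      by (rule nt_eqI[OF S.Cmp_hom[OF s r] S.Idt_hom])
        (use A simp_ob_Cmp[OF X incl_hom(1) squash_hom] squash_incl1 simp_ob_Idt[OF X] in
          \<open>simp_all add: r_comp s_def\<close>)
    define h where "h m a = far X (contract n m a)" for m a
    \<comment> \<open>\<open>contract\<close> deforms the idempotent "\<open>incl1\<close> after
      \<open>squash\<close>" at the vertex 0 into the identity at the vertex 1.\<close>
    have "Cmp (Simp C) s r \<in> W \<longleftrightarrow> Idt (Simp C) A \<in> W"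
    proof (rule homotopic_weq_iff[OF W(1,3) S.Cmp_hom[OF r s] S.Idt_hom])
      show "homotopy C A A h"
        unfolding homotopy_def
      proof (intro conjI allI ballI)
        fix m' a assume a: "a \<in> hom Delta m' 1"
        show "h m' a \<in> hom C (fob A m') (fob A m')"
          using simp_ob_hom[OF X contract_hom[OF a]] by (simp add: h_def)
        fix m g assume g: "g \<in> hom Delta m m'"
        have ag: "Cmp Delta a g \<in> hom Delta m 1" using category.Cmp_hom[OF category_Delta g a] .
        have ig: "far dec (Idt Delta n, g) \<in> hom Delta (n + m + 1) (n + m' + 1)"
          using far_dec_hom[OF category.Idt_hom[OF category_Delta] g] by simp
        have "g \<in> Arr Delta" using g by (simp add: hom_iff)
        then show "Cmp C (far A g) (h m' a) = Cmp C (h m (Cmp Delta a g)) (far A g)"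
          using simp_ob_Cmp[OF X ig contract_hom[OF a]] simp_ob_Cmp[OF X contract_hom[OF ag] ig] Cmp_contract[OF g a]
          by (simp add: h_def)
      qed
      show "component (Cmp (Simp C) s r) m = h m (vertex 0 m)" for m
        using simp_ob_Cmp[OF X squash_hom incl_hom(1)] by (simp add: r_comp s_def h_def contract_vertex)
      show "component (Idt (Simp C) A) m = h m (vertex 1 m)" for m
        using simp_ob_Idt[OF X] by (simp add: h_def contract_vertex)
    qed (use A in simp)
    \<comment> \<open>The last clause of \<open>weakly_saturated\<close>: \<open>s\<close> is a
      section of \<open>r\<close>, and \<open>s\<close> after \<open>r\<close> lies in
      \<open>W\<close>.\<close>
    then have "r \<in> W" using wsat(1)[of A] wsat(5)[OF s r rs] A by simp
    then show ?thesis using tarr by (simp add: r_def)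
  qed
  then have "far (diag_pb C) t \<in> W" using W(2) t unfolding W2_def by (auto simp: hom_iff)
  moreover have "far (diag_pb C) t = component (front C) X"
  proof -
    have 1: "comp_ftr Deltaop Y' (diag Deltaop) = X"
      by (rule ftr_eqI[OF is_functor_comp[OF category_Deltaop is_functor_diag[OF category_Deltaop] Y'] X]) simp_all
    have 2: "comp_ftr Deltaop Y (diag Deltaop) = fob (comp_ftr (Simp C) (diag_pb C) (dec_pb C)) X"
      using X Y by (simp add: Y_def)
    have w: "whisker_right Deltaop t (diag Deltaop) \<in> hom (Simp C) (fob (comp_ftr (Simp C) (diag_pb C) (dec_pb C)) X) X"
      using whisker_right_hom[OF category_Deltaop is_functor_diag[OF category_Deltaop] t] unfolding 1 2 .
    have v: "component (front C) X \<in> hom (Simp C) (fob (comp_ftr (Simp C) (diag_pb C) (dec_pb C)) X) X"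
      using nat_component[OF front_hom, of X] X by simp
    have "whisker_right Deltaop t (diag Deltaop) = component (front C) X"
      by (rule nt_eqI[OF w v]) (simp add: component_front[OF X] t_def)
    then show ?thesis using tarr by simp
  qed
  ultimately show ?thesis by simp
qed

section \<open>The unit of the adjunction\<close>

text \<open>The cut condition sends the first block into the first and the second into the second,
  so the factors are the two restrictions, the second one shifted back. A bisimplicial morphism
  between decalages thereby becomes natural for every map that respects the cuts.\<close>

lemma dec_decompose:
  assumes f: "dmap M N f \<in> hom Delta M N" and MN: "M = k' + l' + 1" "N = k + l + 1"
    and split: "\<And>i. i \<le> M \<Longrightarrow> i \<le> k' \<longleftrightarrow> f i \<le> k"
  obtains a b where "a \<in> hom Delta k' k" "b \<in> hom Delta l' l" "far dec (a, b) = dmap M N f"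
proof -
  let ?g = "\<lambda>i. f (k' + 1 + i) - (k + 1)"
  have a: "dmap k' k f \<in> hom Delta k' k"
  proof (rule dmap_hom)
    show "f i \<le> k" if "i \<le> k'" for i using split[of i] that MN by simp
    show "f i \<le> f j" if "i \<le> j" "j \<le> k'" for i j using dmap_homD(2)[OF f that(1)] that MN by simp
  qed
  have b: "dmap l' l ?g \<in> hom Delta l' l"
  proof (rule dmap_hom)
    fix i assume "i \<le> l'"
    then show "?g i \<le> l" using dmap_homD(1)[OF f, of "k' + 1 + i"] MN by auto
  next
    fix i j assume "i \<le> j" "j \<le> l'"
    then show "?g i \<le> ?g j" using dmap_homD(2)[OF f, of "k' + 1 + i" "k' + 1 + j"] MN by (auto intro: diff_le_mono)
  qed
  have "far dec (dmap k' k f, dmap l' l ?g) = dmap M N f"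
    unfolding far_dec[OF a b] unfolding MN dmap_eq_iff
  proof (intro allI impI)
    fix i assume i: "i \<le> k' + l' + 1"
    show "(if i \<le> k' then f i else k + 1 + ?g (i - (k' + 1))) = f i"
      using split[of i] i MN by auto
  qed
  with a b show ?thesis by (rule that)
qed

lemma incl1_0: "incl1 N 0 = dmap N (N + 1) (\<lambda>i. i)"
  by (simp add: incl_dmap)

lemma squash_0: "squash N 0 = dmap (N + 1) N (\<lambda>i. min i N)"
  by (simp add: squash_def)

text \<open>A morphism \<open>dec\<^sup>* A \<rightarrow> dec\<^sup>* X\<close> amounts to a morphism \<open>\<Delta>\<^sub>1 \<otimes> A \<rightarrow> X\<close>: below, \<open>cut N k\<close> is the component
  of the latter at the map \<open>[N] \<rightarrow> [1]\<close> sending exactly \<open>0, \<dots>, k\<close> to \<open>0\<close>.  For \<open>k < N\<close> this is a component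
  of the given morphism; the case \<open>k = N\<close> is reduced to it by adding a last point to \<open>[N]\<close>.\<close>

locale dec_morphism = category C for C :: "('o, 'm) cat" +
  fixes A X :: "('o, 'm) simp_ob" and \<phi> :: "('o, 'm) bisimp_ar"
  assumes A: "is_functor Deltaop C A" and X: "is_functor Deltaop C X"
    and \<phi>: "\<phi> \<in> hom (Bisimp C) (fob (dec_pb C) A) (fob (dec_pb C) X)"
begin

definition cut :: "nat \<Rightarrow> nat \<Rightarrow> 'm" where
  "cut N k = Cmp C (far X (incl1 N 0)) (Cmp C (component \<phi> (k, N - k)) (far A (squash N 0)))"

lemma \<phi>_hom: "N = k + l + 1 \<Longrightarrow> component \<phi> (k, l) \<in> hom C (fob A N) (fob X N)"
  using bisimp_component[OF \<phi>, of k l] A X by simp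

lemma \<phi>_natural:
  assumes f: "dmap M N f \<in> hom Delta M N" and MN: "M = k' + l' + 1" "N = k + l + 1"
    and split: "\<And>i. i \<le> M \<Longrightarrow> i \<le> k' \<longleftrightarrow> f i \<le> k"
  shows "Cmp C (component \<phi> (k', l')) (far A (dmap M N f)) = Cmp C (far X (dmap M N f)) (component \<phi> (k, l))"
proof -
  obtain a b where ab: "a \<in> hom Delta k' k" "b \<in> hom Delta l' l" and e: "far dec (a, b) = dmap M N f"
    using dec_decompose[OF f MN split] by blast
  show ?thesis
    using bisimp_naturality[OF \<phi> ab] ab A X unfolding e[symmetric] by (simp add: hom_iff)
qed

text \<open>Both maps factor through \<open>\<upsilon>\<close>, which has the two competing last
  points side by side. The faces \<open>\<delta> 0\<close> and \<open>\<delta> 1\<close> each select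
  one of them and become equal once the last point is removed by \<open>incl1 M 0\<close>.\<close>

lemma \<phi>_last_point:
  assumes f: "dmap (M + 1) N f \<in> hom Delta (M + 1) N" and g: "dmap (M + 1) N g \<in> hom Delta (M + 1) N"
    and eq: "\<And>i. i \<le> M \<Longrightarrow> f i = g i" and k: "k \<le> M" and le: "f (M + 1) \<le> g (M + 1)"
  shows "Cmp C (far X (incl1 M 0)) (Cmp C (component \<phi> (k, M - k)) (far A (dmap (M + 1) N f))) =
    Cmp C (far X (incl1 M 0)) (Cmp C (component \<phi> (k, M - k)) (far A (dmap (M + 1) N g)))"
proof -
  define \<upsilon> where "\<upsilon> = dmap (M + 2) N (\<lambda>i. if i \<le> M + 1 then f i else g (M + 1))"
  define \<delta> where "\<delta> c = dmap (M + 1) (M + 2) (\<lambda>i. if i \<le> M then i else M + 1 + c)" for c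
  have \<upsilon>: "\<upsilon> \<in> hom Delta (M + 2) N"
    unfolding \<upsilon>_def
  proof (rule dmap_hom)
    fix i j assume ij: "i \<le> j" "j \<le> M + 2"
    have "f i \<le> g (M + 1)" if "i \<le> M + 1"
      using dmap_homD(2)[OF f that] le by simp
    then show "(if i \<le> M + 1 then f i else g (M + 1)) \<le> (if j \<le> M + 1 then f j else g (M + 1))"
      using dmap_homD(2)[OF f ij(1)] ij by auto
  qed (use dmap_homD(1)[OF f] dmap_homD(1)[OF g] in auto)
  have \<delta>: "\<delta> c \<in> hom Delta (M + 1) (M + 2)" if "c \<le> 1" for c
    unfolding \<delta>_def using that by (intro dmap_hom) auto
  have \<upsilon>\<delta>: "Cmp Delta \<upsilon> (\<delta> 0) = dmap (M + 1) N f" "Cmp Delta \<upsilon> (\<delta> 1) = dmap (M + 1) N g"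
  proof -
    show "Cmp Delta \<upsilon> (\<delta> 0) = dmap (M + 1) N f"
      unfolding \<upsilon>_def \<delta>_def by (subst Cmp_dmap) (auto simp: dmap_eq_iff intro!: arg_cong[of _ _ f])
    show "Cmp Delta \<upsilon> (\<delta> 1) = dmap (M + 1) N g"
      unfolding \<upsilon>_def \<delta>_def using eq by (subst Cmp_dmap) (auto simp: dmap_eq_iff intro!: arg_cong[of _ _ g])
  qed
  have i: "incl1 M 0 \<in> hom Delta M (M + 1)" using incl_hom(1)[of M 0] by simp
  have \<delta>i: "Cmp Delta (\<delta> c) (incl1 M 0) = dmap M (M + 2) (\<lambda>i. i)" for c
    unfolding \<delta>_def incl1_0 by (subst Cmp_dmap) (auto simp: dmap_eq_iff)
  have "Cmp C (far X (incl1 M 0)) (Cmp C (component \<phi> (k, M - k)) (far A (Cmp Delta \<upsilon> (\<delta> c)))) =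
      Cmp C (far X (dmap M (M + 2) (\<lambda>i. i))) (Cmp C (component \<phi> (k, M + 1 - k)) (far A \<upsilon>))" if c: "c \<le> 1" for c
  proof -
    note d = \<delta>[OF c]
    have p: "component \<phi> (k, M - k) \<in> hom C (fob A (M + 1)) (fob X (M + 1))"
      "component \<phi> (k, M + 1 - k) \<in> hom C (fob A (M + 2)) (fob X (M + 2))"
      using k by (auto intro!: \<phi>_hom)
    \<comment> \<open>Naturality applies since \<open>\<delta> c\<close> fixes the points up to
      \<open>M\<close> and sends the last one beyond them, so it preserves a cut after
      \<open>k \<le> M\<close>.\<close>
    have n: "Cmp C (component \<phi> (k, M - k)) (far A (\<delta> c)) = Cmp C (far X (\<delta> c)) (component \<phi> (k, M + 1 - k))"
      unfolding \<delta>_def using d[unfolded \<delta>_def] k by (intro \<phi>_natural) auto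
    show ?thesis
      using simp_ob_Cmp[OF A d \<upsilon>] Cmp_assoc[OF simp_ob_hom[OF A \<upsilon>] simp_ob_hom[OF A d] p(1)]
        n Cmp_assoc[OF simp_ob_hom[OF A \<upsilon>] p(2) simp_ob_hom[OF X d]]
        Cmp_assoc[OF Cmp_hom[OF simp_ob_hom[OF A \<upsilon>] p(2)] simp_ob_hom[OF X d] simp_ob_hom[OF X i]]
        simp_ob_Cmp[OF X i d] \<delta>i[of c]
      by simp
  qed
  from this[of 0] this[of 1] show ?thesis unfolding \<upsilon>\<delta> by simp
qed

lemma \<phi>_last_point':
  assumes f: "dmap (M + 1) N f \<in> hom Delta (M + 1) N" and g: "dmap (M + 1) N g \<in> hom Delta (M + 1) N"
    and eq: "\<And>i. i \<le> M \<Longrightarrow> f i = g i" and k: "k \<le> M"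
  shows "Cmp C (far X (incl1 M 0)) (Cmp C (component \<phi> (k, M - k)) (far A (dmap (M + 1) N f))) =
    Cmp C (far X (incl1 M 0)) (Cmp C (component \<phi> (k, M - k)) (far A (dmap (M + 1) N g)))"
  using \<phi>_last_point[OF f g eq k] \<phi>_last_point[OF g f eq[symmetric] k] by (cases "f (M + 1) \<le> g (M + 1)") auto

lemma incl_squash_hom: "incl1 N 0 \<in> hom Delta N (N + 1)" "squash N 0 \<in> hom Delta (N + 1) N"
  using incl_hom(1)[of N 0] squash_hom[of N 0] by simp_all

lemma cut_hom: "k \<le> N \<Longrightarrow> cut N k \<in> hom C (fob A N) (fob X N)"
  unfolding cut_def
  by (intro Cmp_hom[OF Cmp_hom[OF simp_ob_hom[OF A incl_squash_hom(2)] \<phi>_hom] simp_ob_hom[OF X incl_squash_hom(1)]])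
    simp

text \<open>\<open>F\<close> extends \<open>f\<close> by a new last point, and naturality of
  \<open>\<phi>\<close> applies to \<open>F\<close> even if a cut is at the very end. The
  degeneracies do not match strictly: \<open>squash N 0\<close> after \<open>F\<close> sends the new
  point to \<open>N\<close>, while \<open>f\<close> after \<open>squash M 0\<close> sends it to
  \<open>f M\<close>. The discrepancy is absorbed by \<open>\<phi>_last_point'\<close>.\<close>

lemma cut_natural:
  assumes f: "dmap M N f \<in> hom Delta M N" and k: "k' \<le> M" "k \<le> N"
    and split: "\<And>i. i \<le> M \<Longrightarrow> i \<le> k' \<longleftrightarrow> f i \<le> k"
  shows "Cmp C (far X (dmap M N f)) (cut N k) = Cmp C (cut M k') (far A (dmap M N f))"
proof -
  let ?f = "dmap M N f"
  define F where "F = dmap (M + 1) (N + 1) (\<lambda>i. if i \<le> M then f i else N + 1)"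
  have F: "F \<in> hom Delta (M + 1) (N + 1)"
    unfolding F_def
  proof (rule dmap_hom)
    fix i assume "i \<le> M + 1"
    then show "(if i \<le> M then f i else N + 1) \<le> N + 1" using dmap_homD(1)[OF f, of i] by auto
  next
    fix i j assume "i \<le> j" "j \<le> M + 1"
    then show "(if i \<le> M then f i else N + 1) \<le> (if j \<le> M then f j else N + 1)"
      using dmap_homD(2)[OF f, of i j] dmap_homD(1)[OF f, of i] by auto
  qed
  note iM = incl_squash_hom(1)[of M] and sM = incl_squash_hom(2)[of M]
    and iN = incl_squash_hom(1)[of N] and sN = incl_squash_hom(2)[of N]
  have Fi: "Cmp Delta F (incl1 M 0) = Cmp Delta (incl1 N 0) ?f"
    unfolding F_def incl1_0 using dmap_homD(1)[OF f] by (subst (1 2) Cmp_dmap) (auto simp: dmap_eq_iff)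
  have pM: "component \<phi> (k', M - k') \<in> hom C (fob A (M + 1)) (fob X (M + 1))"
    and pN: "component \<phi> (k, N - k) \<in> hom C (fob A (N + 1)) (fob X (N + 1))"
    using k by (auto intro!: \<phi>_hom)
  have n: "Cmp C (component \<phi> (k', M - k')) (far A F) = Cmp C (far X F) (component \<phi> (k, N - k))"
    unfolding F_def
  proof (rule \<phi>_natural[OF F[unfolded F_def]])
    show "i \<le> k' \<longleftrightarrow> (if i \<le> M then f i else N + 1) \<le> k" if "i \<le> M + 1" for i
      using split[of i] k that by auto
  qed (use k in auto)
  note Ah = simp_ob_hom[OF A] and Xh = simp_ob_hom[OF X]
  have 1: "Cmp C (far X ?f) (cut N k) =
      Cmp C (far X (Cmp Delta (incl1 N 0) ?f)) (Cmp C (component \<phi> (k, N - k)) (far A (squash N 0)))"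
    unfolding cut_def
    using Cmp_assoc[OF Cmp_hom[OF Ah[OF sN] pN] Xh[OF iN] Xh[OF f]] simp_ob_Cmp[OF X f iN] by simp
  also have "\<dots> = Cmp C (Cmp C (far X (incl1 M 0)) (far X F)) (Cmp C (component \<phi> (k, N - k)) (far A (squash N 0)))"
    using simp_ob_Cmp[OF X iM F] Fi by simp
  also have "\<dots> = Cmp C (far X (incl1 M 0)) (Cmp C (Cmp C (far X F) (component \<phi> (k, N - k))) (far A (squash N 0)))"
    using Cmp_assoc[OF Cmp_hom[OF Ah[OF sN] pN] Xh[OF F] Xh[OF iM]] Cmp_assoc[OF Ah[OF sN] pN Xh[OF F]] by simp
  also have "\<dots> = Cmp C (far X (incl1 M 0)) (Cmp C (component \<phi> (k', M - k')) (far A (Cmp Delta (squash N 0) F)))"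
    unfolding n[symmetric] using Cmp_assoc[OF Ah[OF sN] Ah[OF F] pM] simp_ob_Cmp[OF A F sN] by simp
  also have "\<dots> = Cmp C (far X (incl1 M 0)) (Cmp C (component \<phi> (k', M - k')) (far A (Cmp Delta ?f (squash M 0))))"
  proof -
    let ?b = "\<lambda>i. min (if i \<le> M then f i else N + 1) N" and ?c = "\<lambda>i. f (min i M)"
    have e: "Cmp Delta (squash N 0) F = dmap (M + 1) N ?b" "Cmp Delta ?f (squash M 0) = dmap (M + 1) N ?c"
      unfolding F_def squash_0 using dmap_homD(1)[OF F[unfolded F_def]]
      by (subst Cmp_dmap; auto simp: dmap_eq_iff)+
    have h: "Cmp Delta (squash N 0) F \<in> hom Delta (M + 1) N" "Cmp Delta ?f (squash M 0) \<in> hom Delta (M + 1) N"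
      using category.Cmp_hom[OF category_Delta] F sN sM f by blast+
    show ?thesis
      unfolding e by (rule \<phi>_last_point'[OF h[unfolded e] _ k(1)]) (use dmap_homD(1)[OF f] in auto)
  qed
  also have "\<dots> = Cmp C (cut M k') (far A ?f)"
    unfolding cut_def
    using simp_ob_Cmp[OF A sM f] Cmp_assoc[OF Ah[OF f] Ah[OF sM] pM]
      Cmp_assoc[OF Ah[OF f] Cmp_hom[OF Ah[OF sM] pM] Xh[OF iM]] by simp
  finally show ?thesis .
qed

text \<open>Here \<open>k < N\<close>, so the degeneracy \<open>squash N 0\<close> itself respects
  the cut; it moves through \<open>\<phi>\<close> and cancels against the face.\<close>

lemma cut_eq_\<phi>:
  assumes "N = k + l + 1"
  shows "cut N k = component \<phi> (k, l)"
proof -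
  note i = incl_squash_hom(1)[of N] and s = incl_squash_hom(2)[of N]
  note e = squash_0[of N]
  have "Cmp C (component \<phi> (k, N - k)) (far A (squash N 0)) = Cmp C (far X (squash N 0)) (component \<phi> (k, l))"
    unfolding e by (rule \<phi>_natural) (use s[unfolded e] assms in auto)
  then have "cut N k = Cmp C (far X (Idt Delta N)) (component \<phi> (k, l))"
    using Cmp_assoc[OF \<phi>_hom[OF assms] simp_ob_hom[OF X s] simp_ob_hom[OF X i]] simp_ob_Cmp[OF X i s]
      squash_incl1[of N 0] by (simp add: cut_def)
  then show ?thesis using Cmp_Idt_left[OF \<phi>_hom[OF assms]] simp_ob_Idt[OF X] by simp
qed

end

text \<open>The points in question form an initial segment because \<open>a\<close> is monotone. If
  cuts are viewed as maps to \<open>[1]\<close>, then \<open>k\<close> is the minimum of the cut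
  after \<open>n\<close> and \<open>a\<close>.\<close>

lemma split_point:
  assumes a: "a \<in> hom Delta N 1" and n: "n \<le> N"
  shows "\<exists>k\<le>N. \<forall>i\<le>N. i \<le> k \<longleftrightarrow> i \<le> n \<or> snd (snd a) i = 0"
proof -
  obtain f where e: "a = dmap N 1 f" using a by (metis dmap_cases)
  let ?S = "{i. i \<le> N \<and> (i \<le> n \<or> f i = 0)}"
  have fin: "finite ?S" by (rule finite_subset[of _ "{..N}"]) auto
  have mem: "Max ?S \<in> ?S" using n by (intro Max_in[OF fin]) auto
  have "i \<le> Max ?S \<longleftrightarrow> i \<le> n \<or> f i = 0" if "i \<le> N" for i
  proof
    assume i: "i \<le> Max ?S"
    have "f i \<le> f (Max ?S)" using dmap_homD(2)[OF a[unfolded e] i] mem by simp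
    then show "i \<le> n \<or> f i = 0" using mem i by auto
  next
    assume "i \<le> n \<or> f i = 0"
    then show "i \<le> Max ?S" using that by (intro Max_ge[OF fin]) auto
  qed
  then show ?thesis using mem by (intro exI[of _ "Max ?S"]) (auto simp: e)
qed

text \<open>The unit has the retraction \<open>r\<close>. A homotopy between \<open>\<eta>\<close>
  after \<open>r\<close> and the identity puts this composite into \<open>W\<close>; saturation then
  gives \<open>r\<close>, and 2-out-of-3 gives \<open>\<eta>\<close>.\<close>

lemma (in category) unit_weq:
  assumes W: "W1 C W" "weakly_saturated (Simp C) W" and adj: "adjunction (Simp C) (Bisimp C) (dec_pb C) R \<eta> \<epsilon>"
    and X: "is_functor Deltaop C X"
  shows "component \<eta> X \<in> W"
proof -
  interpret S: category "Simp C" by (intro category_Simp category_axioms)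
  interpret B: category "Bisimp C" by (intro category_Bisimp category_axioms)
  note wsat = weakly_saturatedD[OF W(2)]
  let ?L = "dec_pb C"
  have L: "is_functor (Simp C) (Bisimp C) ?L" and R: "is_functor (Bisimp C) (Simp C) R"
    and \<eta>: "\<eta> \<in> hom (fun_cat (Simp C) (Simp C)) (id_ftr (Simp C)) (comp_ftr (Simp C) R ?L)"
    and \<epsilon>: "\<epsilon> \<in> hom (fun_cat (Bisimp C) (Bisimp C)) (comp_ftr (Bisimp C) ?L R) (id_ftr (Bisimp C))"
    and tri1: "\<And>X. X \<in> Obj (Simp C) \<Longrightarrow> Cmp (Bisimp C) (component \<epsilon> (fob ?L X)) (far ?L (component \<eta> X)) = Idt (Bisimp C) (fob ?L X)"
    and tri2: "\<And>Y. Y \<in> Obj (Bisimp C) \<Longrightarrow> Cmp (Simp C) (far R (component \<epsilon> Y)) (component \<eta> (fob R Y)) = Idt (Simp C) (fob R Y)"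
    using adj unfolding adjunction_def by blast+
  have LX: "fob ?L X \<in> Obj (Bisimp C)" using is_functor_Obj[OF L, of X] X by simp
  define P where "P = fob R (fob ?L X)"
  have P: "is_functor Deltaop C P" using is_functor_Obj[OF R LX] by (simp add: P_def)
  have LP: "fob ?L P \<in> Obj (Bisimp C)" using is_functor_Obj[OF L, of P] P by simp
  have hX: "component \<eta> X \<in> hom (Simp C) X P"
    using nat_component[OF \<eta>, of X] X unfolding P_def by (simp del: pull_back_simps)
  define \<phi> where "\<phi> = component \<epsilon> (fob ?L X)"
  have \<phi>: "\<phi> \<in> hom (Bisimp C) (fob ?L P) (fob ?L X)"
    using nat_component[OF \<epsilon> LX] LX unfolding P_def \<phi>_def by (simp del: pull_back_simps)
  interpret dec_morphism C P X \<phi> by unfold_locales (fact P X \<phi>)+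
  \<comment> \<open>\<open>cut N N\<close> belongs to the constant map 0, so \<open>r\<close> is the
    restriction of the counit, seen as a morphism out of a cylinder, to the end 0.\<close>
  define r where "r = NT P X (\<lambda>N. cut N N)"
  have r: "r \<in> hom (Simp C) P X"
    unfolding r_def
  proof (rule simp_homI[OF P X])
    show "cut N N \<in> hom C (fob P N) (fob X N)" for N by (rule cut_hom) simp
    fix a M N assume a: "a \<in> hom Delta M N"
    then obtain f where e: "a = dmap M N f" by (metis dmap_cases)
    note h = a[unfolded e]
    show "Cmp C (cut M M) (far P a) = Cmp C (far X a) (cut N N)"
      unfolding e by (rule cut_natural[symmetric, OF h]) (use dmap_homD(1)[OF h] in auto)
  qed
  \<comment> \<open>The triangle identity in bidegree \<open>(N, 0)\<close>, that is in degree
    \<open>N + 1\<close>, enclosed between the degeneracy and the face that cancel each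
    other.\<close>
  have r\<eta>: "Cmp (Simp C) r (component \<eta> X) = Idt (Simp C) X"
  proof (rule nt_eqI[OF S.Cmp_hom[OF hX r] S.Idt_hom])
    fix N
    note i = incl_squash_hom(1)[of N] and s = incl_squash_hom(2)[of N]
    note hN = simp_component[OF hX, of N] and hN1 = simp_component[OF hX, of "N + 1"]
    have p: "component \<phi> (N, 0) \<in> hom C (fob P (N + 1)) (fob X (N + 1))" by (rule \<phi>_hom) simp
    have "component (Cmp (Bisimp C) \<phi> (far ?L (component \<eta> X))) (N, 0) = Idt C (fob X (N + 1))"
      using tri1[of X] X LX unfolding \<phi>_def[symmetric] by simp
    moreover have "is_nat_trans Deltaop C (component \<eta> X)" using hX by (simp add: hom_fun_cat_iff)
    ultimately have t: "Cmp C (component \<phi> (N, 0)) (component (component \<eta> X) (N + 1)) = Idt C (fob X (N + 1))"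
      by simp
    have "Cmp C (cut N N) (component (component \<eta> X) N) =
        Cmp C (far X (incl1 N 0)) (Cmp C (Cmp C (component \<phi> (N, 0)) (far P (squash N 0))) (component (component \<eta> X) N))"
      unfolding cut_def
      using Cmp_assoc[OF hN Cmp_hom[OF simp_ob_hom[OF P s] p] simp_ob_hom[OF X i]] by simp
    also have "\<dots> = Cmp C (far X (incl1 N 0)) (Cmp C (component \<phi> (N, 0)) (Cmp C (component (component \<eta> X) (N + 1)) (far X (squash N 0))))"
      using Cmp_assoc[OF hN simp_ob_hom[OF P s] p] simp_naturality[OF hX s] by simp
    also have "\<dots> = Cmp C (far X (incl1 N 0)) (far X (squash N 0))"
      using Cmp_assoc[OF simp_ob_hom[OF X s] hN1 p] t Cmp_Idt_left[OF simp_ob_hom[OF X s]] by simp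
    also have "\<dots> = Idt C (fob X N)"
      using simp_ob_Cmp[OF X i s] squash_incl1[of N 0] simp_ob_Idt[OF X] by simp
    finally show "component (Cmp (Simp C) r (component \<eta> X)) N = component (Idt (Simp C) X) N"
      by (simp add: r_def)
  qed (use X in simp)
  obtain T j p where T: "is_tensor C 1 P T j" and p: "p \<in> hom (Simp C) T P" "p \<in> W"
    and pj: "\<And>n a. a \<in> hom Delta n 1 \<Longrightarrow> Cmp C (component p n) (j n a) = Idt C (fob P n)"
    using W(1) P unfolding W1_def fun_cat_simps by blast
  note Tf = tensorD(2)[OF T]
  define k where "k n N a = (SOME k. k \<le> N \<and> (\<forall>i\<le>N. i \<le> k \<longleftrightarrow> i \<le> n \<or> snd (snd a) i = 0))" for n N and a :: delta_arr
  have k': "k n N a \<le> N \<and> (\<forall>i\<le>N. i \<le> k n N a \<longleftrightarrow> i \<le> n \<or> snd (snd a) i = 0)"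
    if "a \<in> hom Delta N 1" "n \<le> N" for n N a
    unfolding k_def by (rule someI_ex) (rule split_point[OF that])
  have k: "k n N a \<le> N" "\<And>i. i \<le> N \<Longrightarrow> i \<le> k n N a \<longleftrightarrow> i \<le> n \<or> snd (snd a) i = 0"
    if "a \<in> hom Delta N 1" "n \<le> N" for n N a
    using k'[OF that] by simp_all
  \<comment> \<open>On the summand \<open>a\<close> the cut after \<open>n\<close> is replaced by
    its minimum with \<open>a\<close>. The bidegree \<open>(n, m)\<close> enters only through
    \<open>n\<close> and \<open>N = n + m + 1\<close>.\<close>
  define H' where "H' n N = (SOME H. H \<in> hom C (fob T N) (fob X N) \<and>
      (\<forall>a\<in>hom Delta N 1. Cmp C H (j N a) = cut N (k n N a)))" for n N
  have "H' n N \<in> hom C (fob T N) (fob X N) \<and> (\<forall>a\<in>hom Delta N 1. Cmp C (H' n N) (j N a) = cut N (k n N a))"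
    if "n \<le> N" for n N
    unfolding H'_def
    by (rule someI_ex)
      (rule coproduct_lift[OF tensorD(3)[OF T] simp_ob_Obj[OF X] cut_hom[OF k(1)[OF _ that]]])
  then have H': "H' n N \<in> hom C (fob T N) (fob X N)"
    and H'j: "\<And>a. a \<in> hom Delta N 1 \<Longrightarrow> Cmp C (H' n N) (j N a) = cut N (k n N a)"
    if "n \<le> N" for n N
    using that by simp_all
  \<comment> \<open>The homotopy is built between decalages, where \<open>cut\<close> describes the
    morphisms, and is transposed along the adjunction afterwards.\<close>
  define K where "K = NT (fob ?L T) (fob ?L X) (\<lambda>(n, m). H' n (n + m + 1))"
  have LT: "fob ?L T \<in> Obj (Bisimp C)" using is_functor_Obj[OF L, of T] Tf by simp
  have K: "K \<in> hom (Bisimp C) (fob ?L T) (fob ?L X)"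
    unfolding K_def
  proof (rule bisimp_homI)
    show "(case (n, m) of (n, m) \<Rightarrow> H' n (n + m + 1)) \<in> hom C (fob (fob ?L T) (n, m)) (fob (fob ?L X) (n, m))" for n m
      using H'[of n "n + m + 1"] Tf X by simp
    fix a a' m m' n n' assume a: "a \<in> hom Delta m n" "a' \<in> hom Delta m' n'"
    define D M N where "D = far dec (a, a')" and "M = m + m' + 1" and "N = n + n' + 1"
    have mn: "m \<le> M" "n \<le> N" by (simp_all add: M_def N_def)
    have D: "D \<in> hom Delta M N" unfolding D_def M_def N_def by (rule far_dec_hom[OF a])
    obtain f g where fg: "a = dmap m n f" "a' = dmap m' n' g" using a by (metis dmap_cases)
    define F where "F i = (if i \<le> m then f i else n + 1 + g (i - (m + 1)))" for i
    have DF: "D = dmap M N F"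
      unfolding D_def fg far_dec[OF a[unfolded fg]] M_def N_def dmap_eq_iff by (simp add: F_def)
    have Fn: "F i \<le> n \<longleftrightarrow> i \<le> m" for i
      using dmap_homD(1)[OF a(1)[unfolded fg], of i] by (auto simp: F_def)
    note TD = simp_ob_hom[OF Tf D] and XD = simp_ob_hom[OF X D] and PD = simp_ob_hom[OF P D]
    have "Cmp C (H' m M) (far T D) = Cmp C (far X D) (H' n N)"
    proof (rule coproduct_eqI[OF tensorD(3)[OF T, of N] Cmp_hom[OF TD H'[OF mn(1)]] Cmp_hom[OF H'[OF mn(2)] XD]])
      fix b assume b: "b \<in> hom Delta N 1"
      have bD: "Cmp Delta b D \<in> hom Delta M 1" using category.Cmp_hom[OF category_Delta D b] .
      have val: "snd (snd (Cmp Delta b D)) i = snd (snd b) (F i)" if i: "i \<le> M" for i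
      proof -
        obtain c where c: "b = dmap N 1 c" using b by (metis dmap_cases)
        note F = dmap_homD(1)[OF D[unfolded DF]]
        show ?thesis unfolding c DF using i F[OF i] by (subst Cmp_dmap[OF F]) auto
      qed
      have "Cmp C (Cmp C (H' m M) (far T D)) (j N b) = Cmp C (cut M (k m M (Cmp Delta b D))) (far P D)"
        using Cmp_assoc[OF tensorD(4)[OF T b] TD H'[OF mn(1)]] tensorD(5)[OF T D b]
          Cmp_assoc[OF PD tensorD(4)[OF T bD] H'[OF mn(1)]] H'j[OF mn(1) bD] by simp
      also have "\<dots> = Cmp C (far X D) (cut N (k n N b))"
        unfolding DF
      proof (rule cut_natural[symmetric, OF D[unfolded DF]])
        show "k m M (Cmp Delta b (dmap M N F)) \<le> M" using k(1)[OF bD mn(1)] by (simp add: DF)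
        show "k n N b \<le> N" using k(1)[OF b mn(2)] .
        show "i \<le> k m M (Cmp Delta b (dmap M N F)) \<longleftrightarrow> F i \<le> k n N b" if i: "i \<le> M" for i
          using k(2)[OF bD mn(1) i] k(2)[OF b mn(2) dmap_homD(1)[OF D[unfolded DF] i]] val[OF i] Fn[of i]
          by (simp add: DF)
      qed
      also have "\<dots> = Cmp C (Cmp C (far X D) (H' n N)) (j N b)"
        using Cmp_assoc[OF tensorD(4)[OF T b] H'[OF mn(2)] XD] H'j[OF mn(2) b] by simp
      finally show "Cmp C (Cmp C (H' m M) (far T D)) (j N b) = Cmp C (Cmp C (far X D) (H' n N)) (j N b)" .
    qed
    then show "Cmp C (case (m, m') of (n, m) \<Rightarrow> H' n (n + m + 1)) (far (fob ?L T) (a, a')) =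
        Cmp C (far (fob ?L X) (a, a')) (case (n, n') of (n, m) \<Rightarrow> H' n (n + m + 1))"
      using a Tf X by (simp add: hom_iff D_def M_def N_def)
  qed (use LT LX in simp_all)
  have hT: "component \<eta> T \<in> hom (Simp C) T (fob R (fob ?L T))"
    using nat_component[OF \<eta>, of T] Tf by (simp del: pull_back_simps)
  have hP: "component \<eta> P \<in> hom (Simp C) P (fob R (fob ?L P))"
    using nat_component[OF \<eta>, of P] P by (simp del: pull_back_simps)
  have RK: "far R K \<in> hom (Simp C) (fob R (fob ?L T)) P"
    using is_functor_hom[OF R K] by (simp add: P_def)
  \<comment> \<open>Restricting the transpose of \<open>K\<close> to an end of the cylinder is
    transposing the restriction of \<open>K\<close>, by naturality of \<open>\<eta>\<close>.\<close>
  have ends: "Cmp (Simp C) (Cmp (Simp C) (far R K) (component \<eta> T)) i = Cmp (Simp C) (far R (Cmp (Bisimp C) K (far ?L i))) (component \<eta> P)"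
    if i: "i \<in> hom (Simp C) P T" for i
  proof -
    note Li = is_functor_hom[OF L i]
    note RLi = is_functor_hom[OF R Li]
    have "i \<in> Arr (Simp C)" using i by (simp add: hom_iff)
    then have "Cmp (Simp C) (component \<eta> T) i = Cmp (Simp C) (far R (far ?L i)) (component \<eta> P)"
      using naturality[OF \<eta> i] by (simp del: pull_back_simps)
    then show ?thesis
      using S.Cmp_assoc[OF i hT RK] S.Cmp_assoc[OF hP RLi RK] is_functor_Cmp[OF R Li K] by simp
  qed
  define i where "i c = NT P T (\<lambda>n. j n (vertex c n))" for c
  have i: "i c \<in> hom (Simp C) P T" if "c \<le> 1" for c
    using tensor_end[OF T that] by (simp add: i_def)
  have Li_comp: "component (far ?L (i c)) (n, m) = j (n + m + 1) (vertex c (n + m + 1))" if "c \<le> 1" for c n m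
    using i[OF that] by (simp add: hom_fun_cat_iff i_def)
  \<comment> \<open>The minimum with the constant 0 is the constant 0, i.e. the cut after
    \<open>N\<close>. The transpose of this end is \<open>\<eta>\<close> after
    \<open>r\<close>.\<close>
  have "Cmp (Bisimp C) K (far ?L (i 0)) = far ?L r"
  proof (rule nt_eqI[OF B.Cmp_hom[OF is_functor_hom[OF L i] K] is_functor_hom[OF L r]])
    fix nm :: "nat \<times> nat"
    obtain n m where nm: "nm = (n, m)" by (metis surj_pair)
    define N where "N = n + m + 1"
    have n: "n \<le> N" by (simp add: N_def)
    have "k n N (vertex 0 N) = N"
      using k(1)[OF vertex_hom n, of 0] k(2)[OF vertex_hom n, of 0 N] by (simp add: vertex_def)
    then show "component (Cmp (Bisimp C) K (far ?L (i 0))) nm = component (far ?L r) nm"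
      using H'j[OF n vertex_hom, of 0] r unfolding nm
      by (simp del: pull_back_simps add: Li_comp)
        (simp add: K_def N_def r_def hom_fun_cat_iff)
  qed simp
  \<comment> \<open>The minimum with the constant 1 leaves the cut after \<open>n\<close> unchanged,
    which gives the counit; its transpose is the identity.\<close>
  moreover have "Cmp (Bisimp C) K (far ?L (i 1)) = \<phi>"
  proof (rule nt_eqI[OF B.Cmp_hom[OF is_functor_hom[OF L i] K] \<phi>])
    fix nm :: "nat \<times> nat"
    obtain n m where nm: "nm = (n, m)" by (metis surj_pair)
    define N where "N = n + m + 1"
    have n: "n \<le> N" by (simp add: N_def)
    have "k n N (vertex 1 N) = n"
      using k(1)[OF vertex_hom n, of 1] k(2)[OF vertex_hom n, of 1 n] k(2)[OF vertex_hom n, of 1 "k n N (vertex 1 N)"] n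
      by (simp add: vertex_def)
    then show "component (Cmp (Bisimp C) K (far ?L (i 1))) nm = component \<phi> nm"
      using H'j[OF n vertex_hom, of 1] cut_eq_\<phi>[OF N_def] unfolding nm
      by (simp del: pull_back_simps add: Li_comp) (simp add: K_def N_def)
  qed simp
  moreover have "Cmp (Simp C) (far R (far ?L r)) (component \<eta> P) = Cmp (Simp C) (component \<eta> X) r"
  proof -
    have "r \<in> Arr (Simp C)" using r by (simp add: hom_iff)
    then show ?thesis using naturality[OF \<eta> r] by (simp del: pull_back_simps)
  qed
  moreover have "Cmp (Simp C) (far R \<phi>) (component \<eta> P) = Idt (Simp C) P"
    using tri2[OF LX] by (simp add: \<phi>_def P_def)
  moreover have "Idt (Simp C) P \<in> W" "Idt (Simp C) X \<in> W" using wsat(1) P X by simp_all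
  ultimately have "Cmp (Simp C) (component \<eta> X) r \<in> W"
    using tensor_ends_weq_iff[OF W(2) T p pj S.Cmp_hom[OF hT RK]] ends[OF i[of 0]] ends[OF i[of 1]]
    unfolding i_def by simp
  from wsat(5)[OF hX r r\<eta> this] show ?thesis
    using wsat(4)[OF hX r] r\<eta> \<open>Idt (Simp C) X \<in> W\<close> by simp
qed

section \<open>The Alexander--Whitney and Eilenberg--Zilber morphisms\<close>

lemma whisker_right_assoc:
  assumes "is_functor J K F"
  shows "whisker_right J (whisker_right K t G) F = whisker_right J t (comp_ftr J G F)"
  using assms is_functor_Obj[OF assms]
  by (auto simp: whisker_right_def comp_ftr_assoc fun_eq_iff restrict_def)

lemma whisker_left_Idt:
  assumes "category J" "category K" "category M" "is_functor K M H" "is_functor J K F"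
  shows "whisker_left J H (Idt (fun_cat J K) F) = Idt (fun_cat J M) (comp_ftr J H F)"
proof -
  interpret D: category "fun_cat J M" using assms by (simp add: category_fun_cat)
  interpret E: category "fun_cat J K" using assms by (simp add: category_fun_cat)
  have F: "F \<in> Obj (fun_cat J K)" using assms by simp
  show ?thesis
    by (rule nt_eqI[OF whisker_left_hom[OF assms(1,4) E.Idt_hom[OF F]] D.Idt_hom])
      (use assms in \<open>auto simp: is_functor_comp is_functor_Idt is_functor_Obj\<close>)
qed

lemma whisker_right_Idt:
  assumes "category J" "category K" "category M" "is_functor J K F" "is_functor K M H"
  shows "whisker_right J (Idt (fun_cat K M) H) F = Idt (fun_cat J M) (comp_ftr J H F)"
proof -
  interpret D: category "fun_cat J M" using assms by (simp add: category_fun_cat)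
  interpret E: category "fun_cat K M" using assms by (simp add: category_fun_cat)
  have H: "H \<in> Obj (fun_cat K M)" using assms by simp
  show ?thesis
    by (rule nt_eqI[OF whisker_right_hom[OF assms(1,4) E.Idt_hom[OF H]] D.Idt_hom])
      (use assms in \<open>auto simp: is_functor_comp is_functor_Obj\<close>)
qed

section \<open>Inverse arrows in functor categories\<close>

lemma inverse_arrowsD:
  assumes "inverse_arrows D f g" "f \<in> hom D X Y"
  shows "g \<in> hom D Y X" "Cmp D g f = Idt D X" "Cmp D f g = Idt D Y"
  using assms by (auto simp: inverse_arrows_def hom_iff)

lemma inverse_arrowsI:
  assumes "f \<in> hom D X Y" "g \<in> hom D Y X" "Cmp D g f = Idt D X" "Cmp D f g = Idt D Y"
  shows "inverse_arrows D f g"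
  using assms by (auto simp: inverse_arrows_def hom_iff)

lemma (in category) inv_arrow_eq:
  assumes "inverse_arrows C f g"
  shows "inv_arrow C f = g"
  unfolding inv_arrow_def
proof (rule the_equality)
  show "inverse_arrows C f g" by fact
  fix h assume h: "inverse_arrows C f h"
  have f: "f \<in> hom C (Dom C f) (Cod C f)" using assms by (simp add: inverse_arrows_def hom_iff)
  note g = inverse_arrowsD[OF assms f] and h = inverse_arrowsD[OF h f]
  show "h = g"
    using Cmp_assoc[OF g(1) f h(1)] g(3) h(2) Cmp_Idt_left[OF g(1)] Cmp_Idt_right[OF h(1)] by simp
qed

lemma whisker_left_inverse:
  assumes "category J" "category K" "category M" "is_functor K M H"
    and "t \<in> hom (fun_cat J K) F G" "inverse_arrows (fun_cat J K) t s"
  shows "inverse_arrows (fun_cat J M) (whisker_left J H t) (whisker_left J H s)"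
proof -
  note i = inverse_arrowsD[OF assms(6,5)] and F = nat_functors[OF assms(5)]
  show ?thesis
    by (rule inverse_arrowsI[OF whisker_left_hom[OF assms(1,4,5)] whisker_left_hom[OF assms(1,4) i(1)]])
      (simp_all add: whisker_left_Cmp[OF assms(1-5) i(1), symmetric] whisker_left_Cmp[OF assms(1-4) i(1) assms(5), symmetric]
        i(2,3) whisker_left_Idt[OF assms(1-4)] F)
qed

lemma whisker_right_inverse:
  assumes "category J" "category K" "category M" "is_functor J K F"
    and "t \<in> hom (fun_cat K M) H H'" "inverse_arrows (fun_cat K M) t s"
  shows "inverse_arrows (fun_cat J M) (whisker_right J t F) (whisker_right J s F)"
proof -
  note i = inverse_arrowsD[OF assms(6,5)] and H = nat_functors[OF assms(5)]
  show ?thesis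
    by (rule inverse_arrowsI[OF whisker_right_hom[OF assms(1,4,5)] whisker_right_hom[OF assms(1,4) i(1)]])
      (simp_all add: whisker_right_Cmp[OF assms(1-5) i(1), symmetric] whisker_right_Cmp[OF assms(1-4) i(1) assms(5), symmetric]
        i(2,3) whisker_right_Idt[OF assms(1-4)] H)
qed

lemma objectwise_inverse:
  assumes "category J" "category K" "t \<in> hom (fun_cat J K) F G"
    and "\<And>X. X \<in> Obj J \<Longrightarrow> iso_arrow K (component t X)"
  shows "\<exists>s. inverse_arrows (fun_cat J K) t s"
proof -
  interpret J: category J by fact
  interpret K: category K by fact
  interpret D: category "fun_cat J K" using assms by (simp add: category_fun_cat)
  note F = nat_functors(1)[OF assms(3)] and G = nat_functors(2)[OF assms(3)]
  obtain i where "\<And>X. X \<in> Obj J \<Longrightarrow> inverse_arrows K (component t X) (i X)"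
    using assms(4) unfolding iso_arrow_def by metis
  note i = inverse_arrowsD[OF this nat_component[OF assms(3)]]
  define s where "s = NT G F (\<lambda>X\<in>Obj J. i X)"
  have s: "s \<in> hom (fun_cat J K) G F"
    unfolding s_def
  proof (rule nat_transI[OF G F])
    fix f X Y assume f: "f \<in> hom J X Y"
    note X = J.hom_Obj(1)[OF f] and Y = J.hom_Obj(2)[OF f]
    note Ff = is_functor_hom[OF F f] and Gf = is_functor_hom[OF G f]
      and tX = nat_component[OF assms(3) X] and tY = nat_component[OF assms(3) Y]
      and iX = i(1)[OF X X] and iY = i(1)[OF Y Y]
    have "Cmp K (i Y) (far G f) = Cmp K (i Y) (Cmp K (Cmp K (far G f) (component t X)) (i X))"
      using K.Cmp_assoc[OF iX tX Gf] i(3)[OF X X] K.Cmp_Idt_right[OF Gf] by simp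
    also have "\<dots> = Cmp K (i Y) (Cmp K (component t Y) (Cmp K (far F f) (i X)))"
      using naturality[OF assms(3) f] K.Cmp_assoc[OF iX Ff tY] by simp
    also have "\<dots> = Cmp K (far F f) (i X)"
      using K.Cmp_assoc[OF K.Cmp_hom[OF iX Ff] tY iY] i(2)[OF Y Y] K.Cmp_Idt_left[OF K.Cmp_hom[OF iX Ff]] by simp
    finally show "Cmp K ((\<lambda>X\<in>Obj J. i X) Y) (far G f) = Cmp K (far F f) ((\<lambda>X\<in>Obj J. i X) X)"
      using X Y by simp
  qed (use i(1) in auto)
  have "Cmp (fun_cat J K) s t = Idt (fun_cat J K) F"
    by (rule nt_eqI[OF D.Cmp_hom[OF assms(3) s] D.Idt_hom]) (use F in \<open>auto simp: s_def i(2)\<close>)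
  moreover have "Cmp (fun_cat J K) t s = Idt (fun_cat J K) G"
    by (rule nt_eqI[OF D.Cmp_hom[OF s assms(3)] D.Idt_hom]) (use G in \<open>auto simp: s_def i(3)\<close>)
  ultimately show ?thesis using inverse_arrowsI[OF assms(3) s] by blast
qed

text \<open>The diagram chase, with functors replaced by atomic objects. \<open>d\<close> stands for
  \<open>diag_pb C\<close> and \<open>r\<close> for \<open>R\<close>; the prefixes \<open>z\<close>,
  \<open>s\<close>, \<open>sz\<close> mean that \<open>ZZ\<close>, \<open>SD\<close> or
  \<open>SD\<close> after \<open>ZZ\<close> (introduced below) is applied, and \<open>lr_r\<close>,
  \<open>lz_r\<close> are \<open>RL\<close> and \<open>RL\<close> after \<open>ZZ\<close>, applied
  to \<open>R\<close>. The zigzags \<open>lr'\<close>, \<open>ld'\<close>, \<open>ed'\<close>,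
  \<open>le'\<close> may be formal or actual inverses.\<close>

lemma (in category) zigzag_inverse_calculus:
  assumes aw: "aw \<in> hom C d r" and er: "er \<in> hom C r zr" and cr: "cr \<in> hom C zr szr"
    and lr: "zinv C W sr szr [Fwd lr] lr'" and de: "de \<in> hom C sr d"
    and ed: "zinv C W d zd [Fwd ed] ed'" and cd: "cd \<in> hom C zd szd" and ld: "zinv C W sd szd [Fwd ld] ld'"
    and zaw: "zaw \<in> hom C zd zr" and szaw: "szaw \<in> hom C szd szr" and saw: "saw \<in> hom C sd sr"
    and v: "v \<in> hom C sd d" and vz: "vz \<in> hom C szd zd"
    and tr: "tr \<in> hom C sr lr_r" and tzr: "tzr \<in> hom C szr lz_r" and le: "zinv C W lr_r lz_r [Fwd le] le'"
    and hr: "hr \<in> hom C r lr_r" and hzr: "hzr \<in> hom C zr lz_r" and re: "re \<in> hom C lr_r r"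
    and e1: "Cmp C er aw = Cmp C zaw ed" and e2: "Cmp C cr zaw = Cmp C szaw cd"
    and e3: "Cmp C lr saw = Cmp C szaw ld" and e4: "zeq C W sd d [Fwd (Cmp C de saw)] [Fwd v]"
    and e6: "Cmp C ed v = Cmp C vz ld" and e7: "Cmp C vz cd = Idt C zd"
    and e8: "Cmp C aw de = Cmp C re tr" and e9: "Cmp C tzr lr = Cmp C le tr"
    and e10: "Cmp C tzr cr = hzr" and e11: "Cmp C hzr er = Cmp C le hr" and e12: "Cmp C re hr = Idt C r"
  shows "zinv C W d r [Fwd aw] ([Fwd er, Fwd cr] @ lr' @ [Fwd de])"
proof -
  have F: "zigzag C W X [Fwd f] Y" if "f \<in> hom C X Y" for f X Y
    using that hom_Obj[OF that] by (simp add: hom_iff)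
  have H: "f \<in> hom C X Y" if "zinv C W X Y [Fwd f] f'" for f f' X Y
    using that by (auto simp: zinv_def hom_iff)
  have B: "zigzag C W Y f' X" "zeq C W X X (f @ f') []" "zeq C W Y Y (f' @ f) []" if "zinv C W X Y f f'" for f f' X Y
    using that by (auto simp: zinv_def)
  note lr_h = H[OF lr] and ed_h = H[OF ed] and ld_h = H[OF ld] and le_h = H[OF le]
  have Id: "zeq C W X X [Fwd f, Fwd g] []" if "f \<in> hom C X Y" "g \<in> hom C Y X" "Cmp C g f = Idt C X" for f g X Y
    using zeq_trans[OF zeq_Cmp[OF that(1,2), unfolded that(3)] zeq_Idt] hom_Obj[OF that(1)] by blast
  note A = zigzag_append
  note q1 = zeq_square[OF aw er ed_h zaw e1, of W] and q2 = zeq_square[OF zaw cr cd szaw e2, of W]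
  have q3: "zeq C W szd sr ([Fwd szaw] @ lr') (ld' @ [Fwd saw])"
    using zeq_flip[OF _ ld lr F[OF szaw] F[OF saw]] zeq_square[OF ld_h szaw saw lr_h e3[symmetric], of W]
    by (auto intro: zeq_sym)
  note q4 = zeq_trans[OF zeq_Cmp[OF saw de] e4]
  have q6: "zeq C W szd d (ld' @ [Fwd v]) ([Fwd vz] @ ed')"
    using zeq_flip[OF _ ld ed F[OF vz] F[OF v]] zeq_square[OF ld_h vz v ed_h e6[symmetric], of W] by auto
  note q7 = Id[OF cd vz e7]
  \<comment> \<open>\<open>aw\<close> moves to the right past \<open>er\<close>, \<open>cr\<close>
    and the inverse \<open>lr'\<close> until it meets the counit and becomes \<open>v\<close>. Then
    \<open>v\<close> moves left past \<open>ld'\<close>, becoming \<open>vz\<close>, and cancels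
    \<open>cd\<close> by \<open>e7\<close>; what remains is \<open>ed\<close> with its
    inverse.\<close>
  have "zeq C W d d ([Fwd aw, Fwd er] @ [Fwd cr] @ lr' @ [Fwd de]) ([Fwd ed, Fwd zaw] @ [Fwd cr] @ lr' @ [Fwd de])"
    by (rule zeq_append[OF q1 zeq_refl[OF A[OF F[OF cr] A[OF B(1)[OF lr] F[OF de]]]]])
  also have "zeq C W d d ([Fwd ed, Fwd zaw] @ [Fwd cr] @ lr' @ [Fwd de]) ([Fwd ed] @ [Fwd cd, Fwd szaw] @ lr' @ [Fwd de])"
    using zeq_context[OF q2 F[OF ed_h] A[OF B(1)[OF lr] F[OF de]]] by simp
  also have "zeq C W d d ([Fwd ed] @ [Fwd cd, Fwd szaw] @ lr' @ [Fwd de]) ([Fwd ed, Fwd cd] @ ld' @ [Fwd saw, Fwd de])"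
    using zeq_context[OF q3 A[OF F[OF ed_h] F[OF cd]] F[OF de]] by simp
  also have "zeq C W d d ([Fwd ed, Fwd cd] @ ld' @ [Fwd saw, Fwd de]) ([Fwd ed, Fwd cd] @ ld' @ [Fwd v])"
    using zeq_append[OF zeq_refl[OF A[OF A[OF F[OF ed_h] F[OF cd]] B(1)[OF ld]]] q4] by simp
  also have "zeq C W d d ([Fwd ed, Fwd cd] @ ld' @ [Fwd v]) ([Fwd ed, Fwd cd] @ [Fwd vz] @ ed')"
    using zeq_append[OF zeq_refl[OF A[OF F[OF ed_h] F[OF cd]]] q6] by simp
  also have "zeq C W d d ([Fwd ed, Fwd cd] @ [Fwd vz] @ ed') ([Fwd ed] @ ed')"
    using zeq_context[OF q7 F[OF ed_h] B(1)[OF ed]] by simp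
  also note B(2)[OF ed]
  finally have 1: "zeq C W d d ([Fwd aw] @ [Fwd er, Fwd cr] @ lr' @ [Fwd de]) []" by simp
  note q8 = zeq_square[OF de aw tr re e8, of W]
  have q9: "zeq C W szr lr_r (lr' @ [Fwd tr]) ([Fwd tzr] @ le')"
    using zeq_flip[OF _ lr le F[OF tzr] F[OF tr]] zeq_square[OF lr_h tzr tr le_h e9, of W] by auto
  note q10 = zeq_Cmp[OF cr tzr, unfolded e10, of W]
  note q11 = zeq_square[OF er hzr hr le_h e11, of W]
  note q12 = Id[OF hr re e12]
  \<comment> \<open>Naturality (\<open>e8\<close>) puts \<open>tr\<close> behind the inverse
    \<open>lr'\<close>; moved to the left of it, it turns the fold step into a unit
    (\<open>e10\<close>). After \<open>le\<close> has cancelled, the triangle identity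
    \<open>e12\<close> remains.\<close>
  have "zeq C W r r (([Fwd er] @ [Fwd cr] @ lr') @ [Fwd de, Fwd aw]) (([Fwd er] @ [Fwd cr] @ lr') @ [Fwd tr, Fwd re])"
    by (rule zeq_append[OF zeq_refl[OF A[OF F[OF er] A[OF F[OF cr] B(1)[OF lr]]]] q8])
  also have "zeq C W r r (([Fwd er] @ [Fwd cr] @ lr') @ [Fwd tr, Fwd re]) ([Fwd er] @ [Fwd cr, Fwd tzr] @ le' @ [Fwd re])"
    using zeq_context[OF q9 A[OF F[OF er] F[OF cr]] F[OF re]] by simp
  also have "zeq C W r r ([Fwd er] @ [Fwd cr, Fwd tzr] @ le' @ [Fwd re]) ([Fwd er, Fwd hzr] @ le' @ [Fwd re])"
    using zeq_context[OF q10 F[OF er] A[OF B(1)[OF le] F[OF re]]] by simp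
  also have "zeq C W r r ([Fwd er, Fwd hzr] @ le' @ [Fwd re]) ([Fwd hr, Fwd le] @ le' @ [Fwd re])"
    by (rule zeq_append[OF q11 zeq_refl[OF A[OF B(1)[OF le] F[OF re]]]])
  also have "zeq C W r r ([Fwd hr, Fwd le] @ le' @ [Fwd re]) ([Fwd hr, Fwd re])"
    using zeq_context[OF B(2)[OF le] F[OF hr] F[OF re]] by simp
  also note q12
  finally have 2: "zeq C W r r (([Fwd er, Fwd cr] @ lr' @ [Fwd de]) @ [Fwd aw]) []" by simp
  show ?thesis
    unfolding zinv_def using 1 2 hom_Obj(1)[OF er] F[OF aw] A[OF F[OF er] A[OF F[OF cr] A[OF B(1)[OF lr] F[OF de]]]] by simp
qed

lemma component_c_op: "is_functor FinSetop C Z \<Longrightarrow> S \<in> Obj FinSet \<Longrightarrow> component (component (c_op C) Z) S = far Z (fold_map S)"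
  by (simp add: c_op_def)

section \<open>The transformations entering the calculation and the identities between them\<close>

locale symmetric_adjunction = category C for C :: "('o, 'm) cat" +
  fixes CC :: "('o, 'm) sym_ftr" and e :: "('o, 'm) simp_nt"
    and R :: "('o, 'm) tot_ftr" and \<eta> :: "('o, 'm) simp_nt" and \<epsilon> :: "('o, 'm) bisimp_nt"
  assumes sym: "symmetric_data C CC e"
    and adj: "adjunction (Simp C) (Bisimp C) (dec_pb C) R \<eta> \<epsilon>"
begin

abbreviation "SS \<equiv> Simp C"
abbreviation "BB \<equiv> Bisimp C"
abbreviation "dd \<equiv> diag_pb C"
abbreviation "LL \<equiv> dec_pb C"
abbreviation "ZZ \<equiv> comp_ftr SS (iota_pb C) CC"
abbreviation "SD \<equiv> comp_ftr SS dd LL"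
abbreviation "RL \<equiv> comp_ftr SS R LL"
abbreviation "AW \<equiv> Aw_nt C R \<eta>"

lemma SS: "category SS" and BB: "category BB"
  by (intro category_Simp category_Bisimp category_axioms)+

lemma dd: "is_functor BB SS dd" and LL: "is_functor SS BB LL" and CC: "is_functor SS (Fin C) CC"
  and R: "is_functor BB SS R" and e: "e \<in> hom (fun_cat SS SS) (id_ftr SS) ZZ"
  and \<eta>: "\<eta> \<in> hom (fun_cat SS SS) (id_ftr SS) RL"
  and \<epsilon>: "\<epsilon> \<in> hom (fun_cat BB BB) (comp_ftr BB LL R) (id_ftr BB)"
  and triangle1: "X \<in> Obj SS \<Longrightarrow> Cmp BB (component \<epsilon> (fob LL X)) (far LL (component \<eta> X)) = Idt BB (fob LL X)"
  and triangle2: "Y \<in> Obj BB \<Longrightarrow> Cmp SS (far R (component \<epsilon> Y)) (component \<eta> (fob R Y)) = Idt SS (fob R Y)"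
  using sym adj category_axioms is_functor_diag_pb is_functor_dec_pb
  unfolding symmetric_data_def adjunction_def by blast+

lemma ZZ: "is_functor SS SS ZZ" and SD: "is_functor SS SS SD" and RL: "is_functor SS SS RL"
  by (rule is_functor_comp[OF SS CC is_functor_iota_pb] is_functor_comp[OF SS LL dd] is_functor_comp[OF SS LL R])+

lemma AW_hom: "AW \<in> hom (fun_cat BB SS) dd R"
proof -
  interpret D: category "fun_cat BB SS" by (intro category_fun_cat SS BB)
  show ?thesis
    unfolding Aw_nt_def
    using D.Cmp_hom[OF whisker_right_hom[OF BB dd \<eta>, unfolded comp_id_left[OF BB SS dd] comp_ftr_assoc[OF dd]]
        whisker_left_hom[OF BB R u_op_hom, unfolded comp_id_right[OF BB R]]] .
qed

lemma component_AW:
  assumes "Y \<in> Obj BB"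
  shows "component AW Y = Cmp SS (far R (component (u_op C) Y)) (component \<eta> (fob dd Y))"
  unfolding Aw_nt_def using assms by (simp del: fun_cat_simps(1) pull_back_simps add: fun_cat_simps(10))

text \<open>On maps this is \<open>decs_iota\<close>. Strictness gives \<open>c_mid\<close>
  literally the same codomain as \<open>c_last\<close>, as required for consecutive steps of a
  zigzag.\<close>

lemma subdivision_iota:
  "comp_ftr (Fin C) (iota_pb C) (comp_ftr (Fin C) (diags_pb C) (decs_pb C)) = comp_ftr (Fin C) SD (iota_pb C)"
proof (rule ftr_eqI[OF is_functor_comp[OF category_Fin is_functor_comp[OF category_Fin is_functor_decs_pb is_functor_diags_pb] is_functor_iota_pb]
      is_functor_comp[OF category_Fin is_functor_iota_pb SD]])
  have on_ob: "comp_ftr Deltaop (comp_ftr FinSetop (comp_ftr FinSetop2 Z decs) (diag FinSetop)) iota =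
      comp_ftr Deltaop (comp_ftr Deltaop2 (comp_ftr Deltaop Z iota) dec) (diag Deltaop)"
    if Z: "is_functor FinSetop C Z" for Z
  proof (rule ftr_eqI)
    show "is_functor Deltaop C (comp_ftr Deltaop (comp_ftr FinSetop (comp_ftr FinSetop2 Z decs) (diag FinSetop)) iota)"
      by (intro is_functor_comp[OF category_Deltaop is_functor_iota]
          is_functor_comp[OF category_FinSetop is_functor_diag[OF category_FinSetop]]
          is_functor_comp[OF category_FinSetop2 is_functor_decs] Z)
    show "is_functor Deltaop C (comp_ftr Deltaop (comp_ftr Deltaop2 (comp_ftr Deltaop Z iota) dec) (diag Deltaop))"
      by (intro is_functor_comp[OF category_Deltaop is_functor_diag[OF category_Deltaop]]
          is_functor_comp[OF category_Deltaop2 is_functor_dec] is_functor_comp[OF category_Deltaop is_functor_iota] Z)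
  next
    fix n
    show "fob (comp_ftr Deltaop (comp_ftr FinSetop (comp_ftr FinSetop2 Z decs) (diag FinSetop)) iota) n =
      fob (comp_ftr Deltaop (comp_ftr Deltaop2 (comp_ftr Deltaop Z iota) dec) (diag Deltaop)) n"
      by (simp add: fob_decs)
  next
    fix f assume "f \<in> Arr Deltaop"
    then have f: "f \<in> hom Delta (Dom Delta f) (Cod Delta f)" by (simp add: hom_iff)
    show "far (comp_ftr Deltaop (comp_ftr FinSetop (comp_ftr FinSetop2 Z decs) (diag FinSetop)) iota) f =
      far (comp_ftr Deltaop (comp_ftr Deltaop2 (comp_ftr Deltaop Z iota) dec) (diag Deltaop)) f"
      using f far_iota_hom[OF f] far_dec_hom[OF f f] decs_iota[OF f f] by (simp add: hom_iff)
  qed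
  show "fob (comp_ftr (Fin C) (iota_pb C) (comp_ftr (Fin C) (diags_pb C) (decs_pb C))) Z =
      fob (comp_ftr (Fin C) SD (iota_pb C)) Z" if "Z \<in> Obj (Fin C)" for Z
  proof -
    have Z: "is_functor FinSetop C Z" using that by simp
    note a = is_functor_comp[OF category_FinSetop2 is_functor_decs Z]
    note b = is_functor_comp[OF category_FinSetop is_functor_diag[OF category_FinSetop] a]
    note c = is_functor_comp[OF category_Deltaop is_functor_iota Z]
    note d = is_functor_comp[OF category_Deltaop2 is_functor_dec c]
    show ?thesis using on_ob[OF Z] Z a b c d by simp
  qed
  fix t assume "t \<in> Arr (Fin C)"
  then have t: "t \<in> hom (Fin C) (src t) (tgt t)" by (simp add: hom_fun_cat_iff)
  note a = whisker_right_hom[OF category_FinSetop2 is_functor_decs t]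
  note b = whisker_right_hom[OF category_FinSetop is_functor_diag[OF category_FinSetop] a]
  note b' = whisker_right_hom[OF category_Deltaop is_functor_iota b]
  note c = whisker_right_hom[OF category_Deltaop is_functor_iota t]
  note d = whisker_right_hom[OF category_Deltaop2 is_functor_dec c]
  note d' = whisker_right_hom[OF category_Deltaop is_functor_diag[OF category_Deltaop] d]
  note n = nat_functors[OF t]
  have "whisker_right Deltaop (whisker_right FinSetop (whisker_right FinSetop2 t decs) (diag FinSetop)) iota =
      whisker_right Deltaop (whisker_right Deltaop2 (whisker_right Deltaop t iota) dec) (diag Deltaop)"
    by (rule nt_eqI[OF b'[unfolded on_ob[OF n(1)] on_ob[OF n(2)]] d']) (simp add: fob_decs)
  moreover have "t \<in> Arr (Fin C)" "whisker_right FinSetop2 t decs \<in> Arr (fun_cat FinSetop2 C)"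
    "whisker_right FinSetop (whisker_right FinSetop2 t decs) (diag FinSetop) \<in> Arr (Fin C)"
    "whisker_right Deltaop t iota \<in> Arr SS" "whisker_right Deltaop2 (whisker_right Deltaop t iota) dec \<in> Arr BB"
    using t a b c d by (simp_all add: hom_iff)
  ultimately show "far (comp_ftr (Fin C) (iota_pb C) (comp_ftr (Fin C) (diags_pb C) (decs_pb C))) t =
      far (comp_ftr (Fin C) SD (iota_pb C)) t"
    by simp
qed

lemma c_mid_hom: "c_mid C CC \<in> hom (fun_cat SS SS) ZZ (comp_ftr SS SD ZZ)"
  unfolding c_mid_def
  using whisker_right_hom[OF SS CC whisker_left_hom[OF category_Fin is_functor_iota_pb c_op_hom]]
  by (simp add: subdivision_iota comp_id_right[OF category_Fin is_functor_iota_pb] comp_ftr_assoc[OF CC])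

lemma component_c_mid:
  assumes X: "X \<in> Obj SS"
  shows "component (component (c_mid C CC) X) n = far (fob CC X) (fold_map {..n})"
proof -
  have Z: "fob CC X \<in> Obj (Fin C)" using is_functor_Obj[OF CC X] .
  have "component (c_op C) (fob CC X) \<in> Arr (Fin C)"
    using nat_component[OF c_op_hom Z] by (simp add: hom_iff)
  then show ?thesis
    using X Z component_c_op[of C "fob CC X" "{..n}"] by (simp add: c_mid_def)
qed

lemma c_last_hom: "c_last C e \<in> hom (fun_cat SS SS) SD (comp_ftr SS SD ZZ)"
  unfolding c_last_def using whisker_left_hom[OF SS SD e] by (simp add: comp_id_right[OF SS SD])

definition "front_Z = whisker_right SS (front C) ZZ"
text \<open>\<open>front\<close> and \<open>\<theta>\<close> both start at the subdivision: the
  first compares the fold map with the identity (\<open>front_c_mid\<close>), the second compares it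
  with the unit (\<open>\<theta>_c_mid\<close>).\<close>

definition "\<theta> = whisker_right SS AW LL"
definition "\<theta>_Z = whisker_right SS \<theta> ZZ"
definition "\<eta>_Z = whisker_right SS \<eta> ZZ"
definition "RLe = whisker_left SS RL e"

lemma front_Z_hom: "front_Z \<in> hom (fun_cat SS SS) (comp_ftr SS SD ZZ) ZZ"
  unfolding front_Z_def using whisker_right_hom[OF SS ZZ front_hom] by (simp add: comp_id_left[OF SS SS ZZ])

lemma \<theta>_hom: "\<theta> \<in> hom (fun_cat SS SS) SD RL"
  unfolding \<theta>_def by (rule whisker_right_hom[OF SS LL AW_hom])

lemma \<theta>_Z_hom: "\<theta>_Z \<in> hom (fun_cat SS SS) (comp_ftr SS SD ZZ) (comp_ftr SS RL ZZ)"
  unfolding \<theta>_Z_def by (rule whisker_right_hom[OF SS ZZ \<theta>_hom])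

lemma \<eta>_Z_hom: "\<eta>_Z \<in> hom (fun_cat SS SS) ZZ (comp_ftr SS RL ZZ)"
  unfolding \<eta>_Z_def using whisker_right_hom[OF SS ZZ \<eta>] by (simp add: comp_id_left[OF SS SS ZZ])

lemma RLe_hom: "RLe \<in> hom (fun_cat SS SS) RL (comp_ftr SS RL ZZ)"
  unfolding RLe_def using whisker_left_hom[OF SS RL e] by (simp add: comp_id_right[OF SS RL])

text \<open>Serves twice: to see that \<open>c_last\<close> is a weak equivalence, and to move
  \<open>front\<close> past the inverse of \<open>c_last\<close>.\<close>

lemma front_e: "Cmp (fun_cat SS SS) e (front C) = Cmp (fun_cat SS SS) front_Z (c_last C e)"
  using whisker_interchange[OF SS SS e front_hom] whisker_left_id[OF SS SS e] whisker_right_id[OF SS front_hom]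
  by (simp add: front_Z_def c_last_def)

lemma \<theta>_e: "Cmp (fun_cat SS SS) \<theta>_Z (c_last C e) = Cmp (fun_cat SS SS) RLe \<theta>"
  using whisker_interchange[OF SS SS e \<theta>_hom] whisker_right_id[OF SS \<theta>_hom]
  by (simp add: \<theta>_Z_def c_last_def RLe_def)

lemma \<eta>_e: "Cmp (fun_cat SS SS) \<eta>_Z e = Cmp (fun_cat SS SS) RLe \<eta>"
  using whisker_interchange[OF SS SS e \<eta>] whisker_left_id[OF SS SS e] whisker_right_id[OF SS \<eta>]
  by (simp add: \<eta>_Z_def RLe_def)

lemma fob_ZZ:
  assumes "X \<in> Obj SS"
  shows "is_functor FinSetop C (fob CC X)" "fob (fob ZZ X) n = fob (fob CC X) {..n}"
    and "a \<in> Arr Delta \<Longrightarrow> far (fob ZZ X) a = far (fob CC X) (far iota a)"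
proof -
  show Z: "is_functor FinSetop C (fob CC X)" using is_functor_Obj[OF CC assms] by simp
  show "fob (fob ZZ X) n = fob (fob CC X) {..n}" "a \<in> Arr Delta \<Longrightarrow> far (fob ZZ X) a = far (fob CC X) (far iota a)"
    using assms Z by simp_all
qed

text \<open>\<open>c_mid\<close> is pull-back along the fold map, so by contravariance every section
  of the fold map provides a left inverse.\<close>

lemma fold_retract:
  assumes X: "X \<in> Obj SS" and g: "dmap n (n + n + 1) g \<in> hom Delta n (n + n + 1)"
    and "\<And>i. i \<le> n \<Longrightarrow> g i = i \<or> g i = n + 1 + i"
  shows "Cmp C (far (fob ZZ X) (dmap n (n + n + 1) g)) (component (component (c_mid C CC) X) n) = Idt C (fob (fob ZZ X) n)"
proof -
  note Z = fob_ZZ(1)[OF X]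
  have "fold_map {..n} \<in> hom FinSet {..n + n + 1} {..n}"
    using fold_map_hom[of "{..n}"] by simp
  then show ?thesis
    using fin_ob_Cmp[OF Z far_iota_hom[OF g], of "fold_map {..n}" "{..n}"] fold_map_section[OF g assms(3)]
      fin_ob_Idt[OF Z, of "{..n}"] g X
    by (simp add: component_c_mid fob_ZZ hom_iff del: comp_ftr_simps)
qed

lemma front_c_mid: "Cmp (fun_cat SS SS) front_Z (c_mid C CC) = Idt (fun_cat SS SS) ZZ"
proof -
  interpret S: category SS by (rule SS)
  interpret E: category "fun_cat SS SS" by (intro category_fun_cat SS)
  have Z: "ZZ \<in> Obj (fun_cat SS SS)" using ZZ by simp
  show ?thesis
  proof (rule nt_eqI[OF E.Cmp_hom[OF c_mid_hom front_Z_hom] E.Idt_hom[OF Z]])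
    fix X assume X: "X \<in> Obj SS"
    have ZX: "fob ZZ X \<in> Obj SS" using is_functor_Obj[OF ZZ X] .
    have "Cmp SS (component front_Z X) (component (c_mid C CC) X) = Idt SS (fob ZZ X)"
    proof (rule nt_eqI[OF S.Cmp_hom[OF nat_component[OF c_mid_hom X] nat_component[OF front_Z_hom X]] S.Idt_hom[OF ZX]])
      fix n
      have "component (component front_Z X) n = far (fob ZZ X) (incl1 n n)"
        unfolding front_Z_def using X ZX component_front[of "fob ZZ X" n] by (simp del: comp_ftr_simps)
      then show "component (Cmp SS (component front_Z X) (component (c_mid C CC) X)) n = component (Idt SS (fob ZZ X)) n"
        using fold_retract[OF X, of n "\<lambda>i. i"] incl_hom(1)[of n n] by (simp add: incl_dmap del: comp_ftr_simps)
    qed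
    then show "component (Cmp (fun_cat SS SS) front_Z (c_mid C CC)) X = component (Idt (fun_cat SS SS) ZZ) X"
      using X by (simp del: comp_ftr_simps)
  qed
qed

text \<open>The strict triangle identity. By naturality of \<open>\<eta>\<close> it suffices that
  \<open>u_op\<close> after the decalage of \<open>c\<close> is the identity. This holds since
  \<open>[n]\<close> concatenated with \<open>[m]\<close> is sent to two copies of itself by
  \<open>incl1\<close> on the first block and \<open>incl2\<close> on the second, which is a section
  of the fold map.\<close>

lemma \<theta>_c_mid: "Cmp (fun_cat SS SS) \<theta>_Z (c_mid C CC) = \<eta>_Z"
proof -
  interpret S: category SS by (rule SS)
  interpret B: category BB by (rule BB)
  interpret E: category "fun_cat SS SS" by (intro category_fun_cat SS)
  show ?thesis
  proof (rule nt_eqI[OF E.Cmp_hom[OF c_mid_hom \<theta>_Z_hom] \<eta>_Z_hom])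
    fix X assume X: "X \<in> Obj SS"
    define Z where "Z = fob ZZ X"
    define c where "c = component (c_mid C CC) X"
    have Z: "Z \<in> Obj SS" using is_functor_Obj[OF ZZ X] by (simp add: Z_def)
    have LZ: "fob LL Z \<in> Obj BB" using is_functor_Obj[OF LL Z] .
    have dLZ: "fob dd (fob LL Z) \<in> Obj SS" using is_functor_Obj[OF dd LZ] .
    have c: "c \<in> hom SS Z (fob dd (fob LL Z))"
      using nat_component[OF c_mid_hom X] X Z unfolding c_def Z_def by (simp del: fun_cat_simps(1) pull_back_simps)
    have Lc: "far LL c \<in> hom BB (fob LL Z) (fob LL (fob dd (fob LL Z)))" by (rule is_functor_hom[OF LL c])
    have u: "component (u_op C) (fob LL Z) \<in> hom BB (fob LL (fob dd (fob LL Z))) (fob LL Z)"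
      using nat_component[OF u_op_hom LZ] LZ by (simp del: fun_cat_simps(1) pull_back_simps)
    have uc: "Cmp BB (component (u_op C) (fob LL Z)) (far LL c) = Idt BB (fob LL Z)"
    proof (rule nt_eqI[OF B.Cmp_hom[OF Lc u] B.Idt_hom[OF LZ]])
      fix nm :: "nat \<times> nat"
      obtain n m where nm: "nm = (n, m)" by (metis surj_pair)
      define N where "N = n + m + 1"
      have i: "dmap n N (\<lambda>i. i) \<in> hom Delta n N" "dmap m N (\<lambda>i. n + 1 + i) \<in> hom Delta m N"
        using incl_hom[of n m] incl_hom(2)[where n = n and m = m] by (simp_all add: incl_dmap N_def)
      have "far dec (incl1 n m, incl2 n m) = dmap N (N + N + 1) (\<lambda>i. if i \<le> n then i else N + 1 + (n + 1 + (i - (n + 1))))"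
        using far_dec[OF i] by (simp add: incl_dmap N_def)
      also have "\<dots> = dmap N (N + N + 1) (\<lambda>i. if i \<le> n then i else N + 1 + i)"
        by (auto simp: dmap_eq_iff)
      finally have dec: "far dec (incl1 n m, incl2 n m) = dmap N (N + N + 1) (\<lambda>i. if i \<le> n then i else N + 1 + i)" .
      have h: "dmap N (N + N + 1) (\<lambda>i. if i \<le> n then i else N + 1 + i) \<in> hom Delta N (N + N + 1)"
        using far_dec_hom[OF incl_hom(1) incl_hom(2), of n m n m] unfolding dec by (simp add: N_def)
      have "component (component (u_op C) (fob LL Z)) (n, m) = far Z (far dec (incl1 n m, incl2 n m))"
        using component_u_op[of "fob LL Z" n m] LZ Z incl_hom[of n m] incl_hom(2)[where n = n and m = m] by (simp add: hom_iff)
      moreover have "component (far LL c) (n, m) = component c N" using c by (simp add: hom_fun_cat_iff N_def)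
      moreover have "Cmp C (far Z (dmap N (N + N + 1) (\<lambda>i. if i \<le> n then i else N + 1 + i))) (component c N) = Idt C (fob Z N)"
        unfolding Z_def c_def by (rule fold_retract[OF X h]) auto
      ultimately show "component (Cmp BB (component (u_op C) (fob LL Z)) (far LL c)) nm = component (Idt BB (fob LL Z)) nm"
        using Z by (simp add: nm dec N_def)
    qed
    have hZ: "component \<eta> Z \<in> hom SS Z (fob R (fob LL Z))"
      and hd: "component \<eta> (fob dd (fob LL Z)) \<in> hom SS (fob dd (fob LL Z)) (fob R (fob LL (fob dd (fob LL Z))))"
      using nat_component[OF \<eta> Z] nat_component[OF \<eta> dLZ] Z dLZ by (simp_all del: fun_cat_simps(1) pull_back_simps)
    note Ru = is_functor_hom[OF R u] and RLc = is_functor_hom[OF R Lc]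
    have nat: "Cmp SS (component \<eta> (fob dd (fob LL Z))) c = Cmp SS (far R (far LL c)) (component \<eta> Z)"
    proof -
      have "c \<in> Arr SS" using c by (simp add: hom_iff)
      then show ?thesis using naturality[OF \<eta> c] by (simp del: fun_cat_simps(2) pull_back_simps)
    qed
    have "Cmp SS (component AW (fob LL Z)) c = component \<eta> Z"
      unfolding component_AW[OF LZ]
      using S.Cmp_assoc[OF c hd Ru] nat S.Cmp_assoc[OF hZ RLc Ru] is_functor_Cmp[OF R Lc u] uc
        is_functor_Idt[OF R LZ] S.Cmp_Idt_left[OF hZ] by simp
    moreover have "component \<theta>_Z X = component AW (fob LL Z)" "component \<eta>_Z X = component \<eta> Z"
      using X Z unfolding \<theta>_Z_def \<theta>_def \<eta>_Z_def Z_def by (simp_all del: fun_cat_simps(1) pull_back_simps comp_ftr_simps)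
    ultimately show "component (Cmp (fun_cat SS SS) \<theta>_Z (c_mid C CC)) X = component \<eta>_Z X"
      using X by (simp add: c_def del: fun_cat_simps(1))
  qed
qed

text \<open>\<open>Aw_nt\<close> is the transpose of \<open>u_op\<close>, and composition with the
  counit transposes it back.\<close>

lemma counit_AW:
  "Cmp (fun_cat BB SS) (whisker_left BB dd \<epsilon>) (whisker_left BB SD AW) = whisker_left BB dd (u_op C)"
proof -
  interpret S: category SS by (rule SS)
  interpret B: category BB by (rule BB)
  interpret D: category "fun_cat BB SS" by (intro category_fun_cat SS BB)
  have saw: "whisker_left BB SD AW \<in> hom (fun_cat BB SS) (comp_ftr BB dd (comp_ftr BB LL dd)) (comp_ftr BB dd (comp_ftr BB LL R))"
    using whisker_left_hom[OF BB SD AW_hom] unfolding comp_ftr_assoc[OF R] comp_ftr_assoc[OF dd] .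
  show ?thesis
  proof (rule nt_eqI[OF D.Cmp_hom[OF saw whisker_left_hom[OF BB dd \<epsilon>]] whisker_left_hom[OF BB dd u_op_hom]])
    fix Y assume Y: "Y \<in> Obj BB"
    define Y' where "Y' = fob LL (fob dd Y)"
    have dY: "fob dd Y \<in> Obj SS" using is_functor_Obj[OF dd Y] .
    have aw: "component AW Y \<in> hom SS (fob dd Y) (fob R Y)" by (rule nat_component[OF AW_hom Y])
    have u: "component (u_op C) Y \<in> hom BB Y' Y"
      using nat_component[OF u_op_hom Y] Y unfolding Y'_def by (simp del: fun_cat_simps(1) pull_back_simps)
    have h: "component \<eta> (fob dd Y) \<in> hom SS (fob dd Y) (fob R Y')"
      using nat_component[OF \<eta> dY] dY unfolding Y'_def by (simp del: fun_cat_simps(1) pull_back_simps)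
    have Y': "Y' \<in> Obj BB" using is_functor_Obj[OF LL dY] by (simp add: Y'_def)
    have ep: "component \<epsilon> Y \<in> hom BB (fob LL (fob R Y)) Y" "component \<epsilon> Y' \<in> hom BB (fob LL (fob R Y')) Y'"
      using nat_component[OF \<epsilon> Y] nat_component[OF \<epsilon> Y'] Y Y' by (simp_all del: fun_cat_simps(1) pull_back_simps)
    note Ru = is_functor_hom[OF R u]
    note LRu = is_functor_hom[OF LL Ru] and Lh = is_functor_hom[OF LL h] and Law = is_functor_hom[OF LL aw]
    have nat: "Cmp BB (component \<epsilon> Y) (far LL (far R (component (u_op C) Y))) = Cmp BB (component (u_op C) Y) (component \<epsilon> Y')"
    proof -
      have "component (u_op C) Y \<in> Arr BB" using u by (simp add: hom_iff)
      then show ?thesis using naturality[OF \<epsilon> u] by (simp del: fun_cat_simps(2) pull_back_simps)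
    qed
    have "Cmp BB (component \<epsilon> Y) (far LL (component AW Y)) = component (u_op C) Y"
      unfolding component_AW[OF Y] is_functor_Cmp[OF LL h Ru]
      using B.Cmp_assoc[OF Lh LRu ep(1)] nat B.Cmp_assoc[OF Lh[folded Y'_def] ep(2) u] triangle1[OF dY]
        B.Cmp_Idt_right[OF u] by (simp add: Y'_def)
    moreover have "component AW Y \<in> Arr SS" using aw by (simp add: hom_iff)
    ultimately show "component (Cmp (fun_cat BB SS) (whisker_left BB dd \<epsilon>) (whisker_left BB SD AW)) Y =
        component (whisker_left BB dd (u_op C)) Y"
      using Y is_functor_Cmp[OF dd Law ep(1)] by (simp del: fun_cat_simps(1,2) pull_back_simps)
  qed
qed

lemma unit_R: "whisker_right BB \<eta> R \<in> hom (fun_cat BB SS) R (comp_ftr BB RL R)"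
  and R_counit: "whisker_left BB R \<epsilon> \<in> hom (fun_cat BB SS) (comp_ftr BB RL R) R"
  using whisker_right_hom[OF BB R \<eta>] whisker_left_hom[OF BB R \<epsilon>]
  unfolding comp_id_left[OF BB SS R] comp_id_right[OF BB R] comp_ftr_assoc[OF R] .

lemma R_counit_unit: "Cmp (fun_cat BB SS) (whisker_left BB R \<epsilon>) (whisker_right BB \<eta> R) = Idt (fun_cat BB SS) R"
proof -
  interpret D: category "fun_cat BB SS" by (intro category_fun_cat SS BB)
  have "R \<in> Obj (fun_cat BB SS)" using R by simp
  then show ?thesis
    by (intro nt_eqI[OF D.Cmp_hom[OF unit_R R_counit] D.Idt_hom])
      (simp_all add: triangle2 del: fun_cat_simps(1))
qed

text \<open>The three invertibility assumptions hold with formal inverses if the components of \<open>c_last\<close>, \<open>e\<close>, \<open>RLe\<close> are weak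
  equivalences, and with actual inverses in the strongly symmetric case.\<close>

lemma Aw_Ez_inverse:
  fixes W :: "('o, 'm) simp_ar set"
  defines "V \<equiv> objectwise BB SS W"
  assumes W: "W1 C W"
    and l: "\<And>F. is_functor BB SS F \<Longrightarrow> zinv (fun_cat BB SS) V (comp_ftr BB SD F) (comp_ftr BB (comp_ftr SS SD ZZ) F)
      [Fwd (whisker_right BB (c_last C e) F)] (l' F)"
    and e': "zinv (fun_cat BB SS) V dd (comp_ftr BB ZZ dd) [Fwd (whisker_right BB e dd)] e'"
    and r': "zinv (fun_cat BB SS) V (comp_ftr BB RL R) (comp_ftr BB (comp_ftr SS RL ZZ) R) [Fwd (whisker_right BB RLe R)] r'"
  shows "zinv (fun_cat BB SS) V dd R [Fwd AW]
    ([Fwd (whisker_right BB e R), Fwd (whisker_right BB (c_mid C CC) R)] @ l' R @ [Fwd (whisker_left BB dd \<epsilon>)])"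
proof -
  interpret D: category "fun_cat BB SS" by (intro category_fun_cat SS BB)
  let ?r = "\<lambda>t F. whisker_right BB t F"
  note wR = whisker_right_hom[OF BB R] and wd = whisker_right_hom[OF BB dd]
  note RC = whisker_right_Cmp[OF BB SS SS]
  have eR: "?r e R \<in> hom (fun_cat BB SS) R (comp_ftr BB ZZ R)"
    and ed: "?r e dd \<in> hom (fun_cat BB SS) dd (comp_ftr BB ZZ dd)"
    using wR[OF e] wd[OF e] unfolding comp_id_left[OF BB SS R] comp_id_left[OF BB SS dd] .
  have de: "whisker_left BB dd \<epsilon> \<in> hom (fun_cat BB SS) (comp_ftr BB SD R) dd"
    using whisker_left_hom[OF BB dd \<epsilon>] unfolding comp_ftr_assoc[OF R] comp_id_right[OF BB dd] .
  have v: "?r (front C) dd \<in> hom (fun_cat BB SS) (comp_ftr BB SD dd) dd"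
    using wd[OF front_hom] unfolding comp_id_left[OF BB SS dd] .
  show ?thesis
  proof (rule D.zigzag_inverse_calculus[OF AW_hom eR wR[OF c_mid_hom] l[OF R] de e' wd[OF c_mid_hom] l[OF dd]
        whisker_left_hom[OF BB ZZ AW_hom] whisker_left_hom[OF BB is_functor_comp[OF SS ZZ SD] AW_hom]
        whisker_left_hom[OF BB SD AW_hom] v wd[OF front_Z_hom] wR[OF \<theta>_hom] wR[OF \<theta>_Z_hom] r'
        unit_R wR[OF \<eta>_Z_hom] R_counit])
    show "Cmp (fun_cat BB SS) (?r e R) AW = Cmp (fun_cat BB SS) (whisker_left BB ZZ AW) (?r e dd)"
      using whisker_interchange[OF BB SS AW_hom e] unfolding whisker_left_id[OF BB SS AW_hom] .
    show "Cmp (fun_cat BB SS) (?r (c_mid C CC) R) (whisker_left BB ZZ AW) =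
        Cmp (fun_cat BB SS) (whisker_left BB (comp_ftr SS SD ZZ) AW) (?r (c_mid C CC) dd)"
      by (rule whisker_interchange[OF BB SS AW_hom c_mid_hom])
    show "Cmp (fun_cat BB SS) (?r (c_last C e) R) (whisker_left BB SD AW) =
        Cmp (fun_cat BB SS) (whisker_left BB (comp_ftr SS SD ZZ) AW) (?r (c_last C e) dd)"
      by (rule whisker_interchange[OF BB SS AW_hom c_last_hom])
    show "zeq (fun_cat BB SS) V (comp_ftr BB SD dd) dd
        [Fwd (Cmp (fun_cat BB SS) (whisker_left BB dd \<epsilon>) (whisker_left BB SD AW))] [Fwd (?r (front C) dd)]"
      unfolding counit_AW V_def by (rule u_op_zeq_front[OF W])
    show "Cmp (fun_cat BB SS) (?r e dd) (?r (front C) dd) = Cmp (fun_cat BB SS) (?r front_Z dd) (?r (c_last C e) dd)"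
      unfolding RC[OF dd front_hom e, symmetric] RC[OF dd c_last_hom front_Z_hom, symmetric] front_e ..
    show "Cmp (fun_cat BB SS) (?r front_Z dd) (?r (c_mid C CC) dd) = Idt (fun_cat BB SS) (comp_ftr BB ZZ dd)"
      unfolding RC[OF dd c_mid_hom front_Z_hom, symmetric] front_c_mid by (rule whisker_right_Idt[OF BB SS SS dd ZZ])
    show "Cmp (fun_cat BB SS) AW (whisker_left BB dd \<epsilon>) = Cmp (fun_cat BB SS) (whisker_left BB R \<epsilon>) (?r \<theta> R)"
      using whisker_interchange[OF BB SS \<epsilon> AW_hom]
      unfolding whisker_right_id[OF BB AW_hom] \<theta>_def whisker_right_assoc[OF R] .
    show "Cmp (fun_cat BB SS) (?r \<theta>_Z R) (?r (c_last C e) R) = Cmp (fun_cat BB SS) (?r RLe R) (?r \<theta> R)"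
      unfolding RC[OF R c_last_hom \<theta>_Z_hom, symmetric] RC[OF R \<theta>_hom RLe_hom, symmetric] \<theta>_e ..
    show "Cmp (fun_cat BB SS) (?r \<theta>_Z R) (?r (c_mid C CC) R) = ?r \<eta>_Z R"
      unfolding RC[OF R c_mid_hom \<theta>_Z_hom, symmetric] \<theta>_c_mid ..
    show "Cmp (fun_cat BB SS) (?r \<eta>_Z R) (?r e R) = Cmp (fun_cat BB SS) (?r RLe R) (?r \<eta> R)"
      unfolding RC[OF R e \<eta>_Z_hom, symmetric] RC[OF R \<eta> RLe_hom, symmetric] \<eta>_e ..
    show "Cmp (fun_cat BB SS) (whisker_left BB R \<epsilon>) (?r \<eta> R) = Idt (fun_cat BB SS) R"
      by (rule R_counit_unit)
  qed
qed

section \<open>The symmetric and the strongly symmetric case\<close>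

lemma weak_case:
  assumes W: "W1 C W" "W2 C W" "weakly_saturated SS W" and eW: "\<And>X. X \<in> Obj SS \<Longrightarrow> component e X \<in> W"
  shows "inverse_arrows (Loc_Fun C W) (Aw C W R \<eta>) (Ez C W CC e R \<epsilon>)"
proof -
  interpret D: category "fun_cat BB SS" by (intro category_fun_cat SS BB)
  note ws = weakly_saturatedD[OF W(3)]
  have square: "Cmp SS (component t X) (component s X) = Cmp SS (component t' X) (component s' X)"
    if "Cmp (fun_cat SS SS) t s = Cmp (fun_cat SS SS) t' s'" "X \<in> Obj SS" for t s t' s' X
    using arg_cong[OF that(1), of "\<lambda>t. component t X"] that(2) by (simp del: fun_cat_simps(1))
  have fW: "component (front C) X \<in> W" if "X \<in> Obj SS" for X using front_weq[OF W] that by simp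
  have hW: "component \<eta> X \<in> W" if "X \<in> Obj SS" for X using unit_weq[OF W(1,3) adj] that by simp
  \<comment> \<open>The subdivision is not known to preserve \<open>W\<close>; instead 2-out-of-3 is
    applied to \<open>front_e\<close>, whose other three sides are in \<open>W\<close>.\<close>
  have lW: "component (c_last C e) X \<in> W" if X: "X \<in> Obj SS" for X
  proof -
    have ZX: "fob ZZ X \<in> Obj SS" by (rule is_functor_Obj[OF ZZ X])
    have "component front_Z X \<in> W"
      using fW[OF ZX] X by (simp add: front_Z_def del: fun_cat_simps(1) comp_ftr_simps)
    moreover have "Cmp SS (component e X) (component (front C) X) \<in> W"
      using ws(2)[OF nat_component[OF front_hom X] nat_component[OF e X] fW[OF X] eW[OF X]] .
    ultimately show ?thesis
      using ws(4)[OF nat_component[OF c_last_hom X] nat_component[OF front_Z_hom X]] square[OF front_e X] by simp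
  qed
  \<comment> \<open>The same argument in the square \<open>\<eta>_e\<close>, with the unit in place
    of \<open>front\<close>.\<close>
  have rW: "component RLe X \<in> W" if X: "X \<in> Obj SS" for X
  proof -
    have ZX: "fob ZZ X \<in> Obj SS" by (rule is_functor_Obj[OF ZZ X])
    have "component \<eta>_Z X \<in> W"
      using hW[OF ZX] X by (simp add: \<eta>_Z_def del: fun_cat_simps(1) comp_ftr_simps)
    then have "Cmp SS (component \<eta>_Z X) (component e X) \<in> W"
      using ws(2)[OF nat_component[OF e X] nat_component[OF \<eta>_Z_hom X] eW[OF X]] by simp
    then show ?thesis
      using ws(3)[OF nat_component[OF \<eta> X] nat_component[OF RLe_hom X] hW[OF X]] square[OF \<eta>_e X] by simp
  qed
  have V: "whisker_right BB t F \<in> objectwise BB SS W"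
    if "t \<in> hom (fun_cat SS SS) G H" "is_functor BB SS F" "\<And>X. X \<in> Obj SS \<Longrightarrow> component t X \<in> W" for t F G H
    using whisker_right_hom[OF BB that(2,1)] that(3)[OF is_functor_Obj[OF that(2)]]
    by (simp add: objectwise_def hom_iff)
  have "zinv (fun_cat BB SS) (objectwise BB SS W) dd R [Fwd AW]
    ([Fwd (whisker_right BB e R), Fwd (whisker_right BB (c_mid C CC) R)] @ [Bwd (whisker_right BB (c_last C e) R)] @
      [Fwd (whisker_left BB dd \<epsilon>)])"
  proof (rule Aw_Ez_inverse[OF W(1)])
    show "zinv (fun_cat BB SS) (objectwise BB SS W) (comp_ftr BB SD F) (comp_ftr BB (comp_ftr SS SD ZZ) F)
        [Fwd (whisker_right BB (c_last C e) F)] [Bwd (whisker_right BB (c_last C e) F)]" if "is_functor BB SS F" for F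
      by (rule D.zinv_weq[OF V[OF c_last_hom that lW] whisker_right_hom[OF BB that c_last_hom]])
    show "zinv (fun_cat BB SS) (objectwise BB SS W) dd (comp_ftr BB ZZ dd)
        [Fwd (whisker_right BB e dd)] [Bwd (whisker_right BB e dd)]"
      using D.zinv_weq[OF V[OF e dd eW] whisker_right_hom[OF BB dd e]] unfolding comp_id_left[OF BB SS dd] .
    show "zinv (fun_cat BB SS) (objectwise BB SS W) (comp_ftr BB RL R) (comp_ftr BB (comp_ftr SS RL ZZ) R)
        [Fwd (whisker_right BB RLe R)] [Bwd (whisker_right BB RLe R)]"
      by (rule D.zinv_weq[OF V[OF RLe_hom R rW] whisker_right_hom[OF BB R RLe_hom]])
  qed
  then show ?thesis
    using D.inverse_arrows_localization by (simp add: Aw_def Ez_def Ez_zigzag_def c_zigzag_def)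
qed

text \<open>An inverse of \<open>e\<close> is carried by functoriality to inverses of
  \<open>c_last\<close> and \<open>RLe\<close>. With these the calculation produces forward steps
  only, and they compose to \<open>Ez_strong_nt\<close>.\<close>

lemma strong_case:
  assumes W: "W1 C W" and iso: "\<And>X. X \<in> Obj SS \<Longrightarrow> iso_arrow SS (component e X)"
  shows "inverse_arrows (Loc_Fun C W) (Aw C W R \<eta>) (Ez_strong C W CC e R \<epsilon>)"
proof -
  interpret D: category "fun_cat BB SS" by (intro category_fun_cat SS BB)
  interpret E: category "fun_cat SS SS" by (intro category_fun_cat SS)
  let ?V = "objectwise BB SS W"
  obtain i where i: "inverse_arrows (fun_cat SS SS) e i" using objectwise_inverse[OF SS SS e iso] by blast
  define l where "l = whisker_left SS SD i"
  have l: "inverse_arrows (fun_cat SS SS) (c_last C e) l"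
    unfolding l_def c_last_def by (rule whisker_left_inverse[OF SS SS SS SD e i])
  note l_hom = inverse_arrowsD(1)[OF l c_last_hom]
  let ?c = "Cmp (fun_cat SS SS) l (Cmp (fun_cat SS SS) (c_mid C CC) e)"
  have c: "c_strong C CC e = ?c"
    unfolding c_strong_def Let_def E.inv_arrow_eq[OF l] ..
  let ?z = "[Fwd (whisker_right BB e R), Fwd (whisker_right BB (c_mid C CC) R)] @ [Fwd (whisker_right BB l R)] @
      [Fwd (whisker_left BB dd \<epsilon>)]"
  have z: "zinv (fun_cat BB SS) ?V dd R [Fwd AW] ?z"
  proof (rule Aw_Ez_inverse[OF W])
    show "zinv (fun_cat BB SS) ?V (comp_ftr BB SD F) (comp_ftr BB (comp_ftr SS SD ZZ) F)
        [Fwd (whisker_right BB (c_last C e) F)] [Fwd (whisker_right BB l F)]" if F: "is_functor BB SS F" for F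
      by (rule D.zinv_iso[OF whisker_right_inverse[OF BB SS SS F c_last_hom l] whisker_right_hom[OF BB F c_last_hom]])
    show "zinv (fun_cat BB SS) ?V dd (comp_ftr BB ZZ dd)
        [Fwd (whisker_right BB e dd)] [Fwd (whisker_right BB i dd)]"
      using D.zinv_iso[OF whisker_right_inverse[OF BB SS SS dd e i] whisker_right_hom[OF BB dd e]]
      unfolding comp_id_left[OF BB SS dd] .
    have "inverse_arrows (fun_cat SS SS) RLe (whisker_left SS RL i)"
      unfolding RLe_def by (rule whisker_left_inverse[OF SS SS SS RL e i])
    from D.zinv_iso[OF whisker_right_inverse[OF BB SS SS R RLe_hom this] whisker_right_hom[OF BB R RLe_hom]]
    show "zinv (fun_cat BB SS) ?V (comp_ftr BB RL R) (comp_ftr BB (comp_ftr SS RL ZZ) R)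
        [Fwd (whisker_right BB RLe R)] [Fwd (whisker_right BB (whisker_left SS RL i) R)]" .
  qed
  have eR: "whisker_right BB e R \<in> hom (fun_cat BB SS) R (comp_ftr BB ZZ R)"
    using whisker_right_hom[OF BB R e] unfolding comp_id_left[OF BB SS R] .
  note mR = whisker_right_hom[OF BB R c_mid_hom] and lR = whisker_right_hom[OF BB R l_hom]
  have de: "whisker_left BB dd \<epsilon> \<in> hom (fun_cat BB SS) (comp_ftr BB SD R) dd"
    using whisker_left_hom[OF BB dd \<epsilon>] unfolding comp_ftr_assoc[OF R] comp_id_right[OF BB dd] .
  have F: "zigzag (fun_cat BB SS) ?V X [Fwd f] Y" if "f \<in> hom (fun_cat BB SS) X Y" for f X Y
    using that D.hom_Obj[OF that] by (simp add: hom_iff)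
  have me: "Cmp (fun_cat SS SS) (c_mid C CC) e \<in> hom (fun_cat SS SS) (id_ftr SS) (comp_ftr SS SD ZZ)"
    by (rule E.Cmp_hom[OF e c_mid_hom])
  have cR: "whisker_right BB ?c R = Cmp (fun_cat BB SS) (whisker_right BB l R)
      (Cmp (fun_cat BB SS) (whisker_right BB (c_mid C CC) R) (whisker_right BB e R))"
    using whisker_right_Cmp[OF BB SS SS R me l_hom] whisker_right_Cmp[OF BB SS SS R e c_mid_hom] by simp
  have "zeq (fun_cat BB SS) ?V R dd ([Fwd (whisker_right BB e R), Fwd (whisker_right BB (c_mid C CC) R)] @
        [Fwd (whisker_right BB l R), Fwd (whisker_left BB dd \<epsilon>)])
      ([Fwd (Cmp (fun_cat BB SS) (whisker_right BB (c_mid C CC) R) (whisker_right BB e R))] @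
        [Fwd (whisker_right BB l R), Fwd (whisker_left BB dd \<epsilon>)])"
    using D.zeq_append[OF D.zeq_Cmp[OF eR mR] zeq_refl[OF D.zigzag_append[OF F[OF lR] F[OF de]]]] by simp
  also have "zeq (fun_cat BB SS) ?V R dd \<dots> ([Fwd (whisker_right BB ?c R)] @ [Fwd (whisker_left BB dd \<epsilon>)])"
    unfolding cR using D.zeq_append[OF D.zeq_Cmp[OF D.Cmp_hom[OF eR mR] lR] zeq_refl[OF F[OF de]]] by simp
  also have "zeq (fun_cat BB SS) ?V R dd \<dots> [Fwd (Ez_strong_nt C CC e R \<epsilon>)]"
    unfolding Ez_strong_nt_def c
    using D.zeq_Cmp[OF _ de, of "whisker_right BB ?c R" R] D.Cmp_hom[OF D.Cmp_hom[OF eR mR] lR] by (simp add: cR)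
  finally have "loc_class (fun_cat BB SS) ?V R dd ?z = loc_class (fun_cat BB SS) ?V R dd [Fwd (Ez_strong_nt C CC e R \<epsilon>)]"
    by (intro D.loc_class_eqI) simp
  then show ?thesis
    using D.inverse_arrows_localization[OF z] by (simp add: Aw_def Ez_strong_def)
qed

end

theorem theorem4p65:
  fixes C :: "('o, 'm) cat"
    and W :: "('o, 'm) simp_ar set"
    and CC :: "('o, 'm) sym_ftr"
    and e :: "('o, 'm) simp_nt"
    and R :: "('o, 'm) tot_ftr"
    and \<eta> :: "('o, 'm) simp_nt"
    and \<epsilon> :: "('o, 'm) bisimp_nt"
  assumes "category C" and "finitely_complete C" and "finitely_cocomplete C"
    and "W \<subseteq> Arr (Simp C)" and "W1 C W"
    and "adjunction (Simp C) (Bisimp C) (dec_pb C) R \<eta> \<epsilon>"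
  shows "(weakly_saturated (Simp C) W \<and> W2 C W \<and> symmetric C W CC e \<longrightarrow>
            inverse_arrows (Loc_Fun C W) (Aw C W R \<eta>) (Ez C W CC e R \<epsilon>))
       \<and> (strongly_symmetric C CC e \<longrightarrow>
            inverse_arrows (Loc_Fun C W) (Aw C W R \<eta>) (Ez_strong C W CC e R \<epsilon>))"
proof (intro conjI impI)
  assume a: "weakly_saturated (Simp C) W \<and> W2 C W \<and> symmetric C W CC e"
  then interpret symmetric_adjunction C CC e R \<eta> \<epsilon>
    using assms(1,6) by (simp add: symmetric_adjunction_def symmetric_adjunction_axioms_def symmetric_def)
  show "inverse_arrows (Loc_Fun C W) (Aw C W R \<eta>) (Ez C W CC e R \<epsilon>)"
    using a by (intro weak_case[OF assms(5)]) (simp_all add: symmetric_def)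
next
  assume a: "strongly_symmetric C CC e"
  then interpret symmetric_adjunction C CC e R \<eta> \<epsilon>
    using assms(1,6) by (simp add: symmetric_adjunction_def symmetric_adjunction_axioms_def strongly_symmetric_def)
  show "inverse_arrows (Loc_Fun C W) (Aw C W R \<eta>) (Ez_strong C W CC e R \<epsilon>)"
    using a by (intro strong_case[OF assms(5)]) (simp add: strongly_symmetric_def)
qed

end
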